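(* (i) Let $\mu,\nu$ be Borel probability measures on $\mathbb R^d$, $\phi\in\{\phi_{\mathsf S},\phi_{\mathsf R}\}$ and $0<\rho<1$. For sequences $k_n\to\infty$, $r_n\to\infty$ with $k_nr_n^{1/2}=O(n^{(1-\rho)/2})$ and $\mathcal G_n=\vec{\mathcal G}^*_{k_n}(\phi,r_n)$, $$\hat\delta_{\mathcal G_n}(X^n,Y^n)\xrightarrow[n\to\infty]{}\delta_{\mathsf{TV}}(\mu,\nu)\quad\mathbb P\text{-a.s.}$$ (ii) Let $\psi$ be an Orlicz function, $M>0$, $0<s\le1$, let $\mathbf r=(r_k)_{k\in\mathbb N}$ be an increasing sequence with $r_k\ge1$ and $r_k\to\infty$, and let $\mathbf m=(m_k)_{k\in\mathbb N}$ be a non-decreasing sequence with $m_k\ge1$. With $\vec c_k:=\vec c_{k,d,s,\mathbf m,\mathbf r}$ (defined in the context) and $\mathcal G_k=\vec{\mathcal G}^{\mathsf R}_k(\vec c_k,r_k)$, there is a constant $C$ depending only on $d,M,s$ such that for all $k,n\in\mathbb N$, $$\sup_{(\mu,\nu)\in\bar{\mathcal P}^2_{\mathsf{TV},\psi}(M,s,\mathbf r,\mathbf m)}\mathbb E\Big[\big|\hat\delta_{\mathcal G_k}(X^n,Y^n)-\delta_{\mathsf{TV}}(\mu,\nu)\big|\Big]\le C\bigg(\Big(m_k^{d+2}r_k^{s(d+1)}k^{-\frac s2}\Big)^{\frac1{s+d+2}}+n^{-1/2}\Big(m_kr_k^{s+1}k^{\frac12}\Big)^{\frac{d+2}{s+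d+2}}+\big(\psi(r_kM^{-1})\big)^{-1}\bigg).$$
   Context: $\delta_{\mathsf{TV}}(\mu,\nu)=\sup_{\mathcal C}2|\mu(\mathcal C)-\nu(\mathcal C)|$ over Borel sets. $\lambda$ is Lebesgue measure, $p,q$ the Lebesgue densities of $\mu,\nu$ when these exist. $B_d(r)$ is the Euclidean ball of radius $r$ centered at $0$. Orlicz: an Orlicz function is an increasing convex $\psi:[0,\infty)\to[0,\infty)$ with $\psi(0)=0$, $\lim_{x\to\infty}\psi(x)=\infty$. $L_\psi(M)=\{f:\|f\|_\psi\le M\}$ with $\|f\|_\psi=\inf\{c>0:\int_{\mathbb R^d}\psi(\|x\|/c)f(x)dx\le1\}$. $f_{\mathsf{TV}}=\mathbf 1_{\mathcal C^*}-\mathbf 1_{\mathbb R^d\setminus\mathcal C^*}$ with $\mathcal C^*=\{x:p(x)\ge q(x)\}$. For $f\in L^1(\mathbb R^d)$, $\xi_{1,1}(f,t)=\sup_{\|u\|\le t}\|f(\cdot+u)-f\|_{L^1(\mathbb R^d)}$, $\|f\|_{\mathsf{Lip}(s,1)}=\|f\|_{L^1}+\sup_{t>0}t^{-s}\xi_{1,1}(f,t)$, and $\mathsf{Lip}_{s,1,b}(\mathcal X)=\{f\in L^1(\mathbb R^d):\|f\|_{\mathsf{Lip}(s,1)}\le b,\ \mathrm{supp}(f)=\mathcal X\}$. $\bar{\mathcal P}^2_{\mathsf{TV},\psi}(M,s,\mathbf r,\mathbf m)$ is the set of pairs of Borel probability measures $\mu,\nu\ll\lambda$ on $\mathbb R^d$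 with $\|p\vee q\|_{\infty,\mathbb R^d}\le M$, $p,q\in L_\psi(M)$, and $f_{\mathsf{TV}}\mathbf 1_{B_d(r_k)}\in\mathsf{Lip}_{s,1,m_k}(B_d(r_k))$ for all $k\in\mathbb N$. Constant: for $r,t>0$ let $\check c_{d,r,t}=r^{d+1}\frac{d\,\pi^{d/2}}{\Gamma(d/2+1)}\int_{\mathbb R^d}\|\omega\|^2e^{-t^2\|\omega\|^2/2}d\omega$ and $\breve c_{d,r,t}=\check c_{d,r,t}\vee1\vee\big((2d\pi^{-d})^{1/2}\Gamma(\tfrac{d+1}2)t^{-1}\big)$. Then $\vec c_{k,d,s,\mathbf m,\mathbf r}:=\breve c_{d,r_k,t^*_{k,s}}$ with $t^*_{k,s}=\big(r_k^{d+1}k^{-1/2}m_k^{-1}\big)^{1/(s+d+2)}$. Neural networks: $\mathcal G_k(a_1,a_2,a_3,a_4,\phi)$ is the set of $g(x)=\sum_{i=1}^k\beta_i\phi(w_i\cdot x+b_i)+w_0\cdot x+b_0$ on $\mathbb R^d$ with $\|w_i\|_1\vee|b_i|\le a_1$, $|\beta_i|\le a_2$ ($1\le i\le k$), $|b_0|\le a_3$, $\|w_0\|_1\le a_4$. $\phi_{\mathsf S}(z)=(1+e^{-z})^{-1}$, $\phi_{\mathsf R}(z)=\max\{z,0\}$. $\bar{\mathcal G}_k(\mathbf a,\phi)$ is the set of functions $\max\{-1,\min\{1,\tilde g\}\}$, $\tilde g\in\mathcal G_k(\mathbf a,\phi)$. $\vec{\mathcal G}^{\mathsf R}_k(a,r)=\{g\mathbf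 1_{B_d(r)}:g\in\bar{\mathcal G}_k(1,2k^{-1}a,a,a,\phi_{\mathsf R})\}$ and $\vec{\mathcal G}^*_k(\phi,r)=\{g\mathbf 1_{B_d(r)}:g\in\bar{\mathcal G}_k(1,1,1,0,\phi)\}$. Estimator: $\hat\delta_{\mathcal G}(X^n,Y^n)=\sup_{g\in\mathcal G}\frac1n\sum_{i=1}^n[g(X_i)-g(Y_i)]$, where $(X_i)$ are i.i.d. from $\mu$ and $(Y_i)$ i.i.d. from $\nu$ (independent samples). *)

theory Defs
  imports "HOL-Probability.Probability" "HOL-Library.Landau_Symbols"
begin

text \<open>
  Throughout, the ambient space is \<^typ>\<open>real ^ 'd\<close>, so that the dimension is \<^term>\<open>CARD('d)\<close>
  and \<^term>\<open>norm\<close> is the Euclidean norm.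
\<close>

definition borel_prob :: "(real ^ 'd::finite) measure \<Rightarrow> bool" where
  "borel_prob \<mu> \<longleftrightarrow> prob_space \<mu> \<and> sets \<mu> = sets borel"

text \<open>The normalisation with the factor 2, so that the values range over the interval from 0 to 2.\<close>

definition tv_dist :: "(real ^ 'd::finite) measure \<Rightarrow> (real ^ 'd) measure \<Rightarrow> real" where
  "tv_dist \<mu> \<nu> = (SUP C\<in>sets borel. 2 * \<bar>measure \<mu> C - measure \<nu> C\<bar>)"

definition leb_density :: "(real ^ 'd::finite) measure \<Rightarrow> real ^ 'd \<Rightarrow> real" where
  "leb_density \<mu> x = enn2real (RN_deriv lborel \<mu> x)"

definition linf_norm :: "(real ^ 'd::finite \<Rightarrow> real) \<Rightarrow> ereal" where
  "linf_norm f = esssup lborel (\<lambda>x. ereal \<bar>f x\<bar>)"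

definition l1_norm :: "(real ^ 'd::finite \<Rightarrow> real) \<Rightarrow> ennreal" where
  "l1_norm f = (\<integral>\<^sup>+x. ennreal \<bar>f x\<bar> \<partial>lborel)"

text \<open>
  An Orlicz function is only constrained on the nonnegative half-line. ``Increasing'' is taken in
  the weak sense, so an Orlicz function may vanish on an initial interval.
\<close>

definition orlicz_function :: "(real \<Rightarrow> real) \<Rightarrow> bool" where
  "orlicz_function \<psi> \<longleftrightarrow> (\<forall>x\<ge>0. 0 \<le> \<psi> x) \<and> mono_on {0..} \<psi> \<and> convex_on {0..} \<psi> \<and>
     \<psi> 0 = 0 \<and> filterlim \<psi> at_top at_top"

text \<open>
  Taken in \<^typ>\<open>ennreal\<close>, so that the infimum of the empty set is infinite. It is meant for
  nonnegative functions (densities): the nonnegative integral truncates negative values at 0.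
\<close>

definition orlicz_norm :: "(real \<Rightarrow> real) \<Rightarrow> (real ^ 'd::finite \<Rightarrow> real) \<Rightarrow> ennreal" where
  "orlicz_norm \<psi> f =
     (INF c\<in>{c. 0 < c \<and> (\<integral>\<^sup>+x. ennreal (\<psi> (norm x / c) * f x) \<partial>lborel) \<le> 1}. ennreal c)"

definition L_orlicz :: "(real \<Rightarrow> real) \<Rightarrow> real \<Rightarrow> (real ^ 'd::finite \<Rightarrow> real) set" where
  "L_orlicz \<psi> M = {f. orlicz_norm \<psi> f \<le> ennreal M}"

definition f_tv :: "(real ^ 'd::finite) measure \<Rightarrow> (real ^ 'd) measure \<Rightarrow> real ^ 'd \<Rightarrow> real" where
  "f_tv \<mu> \<nu> x =
     (let C = {y. leb_density \<mu> y \<ge> leb_density \<nu> y} in indicat_real C x - indicat_real (- C) x)"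

definition l1_modulus :: "(real ^ 'd::finite \<Rightarrow> real) \<Rightarrow> real \<Rightarrow> ennreal" where
  "l1_modulus f t = (SUP u\<in>{u. norm u \<le> t}. l1_norm (\<lambda>x. f (x + u) - f x))"

definition lip_norm :: "real \<Rightarrow> (real ^ 'd::finite \<Rightarrow> real) \<Rightarrow> ennreal" where
  "lip_norm s f = l1_norm f + (SUP t\<in>{0<..}. ennreal (t powr (- s)) * l1_modulus f t)"

definition Lip_class :: "real \<Rightarrow> real \<Rightarrow> (real ^ 'd::finite) set \<Rightarrow> (real ^ 'd \<Rightarrow> real) set" where
  "Lip_class s b S =
     {f. integrable lborel f \<and> lip_norm s f \<le> ennreal b \<and> closure {x. f x \<noteq> 0} = S}"

text \<open>Sequences are indexed by the positive integers; their value at 0 is never used.\<close>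

definition P_tv :: "(real \<Rightarrow> real) \<Rightarrow> real \<Rightarrow> real \<Rightarrow> (nat \<Rightarrow> real) \<Rightarrow> (nat \<Rightarrow> real) \<Rightarrow>
    ((real ^ 'd::finite) measure \<times> (real ^ 'd) measure) set" where
  "P_tv \<psi> M s r m = {(\<mu>, \<nu>).
     borel_prob \<mu> \<and> borel_prob \<nu> \<and>
     absolutely_continuous lborel \<mu> \<and> absolutely_continuous lborel \<nu> \<and>
     linf_norm (\<lambda>x. max (leb_density \<mu> x) (leb_density \<nu> x)) \<le> ereal M \<and>
     leb_density \<mu> \<in> L_orlicz \<psi> M \<and> leb_density \<nu> \<in> L_orlicz \<psi> M \<and>
     (\<forall>k\<ge>1. (\<lambda>x. f_tv \<mu> \<nu> x * indicat_real (cball 0 (r k)) x)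
               \<in> Lip_class s (m k) (cball 0 (r k)))}"

definition c_check :: "'d::finite itself \<Rightarrow> real \<Rightarrow> real \<Rightarrow> real" where
  "c_check T r t = r ^ (CARD('d) + 1)
     * (CARD('d) * pi powr (CARD('d) / 2) / Gamma (CARD('d) / 2 + 1))
     * (\<integral>\<omega>. (norm \<omega>)\<^sup>2 * exp (- (t\<^sup>2 * (norm \<omega>)\<^sup>2 / 2)) \<partial>(lborel :: (real ^ 'd) measure))"

definition c_breve :: "'d::finite itself \<Rightarrow> real \<Rightarrow> real \<Rightarrow> real" where
  "c_breve T r t = max (c_check T r t)
     (max 1 (sqrt (2 * CARD('d) * pi powr (- real CARD('d))) * Gamma ((CARD('d) + 1) / 2) / t))"

definition t_star ::
  "'d::finite itself \<Rightarrow> nat \<Rightarrow> real \<Rightarrow> (nat \<Rightarrow> real) \<Rightarrow> (nat \<Rightarrow> real) \<Rightarrow> real" where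
  "t_star T k s m r =
     (r k ^ (CARD('d) + 1) * real k powr (- 1 / 2) / m k) powr (1 / (s + CARD('d) + 2))"

definition c_vec ::
  "'d::finite itself \<Rightarrow> nat \<Rightarrow> real \<Rightarrow> (nat \<Rightarrow> real) \<Rightarrow> (nat \<Rightarrow> real) \<Rightarrow> real" where
  "c_vec T k s m r = c_breve T (r k) (t_star T k s m r)"

definition vec_norm1 :: "real ^ 'd::finite \<Rightarrow> real" where
  "vec_norm1 w = (\<Sum>j\<in>UNIV. \<bar>w $ j\<bar>)"

definition sigmoid :: "real \<Rightarrow> real" where
  "sigmoid z = 1 / (1 + exp (- z))"

definition relu :: "real \<Rightarrow> real" where
  "relu z = max z 0"

definition nn_class :: "nat \<Rightarrow> real \<Rightarrow> real \<Rightarrow> real \<Rightarrow> real \<Rightarrow> (real \<Rightarrow> real) \<Rightarrow>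
    (real ^ 'd::finite \<Rightarrow> real) set" where
  "nn_class k a1 a2 a3 a4 \<phi> =
     {\<lambda>x. (\<Sum>i = 1..k. \<beta> i * \<phi> (w i \<bullet> x + b i)) + w0 \<bullet> x + b0 | \<beta> w b w0 b0.
        (\<forall>i\<in>{1..k}. max (vec_norm1 (w i)) \<bar>b i\<bar> \<le> a1 \<and> \<bar>\<beta> i\<bar> \<le> a2) \<and>
        \<bar>b0\<bar> \<le> a3 \<and> vec_norm1 w0 \<le> a4}"

definition nn_class_clip :: "nat \<Rightarrow> real \<Rightarrow> real \<Rightarrow> real \<Rightarrow> real \<Rightarrow> (real \<Rightarrow> real) \<Rightarrow>
    (real ^ 'd::finite \<Rightarrow> real) set" where
  "nn_class_clip k a1 a2 a3 a4 \<phi> = {\<lambda>x. max (- 1) (min 1 (g x)) | g. g \<in> nn_class k a1 a2 a3 a4 \<phi>}"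

definition G_relu :: "nat \<Rightarrow> real \<Rightarrow> real \<Rightarrow> (real ^ 'd::finite \<Rightarrow> real) set" where
  "G_relu k a r = {\<lambda>x. g x * indicat_real (cball 0 r) x | g.
     g \<in> nn_class_clip k 1 (2 / real k * a) a a relu}"

definition G_star :: "nat \<Rightarrow> (real \<Rightarrow> real) \<Rightarrow> real \<Rightarrow> (real ^ 'd::finite \<Rightarrow> real) set" where
  "G_star k \<phi> r = {\<lambda>x. g x * indicat_real (cball 0 r) x | g. g \<in> nn_class_clip k 1 1 1 0 \<phi>}"

text \<open>Samples are numbered from 0, so the first \<open>n\<close> of them are those with index below \<open>n\<close>.\<close>

definition tv_estimator :: "(real ^ 'd::finite \<Rightarrow> real) set \<Rightarrow> nat \<Rightarrow>
    (nat \<Rightarrow> real ^ 'd) \<Rightarrow> (nat \<Rightarrow> real ^ 'd) \<Rightarrow> real" where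
  "tv_estimator G n x y = (SUP g\<in>G. 1 / real n * (\<Sum>i<n. g (x i) - g (y i)))"

definition iid_samples :: "'w measure \<Rightarrow> (real ^ 'd::finite) measure \<Rightarrow> (real ^ 'd) measure \<Rightarrow>
    (nat \<Rightarrow> 'w \<Rightarrow> real ^ 'd) \<Rightarrow> (nat \<Rightarrow> 'w \<Rightarrow> real ^ 'd) \<Rightarrow> bool" where
  "iid_samples P \<mu> \<nu> X Y \<longleftrightarrow> prob_space P \<and>
     prob_space.indep_vars P (\<lambda>_. borel) (case_sum X Y) (UNIV :: (nat + nat) set) \<and>
     (\<forall>i. distr P borel (X i) = \<mu>) \<and> (\<forall>i. distr P borel (Y i) = \<nu>)"

text \<open>
  The expected absolute error depends on the samples only through their joint law, which is the
  product measure below. Working with this law (rather than on an arbitrary probability space)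
  lets a constant be chosen independently of the type of the sample space.
\<close>

definition sample_law :: "nat \<Rightarrow> (real ^ 'd::finite) measure \<Rightarrow> (real ^ 'd) measure \<Rightarrow>
    ((nat \<Rightarrow> real ^ 'd) \<times> (nat \<Rightarrow> real ^ 'd)) measure" where
  "sample_law n \<mu> \<nu> = Pi\<^sub>M {..<n} (\<lambda>_. \<mu>) \<Otimes>\<^sub>M Pi\<^sub>M {..<n} (\<lambda>_. \<nu>)"

definition expected_error :: "(real ^ 'd::finite \<Rightarrow> real) set \<Rightarrow> nat \<Rightarrow>
    (real ^ 'd) measure \<Rightarrow> (real ^ 'd) measure \<Rightarrow> ennreal" where
  "expected_error G n \<mu> \<nu> =
     (\<integral>\<^sup>+(x, y). ennreal \<bar>tv_estimator G n x y - tv_dist \<mu> \<nu>\<bar> \<partial>sample_law n \<mu> \<nu>)"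

end

theory Submission
  imports Defs "HOL-Real_Asymp.Real_Asymp"
begin

text \<open>
  For both parts the estimation error is a uniform deviation over a finite net of the network class:
  Hoeffding's inequality, a union bound and the Borel--Cantelli lemma give the almost sure statement,
  symmetrization and the contraction principle give the expected error. For the first part, the bias
  vanishes because one-neuron functions with bounded weights span a dense subspace of the continuous
  functions on a compact set.

  For the second part, no Fourier analysis is needed. The kernel
  \<open>K z = (1 + \<parallel>z\<parallel>\<^sup>2) powr (- d - 1 / 2)\<close> is the average of ridge functions \<open>\<kappa> (g \<bullet> z)\<close> over a standard
  Gaussian direction \<open>g\<close>, where \<open>\<kappa>\<close> is a polynomial times a Gaussian, and
  \<open>\<kappa> v = \<integral> \<kappa>'' u * relu (v - u) du\<close>. Smoothing the optimal test function with \<open>K\<close> at scale \<open>t\<close> therefore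
  costs \<open>O(m t powr s)\<close> in \<open>L\<^sup>1\<close> and produces a superposition of rectifiers of total mass
  \<open>O((r / t) ^ (d + 1))\<close>, to which Maurey's argument applies with \<open>k\<close> neurons. If the claimed bias term
  is at least 1 the bound is trivial; otherwise \<open>t < 1\<close>, and this mass fits into the class after
  enlarging \<open>t\<close> by a constant factor.
\<close>

subsection \<open>Rademacher averages\<close>

text \<open>The radius of the class dictates the construction for the second part. Rescaling the
  Gaussian integral in \<open>c_check\<close> shows that it is a constant times
  \<open>r^(d+1) / t^(d+2)\<close>, one factor \<open>1 / t\<close> above the network mass; for
  \<open>t < 1\<close> this factor is to spare, and constants can be hidden in the scale. The value
  \<open>t_star\<close> is the scale at which the smoothing error \<open>m * t^s\<close> equals the
  sampling error \<open>r^(d+1) * t^(-d-2) * k^(-1/2)\<close>. A Gaussian ridge profile alone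
  averages to \<open>(1 + |z|^2)^(-1/2)\<close>, which is not integrable on the whole space; the
  polynomial factor supplies the missing decay. Rectifiers appear because \<open>relu\<close> is a
  fundamental solution of the second derivative on the line. The supremum over the uncountable class
  is never integrated through its own measurability: it is dominated pointwise by a maximum over a
  finite net, which is measurable. The Rademacher bound does not see the size of the net, so there
  the mesh can tend to 0 for free; in the first part the size of the net is what competes with the
  Hoeffding bound.\<close>

primrec rademacher_mean :: "nat \<Rightarrow> ((nat \<Rightarrow> real) \<Rightarrow> real) \<Rightarrow> real" where
  "rademacher_mean 0 h = h (\<lambda>_. 0)"
| "rademacher_mean (Suc n) h =
     (rademacher_mean n (\<lambda>e. h (e(n := 1))) + rademacher_mean n (\<lambda>e. h (e(n := - 1)))) / 2"

text \<open>The recursion evaluates its argument only at patterns with signs 1 and -1 below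
  \<open>n\<close> and 0 from \<open>n\<close> on, all of which satisfy
  \<open>\<bar>e i\<bar> \<le> 1\<close>. Averaging by recursion instead of over a probability space
  of signs lets each later induction peel off one sign.\<close>

lemma rademacher_mean_mono:
  assumes "\<And>e. (\<And>i. \<bar>e i\<bar> \<le> 1) \<Longrightarrow> h e \<le> h' e"
  shows "rademacher_mean n h \<le> rademacher_mean n h'"
  using assms
proof (induction n arbitrary: h h')
  case (Suc n)
  have "rademacher_mean n (\<lambda>e. h (e(n := c))) \<le> rademacher_mean n (\<lambda>e. h' (e(n := c)))" if "\<bar>c\<bar> \<le> 1" for c
    using that by (intro Suc.IH Suc.prems) auto
  from this[of 1] this[of "- 1"] show ?case by simp
qed simp

lemma rademacher_mean_add:
  "rademacher_mean n (\<lambda>e. h e + h' e) = rademacher_mean n h + rademacher_mean n h'"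
  by (induction n arbitrary: h h') (auto simp: field_simps)

lemma rademacher_mean_cmult: "rademacher_mean n (\<lambda>e. c * h e) = c * rademacher_mean n h"
  by (induction n arbitrary: h) (auto simp: field_simps)

lemma rademacher_mean_const: "rademacher_mean n (\<lambda>_. c) = c"
  by (induction n) auto

lemma rademacher_mean_uminus_signs:
  "rademacher_mean n (\<lambda>e. h (\<lambda>i. - e i)) = rademacher_mean n h"
proof (induction n arbitrary: h)
  case (Suc n)
  have "rademacher_mean n (\<lambda>e. h (\<lambda>i. - (e(n := c)) i)) = rademacher_mean n (\<lambda>e. h (e(n := - c)))"
    for c
  proof -
    have "(\<lambda>i. - (e(n := c)) i) = (\<lambda>i. - e i)(n := - c)" for e :: "nat \<Rightarrow> real"
      by auto
    then show ?thesis
      using Suc.IH[of "\<lambda>e. h (e(n := - c))"] by simp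
  qed
  from this[of 1] this[of "- 1"] show ?case by simp
qed auto

lemma rademacher_mean_square_le:
  "(rademacher_mean n h)\<^sup>2 \<le> rademacher_mean n (\<lambda>e. (h e)\<^sup>2)"
proof (induction n arbitrary: h)
  case (Suc n)
  let ?a = "rademacher_mean n (\<lambda>e. h (e(n := 1)))" and ?b = "rademacher_mean n (\<lambda>e. h (e(n := - 1)))"
  have "((?a + ?b) / 2)\<^sup>2 \<le> (?a\<^sup>2 + ?b\<^sup>2) / 2"
    using sum_squares_bound[of ?a ?b] by (simp add: power2_eq_square field_simps)
  also have "\<dots> \<le> rademacher_mean (Suc n) (\<lambda>e. (h e)\<^sup>2)"
    using Suc.IH[of "\<lambda>e. h (e(n := 1))"] Suc.IH[of "\<lambda>e. h (e(n := - 1))"] by simp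
  finally show ?case by simp
qed auto

text \<open>Distinct signs are orthogonal: the cross terms for \<open>e n = 1\<close> and
  \<open>e n = - 1\<close> cancel. The free offset \<open>c\<close> carries the vectors whose signs
  are already fixed through the induction.\<close>

lemma rademacher_mean_norm_square:
  fixes v :: "nat \<Rightarrow> 'a::real_inner"
  shows "rademacher_mean n (\<lambda>e. (norm (c + (\<Sum>i<n. e i *\<^sub>R v i)))\<^sup>2) = (norm c)\<^sup>2 + (\<Sum>i<n. (norm (v i))\<^sup>2)"
proof (induction n arbitrary: c)
  case (Suc n)
  have *: "rademacher_mean n (\<lambda>e. (norm (c + (\<Sum>i<Suc n. (e(n := t)) i *\<^sub>R v i)))\<^sup>2)
      = (norm (c + t *\<^sub>R v n))\<^sup>2 + (\<Sum>i<n. (norm (v i))\<^sup>2)" for t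
  proof -
    have "(\<Sum>i<n. (e(n := t)) i *\<^sub>R v i) = (\<Sum>i<n. e i *\<^sub>R v i)" for e
      by (intro sum.cong) auto
    then show ?thesis
      using Suc.IH[of "c + t *\<^sub>R v n"] by (simp add: algebra_simps)
  qed
  show ?case
    by (simp only: rademacher_mean.simps *)
       (simp add: power2_norm_eq_inner algebra_simps inner_commute)
qed auto

text \<open>Jensen's inequality passes from the norm to its square, which orthogonality evaluates as
  a sum of \<open>n\<close> terms.\<close>

lemma rademacher_mean_norm_le:
  fixes v :: "nat \<Rightarrow> 'a::real_inner"
  assumes "\<And>i. i < n \<Longrightarrow> norm (v i) \<le> b" "0 \<le> b"
  shows "rademacher_mean n (\<lambda>e. norm (\<Sum>i<n. e i *\<^sub>R v i)) \<le> b * sqrt n"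
proof (rule power2_le_imp_le)
  have "(rademacher_mean n (\<lambda>e. norm (\<Sum>i<n. e i *\<^sub>R v i)))\<^sup>2
      \<le> (\<Sum>i<n. (norm (v i))\<^sup>2)"
    using rademacher_mean_square_le[of n "\<lambda>e. norm (\<Sum>i<n. e i *\<^sub>R v i)"]
      rademacher_mean_norm_square[of n 0 v] by simp
  also have "\<dots> \<le> (\<Sum>i<n. b\<^sup>2)"
    using assms by (intro sum_mono power_mono) auto
  finally show "(rademacher_mean n (\<lambda>e. norm (\<Sum>i<n. e i *\<^sub>R v i)))\<^sup>2 \<le> (b * sqrt n)\<^sup>2"
    by (simp add: power_mult_distrib mult.commute)
qed (use assms in simp)

text \<open>The contraction principle for a single sign. If \<open>t\<close> and \<open>s\<close>
  maximize the two expressions on the left, their sum is \<open>A t + A s + (a t - a s)\<close>, at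
  most \<open>A t + A s + \<bar>b t - b s\<bar>\<close>; according to the sign of
  \<open>b t - b s\<close>, the pair \<open>(t, s)\<close> or \<open>(s, t)\<close> competes on the
  right.\<close>

lemma Max_image_add_Max_image_diff_le:
  fixes A a b :: "'t \<Rightarrow> real"
  assumes "finite T" "T \<noteq> {}" "\<And>s t. s \<in> T \<Longrightarrow> t \<in> T \<Longrightarrow> \<bar>a t - a s\<bar> \<le> \<bar>b t - b s\<bar>"
  shows "(MAX t\<in>T. A t + a t) + (MAX t\<in>T. A t - a t) \<le> (MAX t\<in>T. A t + b t) + (MAX t\<in>T. A t - b t)"
proof -
  have "(MAX t\<in>T. A t + a t) \<in> (\<lambda>t. A t + a t) ` T" "(MAX t\<in>T. A t - a t) \<in> (\<lambda>t. A t - a t) ` T"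
    using assms(1,2) by (intro Max_in; simp)+
  then obtain t s where ts: "t \<in> T" "s \<in> T" "(MAX t\<in>T. A t + a t) = A t + a t" "(MAX t\<in>T. A t - a t) = A s - a s"
    by blast
  have "A u + b u \<le> (MAX t\<in>T. A t + b t)" "A u - b u \<le> (MAX t\<in>T. A t - b t)" if "u \<in> T" for u
    using that assms(1) by (auto intro!: Max_ge)
  from this[OF ts(1)] this[OF ts(2)] show ?thesis
    using assms(3)[OF ts(1,2)] assms(3)[OF ts(2,1)] ts(3,4) by linarith
qed

text \<open>The contraction principle of Ledoux and Talagrand, stated as a comparison of increments.\<close>

lemma rademacher_contraction:
  fixes a b :: "nat \<Rightarrow> 't \<Rightarrow> real"
  assumes T: "finite T" "T \<noteq> {}"
    and le: "\<And>i s t. i < n \<Longrightarrow> s \<in> T \<Longrightarrow> t \<in> T \<Longrightarrow> \<bar>a i t - a i s\<bar> \<le> \<bar>b i t - b i s\<bar>"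
  shows "rademacher_mean n (\<lambda>e. MAX t\<in>T. c t + (\<Sum>i<n. e i * a i t))
       \<le> rademacher_mean n (\<lambda>e. MAX t\<in>T. c t + (\<Sum>i<n. e i * b i t))"
  using le
proof (induction n arbitrary: c)
  case (Suc n)
  have split: "rademacher_mean n (\<lambda>e. MAX t\<in>T. c t + (\<Sum>i<Suc n. (e(n := x)) i * d i t))
     = rademacher_mean n (\<lambda>e. MAX t\<in>T. (c t + x * d n t) + (\<Sum>i<n. e i * d i t))" for x d
  proof -
    have "(\<Sum>i<n. (e(n := x)) i * d i t) = (\<Sum>i<n. e i * d i t)" for e t
      by (intro sum.cong) auto
    then show ?thesis
      by (simp add: algebra_simps)
  qed
  have "rademacher_mean (Suc n) (\<lambda>e. MAX t\<in>T. c t + (\<Sum>i<Suc n. e i * a i t))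
     = (rademacher_mean n (\<lambda>e. MAX t\<in>T. (c t + 1 * a n t) + (\<Sum>i<n. e i * a i t))
       + rademacher_mean n (\<lambda>e. MAX t\<in>T. (c t + (-1) * a n t) + (\<Sum>i<n. e i * a i t))) / 2"
    unfolding rademacher_mean.simps split ..
  also have "\<dots> \<le> (rademacher_mean n (\<lambda>e. MAX t\<in>T. (c t + 1 * a n t) + (\<Sum>i<n. e i * b i t))
       + rademacher_mean n (\<lambda>e. MAX t\<in>T. (c t + (-1) * a n t) + (\<Sum>i<n. e i * b i t))) / 2"
    by (intro divide_right_mono add_mono Suc.IH Suc.prems) auto
  \<comment> \<open>The two averages are merged before comparing: with the earlier signs fixed, the
    inequality is available for the sum over both values of the last sign.\<close>
  also have "\<dots> \<le> (rademacher_mean n (\<lambda>e. MAX t\<in>T. (c t + 1 * b n t) + (\<Sum>i<n. e i * b i t))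
       + rademacher_mean n (\<lambda>e. MAX t\<in>T. (c t + (-1) * b n t) + (\<Sum>i<n. e i * b i t))) / 2"
    unfolding rademacher_mean_add[symmetric]
  proof (intro divide_right_mono rademacher_mean_mono)
    fix e :: "nat \<Rightarrow> real"
    show "(MAX t\<in>T. c t + 1 * a n t + (\<Sum>i<n. e i * b i t)) + (MAX t\<in>T. c t + - 1 * a n t + (\<Sum>i<n. e i * b i t))
      \<le> (MAX t\<in>T. c t + 1 * b n t + (\<Sum>i<n. e i * b i t)) + (MAX t\<in>T. c t + - 1 * b n t + (\<Sum>i<n. e i * b i t))"
      using Max_image_add_Max_image_diff_le[where A = "\<lambda>t. c t + (\<Sum>i<n. e i * b i t)", OF T Suc.prems(1)[of n]]
      by (simp add: algebra_simps)
  qed auto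
  also have "\<dots> = rademacher_mean (Suc n) (\<lambda>e. MAX t\<in>T. c t + (\<Sum>i<Suc n. e i * b i t))"
    unfolding rademacher_mean.simps split ..
  finally show ?case .
qed auto

lemma borel_measurable_rademacher_mean:
  assumes "\<And>e. h e \<in> borel_measurable M"
  shows "(\<lambda>x. rademacher_mean n (\<lambda>e. h e x)) \<in> borel_measurable M"
  using assms
proof (induction n arbitrary: h)
  case (Suc n)
  have [measurable]: "(\<lambda>x. rademacher_mean n (\<lambda>e. h (e(n := c)) x)) \<in> borel_measurable M" for c
    by (rule Suc.IH[of "\<lambda>e. h (e(n := c))"]) (rule Suc.prems)
  show ?case by simp
qed auto

lemma abs_rademacher_mean_le:
  assumes "\<And>e. (\<And>i. \<bar>e i\<bar> \<le> 1) \<Longrightarrow> \<bar>h e\<bar> \<le> b"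
  shows "\<bar>rademacher_mean n h\<bar> \<le> b"
proof -
  have "h e \<le> b \<and> - b \<le> h e" if "\<And>i. \<bar>e i\<bar> \<le> 1" for e :: "nat \<Rightarrow> real"
  proof -
    have "\<bar>h e\<bar> \<le> b" by (rule assms) (rule that)
    then show ?thesis by auto
  qed
  then have "rademacher_mean n h \<le> rademacher_mean n (\<lambda>_. b)" "rademacher_mean n (\<lambda>_. - b) \<le> rademacher_mean n h"
    by (auto intro!: rademacher_mean_mono)
  then show ?thesis by (simp add: rademacher_mean_const)
qed

lemma abs_Max_image_le:
  fixes f :: "'t \<Rightarrow> real"
  assumes "finite T" "T \<noteq> {}" "\<And>t. t \<in> T \<Longrightarrow> \<bar>f t\<bar> \<le> b"
  shows "\<bar>MAX t\<in>T. f t\<bar> \<le> b"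
proof -
  have "(MAX t\<in>T. f t) \<in> f ` T"
    using assms by (intro Max_in) auto
  then show ?thesis using assms(3) by auto
qed

section \<open>Symmetrization on a product space\<close>

context prob_space
begin

context
  fixes T :: "'t set" and g :: "'t \<Rightarrow> 'a \<Rightarrow> real" and b :: real
  assumes T: "finite T" "T \<noteq> {}"
    and g: "\<And>t. t \<in> T \<Longrightarrow> g t \<in> borel_measurable M" "\<And>t x. t \<in> T \<Longrightarrow> \<bar>g t x\<bar> \<le> b"
begin

lemma integrable_Max_bounded:
  assumes "prob_space N" "\<And>t. t \<in> T \<Longrightarrow> f t \<in> borel_measurable N" "\<And>t x. t \<in> T \<Longrightarrow> \<bar>f t x\<bar> \<le> B"
  shows "integrable N (\<lambda>x. MAX t\<in>T. f t x :: real)"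
proof -
  interpret N: prob_space N by fact
  show ?thesis
    using T assms by (intro N.integrable_const_bound[of _ B] borel_measurable_Max)
      (auto intro!: abs_Max_image_le)
qed

text \<open>Each \<open>A t + (g t y - expectation (g t))\<close> is the mean of
  \<open>A t + 2 * g t y\<close> and \<open>A t - 2 * expectation (g t)\<close>, and the latter is
  at most the expectation of the maximum of \<open>A t - 2 * g t y'\<close>. After integration over
  \<open>y\<close> the variable \<open>y'\<close> can be renamed, so no ghost sample is introduced.
  This is the origin of the factor 2 in front of \<open>g\<close>.\<close>

lemma symmetrization_step:
  "(\<integral>y. (MAX t\<in>T. A t + (g t y - expectation (g t))) \<partial>M)
    \<le> (\<integral>y. ((MAX t\<in>T. A t + 2 * g t y) + (MAX t\<in>T. A t - 2 * g t y)) / 2 \<partial>M)"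
proof -
  obtain B where B: "\<And>t. t \<in> T \<Longrightarrow> \<bar>A t\<bar> \<le> B"
    using T(1) finite_imageI[of T "\<lambda>t. \<bar>A t\<bar>"] by (meson Max_ge image_eqI)
  have int_g: "integrable M (g t)" if "t \<in> T" for t
    using g that by (intro integrable_const_bound[of _ b]) auto
  have b0: "\<bar>g t x * c\<bar> \<le> b * \<bar>c\<bar>" if "t \<in> T" for t x c
    using g(2)[OF that] by (simp add: abs_mult mult_right_mono)
  have int: "integrable M (\<lambda>y. MAX t\<in>T. A t + g t y * c)" for c
    using g(1) B b0 by (intro integrable_Max_bounded[of _ _ "B + b * \<bar>c\<bar>"])
       (auto intro!: order.trans[OF abs_triangle_ineq add_mono] simp: prob_space_axioms)
  have int2: "integrable M (\<lambda>y. MAX t\<in>T. A t + g t y * c + d t)" for c d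
  proof -
    obtain D where D: "\<And>t. t \<in> T \<Longrightarrow> \<bar>d t\<bar> \<le> D"
      using T(1) finite_imageI[of T "\<lambda>t. \<bar>d t\<bar>"] by (meson Max_ge image_eqI)
    show ?thesis
      using g(1) B b0 D by (intro integrable_Max_bounded[of _ _ "B + b * \<bar>c\<bar> + D"])
        (auto intro!: order.trans[OF abs_triangle_ineq add_mono] simp: prob_space_axioms)
  qed
  have pt: "(MAX t\<in>T. A t + (g t y - expectation (g t)))
     \<le> (MAX t\<in>T. A t + 2 * g t y) / 2 + (\<integral>y'. (MAX t\<in>T. A t - 2 * g t y') / 2 \<partial>M)" for y
  proof (subst Max_le_iff, goal_cases)
    case 3
    show ?case
    proof
    fix a assume "a \<in> (\<lambda>t. A t + (g t y - expectation (g t))) ` T"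
    then obtain t where t: "t \<in> T" "a = A t + (g t y - expectation (g t))" by auto
    have "A t - 2 * expectation (g t) = (\<integral>y'. A t - 2 * g t y' \<partial>M)"
      using int_g[OF t(1)] by (simp add: prob_space)
    also have "\<dots> \<le> (\<integral>y'. (MAX t\<in>T. A t - 2 * g t y') \<partial>M)"
      using int_g[OF t(1)] int[of "-2"] T t by (intro integral_mono) (auto intro!: Max_ge simp: mult.commute)
    finally have "A t - 2 * expectation (g t) \<le> (\<integral>y'. (MAX t\<in>T. A t - 2 * g t y') \<partial>M)" .
    moreover have "A t + 2 * g t y \<le> (MAX t\<in>T. A t + 2 * g t y)"
      using T t by (auto intro!: Max_ge)
    ultimately show "a \<le> (MAX t\<in>T. A t + 2 * g t y) / 2 + (\<integral>y'. (MAX t\<in>T. A t - 2 * g t y') / 2 \<partial>M)"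
      using t(2) by simp
    qed
  qed (use T in auto)
  have "(\<integral>y. (MAX t\<in>T. A t + (g t y - expectation (g t))) \<partial>M)
    \<le> (\<integral>y. (MAX t\<in>T. A t + 2 * g t y) / 2 + (\<integral>y'. (MAX t\<in>T. A t - 2 * g t y') / 2 \<partial>M) \<partial>M)"
    using int2[of 1 "\<lambda>t. - expectation (g t)"] int[of 2] int[of "-2"]
    by (intro integral_mono pt) (auto simp: algebra_simps)
  also have "\<dots> = (\<integral>y. (MAX t\<in>T. A t + 2 * g t y) / 2 + (MAX t\<in>T. A t - 2 * g t y) / 2 \<partial>M)"
    using int[of 2] int[of "-2"] by (simp add: algebra_simps prob_space)
  finally show ?thesis by (simp add: add_divide_distrib)
qed

text \<open>The coordinates are symmetrized one at a time, the rest being absorbed in the offset.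
  \<open>symmetrization_step\<close> treats the last coordinate with the others fixed; Fubini then
  exchanges the roles, and the induction hypothesis applies for a fixed last coordinate
  \<open>y\<close> with offset \<open>c t + s * g t y\<close>, where \<open>s\<close> is 2 or
  -2.\<close>

lemma symmetrization:
  fixes c :: "'t \<Rightarrow> real" and n :: nat
  shows "(\<integral>x. (MAX t\<in>T. c t + (\<Sum>i<n. g t (x i) - expectation (g t))) \<partial>(Pi\<^sub>M {..<n} (\<lambda>_. M)))
    \<le> (\<integral>x. rademacher_mean n (\<lambda>e. MAX t\<in>T. c t + (\<Sum>i<n. e i * (2 * g t (x i)))) \<partial>(Pi\<^sub>M {..<n} (\<lambda>_. M)))"
proof (induction n arbitrary: c)
  case 0
  then show ?case by simp
next
  case (Suc n)
  let ?P = "\<lambda>n::nat. Pi\<^sub>M {..<n} (\<lambda>_. M)"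
  have P: "prob_space (?P n)" for n
    by (rule prob_space_PiM) (rule prob_space_axioms)
  interpret PP: product_prob_space "\<lambda>_. M" "UNIV :: nat set"
    by unfold_locales
  interpret Pn: prob_space "?P n" by (fact P)
  interpret PS: prob_space "?P (Suc n)" by (fact P)
  interpret PM: pair_prob_space "?P n" M
    by unfold_locales
  have upd: "(\<lambda>(x, y). x(n := y)) \<in> measurable (?P n \<Otimes>\<^sub>M M) (?P (Suc n))"
    using measurable_add_dim[of n "{..<n}" "\<lambda>_. M"] by (simp add: lessThan_Suc)
  have ins: "integral\<^sup>L (?P (Suc n)) f = (\<integral>x. (\<integral>y. f (x(n := y)) \<partial>M) \<partial>?P n)"
    "integral\<^sup>L (?P (Suc n)) f = (\<integral>y. (\<integral>x. f (x(n := y)) \<partial>?P n) \<partial>M)"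
    "integrable M (\<lambda>y. \<integral>x. f (x(n := y)) \<partial>?P n)"
    "integrable (?P n) (\<lambda>x. \<integral>y. f (x(n := y)) \<partial>M)"
    if f: "f \<in> borel_measurable (?P (Suc n))" "\<And>z. \<bar>f z\<bar> \<le> K" for f :: "_ \<Rightarrow> real" and K
  proof -
    have m: "(\<lambda>(x, y). f (x(n := y))) \<in> borel_measurable (?P n \<Otimes>\<^sub>M M)"
      using measurable_compose[OF upd f(1)] by (simp add: case_prod_unfold)
    have int: "integrable (?P n \<Otimes>\<^sub>M M) (\<lambda>(x, y). f (x(n := y)))"
      using m f(2) by (intro PM.integrable_const_bound[of _ K]) auto
    have "integrable (?P (Suc n)) f"
      using f by (intro PS.integrable_const_bound[of _ K]) auto
    then have intS: "integrable (Pi\<^sub>M (insert n {..<n}) (\<lambda>_. M)) f"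
      by (simp only: lessThan_Suc)
    show 1: "integral\<^sup>L (?P (Suc n)) f = (\<integral>x. (\<integral>y. f (x(n := y)) \<partial>M) \<partial>?P n)"
      unfolding lessThan_Suc
      by (rule PP.product_integral_insert[OF finite_lessThan _ intS]) simp
    show "integral\<^sup>L (?P (Suc n)) f = (\<integral>y. (\<integral>x. f (x(n := y)) \<partial>?P n) \<partial>M)"
      unfolding 1 using PM.Fubini_integral[OF int] by simp
    show "integrable M (\<lambda>y. \<integral>x. f (x(n := y)) \<partial>?P n)" "integrable (?P n) (\<lambda>x. \<integral>y. f (x(n := y)) \<partial>M)"
      using PM.integrable_snd[OF int] PM.integrable_fst[OF int] by auto
  qed
  obtain B where B: "\<And>t. t \<in> T \<Longrightarrow> \<bar>c t\<bar> \<le> B"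
    using T(1) finite_imageI[of T "\<lambda>t. \<bar>c t\<bar>"] by (meson Max_ge image_eqI)
  have b: "0 \<le> b"
    using T(2) g(2) by (meson abs_ge_zero ex_in_conv order.trans)
  have Eg: "\<bar>expectation (g t)\<bar> \<le> b" if "t \<in> T" for t
  proof -
    have "integrable M (g t)"
      using g that by (intro integrable_const_bound[of _ b]) auto
    then show ?thesis
      using g(2)[OF that] integral_le_const[of "g t" b] integral_ge_const[of "g t" "- b"]
      by (auto simp: abs_le_iff minus_le_iff)
  qed
  have dev: "\<bar>g t u - expectation (g t)\<bar> \<le> 2 * b" if "t \<in> T" for t u
    using g(2)[OF that, of u] Eg[OF that] by linarith
  have bd1: "\<bar>MAX t\<in>T. (c t + s * g t y) + (\<Sum>i<n. g t (x i) - expectation (g t))\<bar> \<le> B + \<bar>s\<bar> * b + n * (2 * b)" for s y x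
  proof (rule abs_Max_image_le[OF T])
    fix t assume t: "t \<in> T"
    have "\<bar>\<Sum>i<n. g t (x i) - expectation (g t)\<bar> \<le> (\<Sum>i<n. 2 * b)"
      by (rule order.trans[OF sum_abs sum_mono]) (use dev[OF t] in simp)
    moreover have "\<bar>s * g t y\<bar> \<le> \<bar>s\<bar> * b"
      using g(2)[OF t] by (simp add: abs_mult mult_left_mono)
    ultimately show "\<bar>(c t + s * g t y) + (\<Sum>i<n. g t (x i) - expectation (g t))\<bar> \<le> B + \<bar>s\<bar> * b + n * (2 * b)"
      using B[OF t] by simp
  qed
  have bd2: "\<bar>rademacher_mean n (\<lambda>e. MAX t\<in>T. (c t + s * g t y) + (\<Sum>i<n. e i * (2 * g t (x i))))\<bar>
      \<le> B + \<bar>s\<bar> * b + n * (2 * b)" for s y x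
  proof (rule abs_rademacher_mean_le, rule abs_Max_image_le[OF T])
    fix t and e :: "nat \<Rightarrow> real" assume t: "t \<in> T" and e: "\<And>i. \<bar>e i\<bar> \<le> 1"
    have "\<bar>e i * (2 * g t (x i))\<bar> \<le> 1 * (2 * b)" for i
      unfolding abs_mult using g(2)[OF t] e by (intro mult_mono) auto
    then have "\<bar>\<Sum>i<n. e i * (2 * g t (x i))\<bar> \<le> (\<Sum>i<n. 2 * b)"
      by (intro order.trans[OF sum_abs sum_mono]) auto
    moreover have "\<bar>s * g t y\<bar> \<le> \<bar>s\<bar> * b"
      using g(2)[OF t] by (simp add: abs_mult mult_left_mono)
    ultimately show "\<bar>(c t + s * g t y) + (\<Sum>i<n. e i * (2 * g t (x i)))\<bar> \<le> B + \<bar>s\<bar> * b + n * (2 * b)"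
      using B[OF t] by simp
  qed
  have gm[measurable]: "(\<lambda>z. g t (z i)) \<in> borel_measurable (?P (Suc n))" if "t \<in> T" "i < Suc n" for t i
    using that g(1) by (intro measurable_compose[OF measurable_component_singleton]) auto
  have gm'[measurable]: "(\<lambda>z. g t (z i)) \<in> borel_measurable (?P n)" if "t \<in> T" "i < n" for t i
    using that g(1) by (intro measurable_compose[OF measurable_component_singleton]) auto
  \<comment> \<open>\<open>L\<close> is the original maximum, \<open>F s\<close> has only the last
    coordinate replaced by its signed version, and \<open>Q s\<close> has all of them symmetrized.
    All three are bounded everywhere, which yields every integrability condition of Fubini.\<close>
  define F where "F s z = (MAX t\<in>T. (c t + s * g t (z n)) + (\<Sum>i<n. g t (z i) - expectation (g t)))" for s z
  define L where "L z = (MAX t\<in>T. c t + (\<Sum>i<Suc n. g t (z i) - expectation (g t)))" for z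
  define Q where "Q s z = rademacher_mean n (\<lambda>e. MAX t\<in>T. (c t + s * g t (z n)) + (\<Sum>i<n. e i * (2 * g t (z i))))" for s z
  have mF: "F s \<in> borel_measurable (?P (Suc n))" for s
    unfolding F_def using T gm by (intro borel_measurable_Max borel_measurable_add borel_measurable_sum) auto
  have mL: "L \<in> borel_measurable (?P (Suc n))"
    unfolding L_def using T gm by (intro borel_measurable_Max borel_measurable_add borel_measurable_sum) auto
  have mQ: "Q s \<in> borel_measurable (?P (Suc n))" for s
    unfolding Q_def using T gm
    by (intro borel_measurable_rademacher_mean borel_measurable_Max borel_measurable_add borel_measurable_sum) auto
  have bF: "\<bar>F s z\<bar> \<le> B + \<bar>s\<bar> * b + n * (2 * b)" for s z
    unfolding F_def by (rule bd1)
  have bQ: "\<bar>Q s z\<bar> \<le> B + \<bar>s\<bar> * b + n * (2 * b)" for s z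
    unfolding Q_def by (rule bd2)
  have bL: "\<bar>L z\<bar> \<le> B + Suc n * (2 * b)" for z
    unfolding L_def
  proof (rule abs_Max_image_le[OF T])
    fix t assume t: "t \<in> T"
    have "\<bar>\<Sum>i<Suc n. g t (z i) - expectation (g t)\<bar> \<le> (\<Sum>i<Suc n. 2 * b)"
      by (rule order.trans[OF sum_abs sum_mono]) (use dev[OF t] in simp)
    then show "\<bar>c t + (\<Sum>i<Suc n. g t (z i) - expectation (g t))\<bar> \<le> B + Suc n * (2 * b)"
      using B[OF t] by simp
  qed
  define K where "K = B + 2 * b + n * (2 * b)"
  have bFF: "\<bar>(F 2 z + F (-2) z) / 2\<bar> \<le> K" for z
    using bF[of 2 z] bF[of "-2" z] unfolding K_def[symmetric] abs_numeral abs_neg_numeral by (simp add: abs_le_iff)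
  have mFF: "(\<lambda>z. (F 2 z + F (-2) z) / 2) \<in> borel_measurable (?P (Suc n))"
    using mF by measurable
  have upd_sum: "(\<Sum>i<n. f ((x(n := y)) i) - d) = (\<Sum>i<n. f (x i) - d)" for f :: "'a \<Rightarrow> real" and x y d
    by (intro sum.cong) auto
  have upd_sum': "(\<Sum>i<n. e i * (2 * f ((x(n := y)) i))) = (\<Sum>i<n. e i * (2 * f (x i)))" for f :: "'a \<Rightarrow> real" and x y e
    by (intro sum.cong) auto
  have "integral\<^sup>L (?P (Suc n)) L = (\<integral>x. (\<integral>y. L (x(n := y)) \<partial>M) \<partial>?P n)"
    by (rule ins(1)[OF mL bL])
  also have "\<dots> \<le> (\<integral>x. (\<integral>y. (F 2 (x(n := y)) + F (-2) (x(n := y))) / 2 \<partial>M) \<partial>?P n)"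
  proof (rule integral_mono)
    show "integrable (?P n) (\<lambda>x. \<integral>y. L (x(n := y)) \<partial>M)"
      by (rule ins(4)[OF mL bL])
    show "integrable (?P n) (\<lambda>x. \<integral>y. (F 2 (x(n := y)) + F (-2) (x(n := y))) / 2 \<partial>M)"
      by (rule ins(4)[OF mFF bFF])
    fix x
    show "(\<integral>y. L (x(n := y)) \<partial>M) \<le> (\<integral>y. (F 2 (x(n := y)) + F (-2) (x(n := y))) / 2 \<partial>M)"
      using symmetrization_step[of "\<lambda>t. c t + (\<Sum>i<n. g t (x i) - expectation (g t))"]
      unfolding L_def F_def by (simp add: upd_sum algebra_simps)
  qed
  also have "\<dots> = integral\<^sup>L (?P (Suc n)) (\<lambda>z. (F 2 z + F (-2) z) / 2)"
    by (rule ins(1)[OF mFF bFF, symmetric])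
  also have "\<dots> = (integral\<^sup>L (?P (Suc n)) (F 2) + integral\<^sup>L (?P (Suc n)) (F (-2))) / 2"
  proof -
    have "integrable (?P (Suc n)) (F s)" for s
      using mF bF[of s] by (intro PS.integrable_const_bound) auto
    then show ?thesis by simp
  qed
  also have "\<dots> \<le> (integral\<^sup>L (?P (Suc n)) (Q 2) + integral\<^sup>L (?P (Suc n)) (Q (-2))) / 2"
  proof -
    have "integral\<^sup>L (?P (Suc n)) (F s) \<le> integral\<^sup>L (?P (Suc n)) (Q s)" for s
    proof -
      have "integral\<^sup>L (?P (Suc n)) (F s) = (\<integral>y. (\<integral>x. F s (x(n := y)) \<partial>?P n) \<partial>M)"
        by (rule ins(2)[OF mF bF])
      also have "\<dots> \<le> (\<integral>y. (\<integral>x. Q s (x(n := y)) \<partial>?P n) \<partial>M)"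
      proof (rule integral_mono[OF ins(3)[OF mF bF] ins(3)[OF mQ bQ]])
        show "(\<integral>x. F s (x(n := y)) \<partial>?P n) \<le> (\<integral>x. Q s (x(n := y)) \<partial>?P n)" for y
          using Suc.IH[of "\<lambda>t. c t + s * g t y"] unfolding F_def Q_def upd_sum upd_sum' by simp
      qed
      also have "\<dots> = integral\<^sup>L (?P (Suc n)) (Q s)"
        by (rule ins(2)[OF mQ bQ, symmetric])
      finally show ?thesis .
    qed
    from this[of 2] this[of "-2"] show ?thesis by simp
  qed
  also have "\<dots> = integral\<^sup>L (?P (Suc n)) (\<lambda>z. (Q 2 z + Q (-2) z) / 2)"
  proof -
    have "integrable (?P (Suc n)) (Q s)" for s
      using mQ bQ[of s] by (intro PS.integrable_const_bound) auto
    then show ?thesis by simp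
  qed
  also have "(\<lambda>z. (Q 2 z + Q (-2) z) / 2)
      = (\<lambda>z. rademacher_mean (Suc n) (\<lambda>e. MAX t\<in>T. c t + (\<Sum>i<Suc n. e i * (2 * g t (z i)))))"
  proof
    fix z
    have "(\<Sum>i<n. (e(n := s)) i * (2 * g t (z i))) = (\<Sum>i<n. e i * (2 * g t (z i)))" for e s t
      by (intro sum.cong) auto
    then show "(Q 2 z + Q (-2) z) / 2 = rademacher_mean (Suc n) (\<lambda>e. MAX t\<in>T. c t + (\<Sum>i<Suc n. e i * (2 * g t (z i))))"
      unfolding Q_def by (simp add: algebra_simps)
  qed
  finally show ?case unfolding L_def .
qed

end

end

subsection \<open>The network classes\<close>

lemma vec_norm1_nonneg: "0 \<le> vec_norm1 w"
  unfolding vec_norm1_def by (intro sum_nonneg) auto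

lemma abs_inner_le_vec_norm1: "\<bar>w \<bullet> x\<bar> \<le> vec_norm1 w * norm x"
proof -
  have "\<bar>w \<bullet> x\<bar> \<le> norm w * norm x"
    by (rule Cauchy_Schwarz_ineq2)
  also have "\<dots> \<le> vec_norm1 w * norm x"
    unfolding vec_norm1_def by (intro mult_right_mono norm_le_l1_cart) auto
  finally show ?thesis .
qed

lemma sigmoid_bounds: "0 < sigmoid z" "sigmoid z < 1"
  by (auto simp: sigmoid_def field_simps add_pos_pos)

lemma sigmoid_has_real_derivative:
  "(sigmoid has_real_derivative sigmoid z * (1 - sigmoid z)) (at z)"
proof -
  have "1 + exp (- z) \<noteq> 0" using exp_gt_zero[of "- z"] by linarith
  then show ?thesis
    unfolding sigmoid_def
    by (auto intro!: derivative_eq_intros simp: field_simps power2_eq_square)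
qed

lemma sigmoid_lipschitz: "\<bar>sigmoid x - sigmoid y\<bar> \<le> \<bar>x - y\<bar>"
proof -
  have "norm (sigmoid x - sigmoid y) \<le> 1 * norm (x - y)"
  proof (rule field_differentiable_bound[of UNIV sigmoid "\<lambda>z. sigmoid z * (1 - sigmoid z)"])
    show "norm (sigmoid z * (1 - sigmoid z)) \<le> 1" for z
      using sigmoid_bounds[of z] by (auto simp: abs_mult intro!: mult_le_one)
  qed (auto intro: sigmoid_has_real_derivative)
  then show ?thesis by simp
qed

lemma relu_lipschitz: "\<bar>relu x - relu y\<bar> \<le> \<bar>x - y\<bar>"
  by (auto simp: relu_def max_def)

text \<open>What the finite net and measurability draw on, so that these arguments run for both
  activations at once.\<close>

definition admissible_activation :: "(real \<Rightarrow> real) \<Rightarrow> bool" where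
  "admissible_activation \<phi> \<longleftrightarrow> (\<forall>x y. \<bar>\<phi> x - \<phi> y\<bar> \<le> \<bar>x - y\<bar>) \<and> (\<forall>z. \<bar>\<phi> z\<bar> \<le> \<bar>z\<bar> + 1)"

lemma admissible_sigmoid: "admissible_activation sigmoid"
  using sigmoid_bounds sigmoid_lipschitz unfolding admissible_activation_def
  by (smt (verit))

lemma admissible_relu: "admissible_activation relu"
  using relu_lipschitz by (auto simp: admissible_activation_def relu_def)

text \<open>A network is represented by its tuple of parameters, so that rounding, negating and
  appending a neuron become operations on parameters.\<close>

definition nn_fun :: "nat \<Rightarrow> (real \<Rightarrow> real) \<Rightarrow>
    (nat \<Rightarrow> real) \<times> (nat \<Rightarrow> (real ^ 'd::finite)) \<times> (nat \<Rightarrow> real) \<times> (real ^ 'd) \<times> real \<Rightarrow> real ^ 'd \<Rightarrow> real" where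
  "nn_fun k \<phi> = (\<lambda>(\<beta>, w, b, w0, b0) x. (\<Sum>i = 1..k. \<beta> i * \<phi> (w i \<bullet> x + b i)) + w0 \<bullet> x + b0)"

definition nn_params :: "nat \<Rightarrow> real \<Rightarrow> real \<Rightarrow> real \<Rightarrow> real \<Rightarrow>
    ((nat \<Rightarrow> real) \<times> (nat \<Rightarrow> (real ^ 'd::finite)) \<times> (nat \<Rightarrow> real) \<times> (real ^ 'd) \<times> real) set" where
  "nn_params k a1 a2 a3 a4 = {(\<beta>, w, b, w0, b0).
     (\<forall>i\<in>{1..k}. vec_norm1 (w i) \<le> a1 \<and> \<bar>b i\<bar> \<le> a1 \<and> \<bar>\<beta> i\<bar> \<le> a2) \<and> \<bar>b0\<bar> \<le> a3 \<and> vec_norm1 w0 \<le> a4}"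

lemma nn_class_eq: "nn_class k a1 a2 a3 a4 \<phi> = nn_fun k \<phi> ` nn_params k a1 a2 a3 a4"
proof (intro equalityI subsetI)
  fix g :: "real ^ 'd \<Rightarrow> real" assume "g \<in> nn_class k a1 a2 a3 a4 \<phi>"
  then obtain \<beta> w b w0 b0 where p: "g = (\<lambda>x. (\<Sum>i = 1..k. \<beta> i * \<phi> (w i \<bullet> x + b i)) + w0 \<bullet> x + b0)"
    "\<forall>i\<in>{1..k}. max (vec_norm1 (w i)) \<bar>b i\<bar> \<le> a1 \<and> \<bar>\<beta> i\<bar> \<le> a2" "\<bar>b0\<bar> \<le> a3" "vec_norm1 w0 \<le> a4"
    unfolding nn_class_def by blast
  show "g \<in> nn_fun k \<phi> ` nn_params k a1 a2 a3 a4"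
    by (rule image_eqI[of _ _ "(\<beta>, w, b, w0, b0)"]) (use p in \<open>auto simp: nn_fun_def nn_params_def\<close>)
next
  fix g :: "real ^ 'd \<Rightarrow> real" assume "g \<in> nn_fun k \<phi> ` nn_params k a1 a2 a3 a4"
  then obtain \<beta> w b w0 b0 where p: "g = nn_fun k \<phi> (\<beta>, w, b, w0, b0)" "(\<beta>, w, b, w0, b0) \<in> nn_params k a1 a2 a3 a4"
    by auto
  show "g \<in> nn_class k a1 a2 a3 a4 \<phi>"
    unfolding nn_class_def p(1)
    by (intro CollectI exI[of _ \<beta>] exI[of _ w] exI[of _ b] exI[of _ w0] exI[of _ b0])
      (use p(2) in \<open>auto simp: nn_fun_def nn_params_def\<close>)
qed

section \<open>Clipped networks on a ball\<close>

definition clip :: "real \<Rightarrow> real" where "clip z = max (- 1) (min 1 z)"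

lemma clip_bounds: "\<bar>clip z\<bar> \<le> 1" and clip_lipschitz: "\<bar>clip y - clip z\<bar> \<le> \<bar>y - z\<bar>"
  and clip_minus: "clip (- z) = - clip z" and clip_id: "\<bar>z\<bar> \<le> 1 \<Longrightarrow> clip z = z"
  by (auto simp: clip_def)

definition ball_fun :: "real \<Rightarrow> (real ^ 'd::finite \<Rightarrow> real) \<Rightarrow> real ^ 'd \<Rightarrow> real" where
  "ball_fun r g x = clip (g x) * indicat_real (cball 0 r) x"

definition ball_class :: "nat \<Rightarrow> real \<Rightarrow> real \<Rightarrow> real \<Rightarrow> real \<Rightarrow> (real \<Rightarrow> real) \<Rightarrow> real \<Rightarrow>
    (real ^ 'd::finite \<Rightarrow> real) set" where
  "ball_class k a1 a2 a3 a4 \<phi> r = (\<lambda>p. ball_fun r (nn_fun k \<phi> p)) ` nn_params k a1 a2 a3 a4"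

lemma ball_class_eq:
  "{\<lambda>x. g x * indicat_real (cball 0 r) x | g. g \<in> nn_class_clip k a1 a2 a3 a4 \<phi>} = ball_class k a1 a2 a3 a4 \<phi> r"
  unfolding nn_class_clip_def nn_class_eq ball_class_def ball_fun_def[abs_def] clip_def
  by (intro equalityI subsetI; simp only: image_iff mem_Collect_eq Bex_def; force)

lemma G_relu_eq: "G_relu k a r = ball_class k 1 (2 / real k * a) a a relu r"
  unfolding G_relu_def ball_class_eq ..

lemma G_star_eq: "G_star k \<phi> r = ball_class k 1 1 1 0 \<phi> r"
  unfolding G_star_def ball_class_eq ..

lemma abs_ball_fun_le: "\<bar>ball_fun r g x\<bar> \<le> 1"
  using clip_bounds[of "g x"] by (auto simp: ball_fun_def indicator_def)

lemma ball_class_bounds: "f \<in> ball_class k a1 a2 a3 a4 \<phi> r \<Longrightarrow> \<bar>f x\<bar> \<le> 1"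
  by (auto simp: ball_class_def abs_ball_fun_le)

lemma ball_class_measurable:
  assumes "admissible_activation \<phi>" "f \<in> ball_class k a1 a2 a3 a4 \<phi> r"
  shows "f \<in> borel_measurable borel"
proof -
  have "1-lipschitz_on UNIV \<phi>"
    using assms(1) by (intro lipschitz_onI) (auto simp: admissible_activation_def dist_real_def)
  then have [measurable]: "\<phi> \<in> borel_measurable borel"
    by (intro borel_measurable_continuous_onI lipschitz_on_continuous_on)
  obtain \<beta> w b w0 b0 where f: "f = ball_fun r (nn_fun k \<phi> (\<beta>, w, b, w0, b0))"
    using assms(2) by (auto simp: ball_class_def)
  have [measurable]: "cball (0 :: real ^ 'd) r \<in> sets borel"
    by (intro borel_closed closed_cball)
  show ?thesis
    unfolding f ball_fun_def[abs_def] nn_fun_def clip_def prod.case by measurable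
qed

lemma ball_class_nonempty:
  assumes "0 \<le> a1" "0 \<le> a2" "0 \<le> a3" "0 \<le> a4"
  shows "(\<lambda>_. 0) \<in> ball_class k a1 a2 a3 a4 \<phi> r"
proof -
  have "ball_fun r (nn_fun k \<phi> (\<lambda>_. 0, \<lambda>_. 0, \<lambda>_. 0, 0, 0)) \<in> ball_class k a1 a2 a3 a4 \<phi> r"
    using assms unfolding ball_class_def nn_params_def by (intro imageI) (auto simp: vec_norm1_def)
  then show ?thesis
    by (simp add: ball_fun_def[abs_def] nn_fun_def clip_def)
qed

text \<open>\<open>clip\<close> is odd and the outer parameters enter linearly. Closure under
  negation lets a one-sided maximal deviation bound both sides, and lets the second sample, which
  enters with a minus sign, be treated like the first.\<close>

lemma ball_class_uminus:
  assumes "f \<in> ball_class k a1 a2 a3 a4 \<phi> r"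
  shows "(\<lambda>x. - f x) \<in> ball_class k a1 a2 a3 a4 \<phi> r"
proof -
  obtain \<beta> w b w0 b0 where p: "(\<beta>, w, b, w0, b0) \<in> nn_params k a1 a2 a3 a4"
      "f = ball_fun r (nn_fun k \<phi> (\<beta>, w, b, w0, b0))"
    using assms by (auto simp: ball_class_def)
  have "ball_fun r (nn_fun k \<phi> (\<lambda>i. - \<beta> i, w, b, - w0, - b0)) \<in> ball_class k a1 a2 a3 a4 \<phi> r"
    using p(1) unfolding ball_class_def nn_params_def by (intro imageI) (auto simp: vec_norm1_def)
  moreover have "nn_fun k \<phi> (\<lambda>i. - \<beta> i, w, b, - w0, - b0) x = - nn_fun k \<phi> (\<beta>, w, b, w0, b0) x" for x
    by (simp add: nn_fun_def sum_negf)
  ultimately show ?thesis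
    unfolding p(2) by (simp add: ball_fun_def[abs_def] clip_minus)
qed

lemma abs_ball_fun_diff_le:
  assumes "x \<in> cball 0 r \<Longrightarrow> \<bar>g x - h x\<bar> \<le> c" "0 \<le> c"
  shows "\<bar>ball_fun r g x - ball_fun r h x\<bar> \<le> c"
  using assms order.trans[OF clip_lipschitz[of "g x" "h x"]] by (auto simp: ball_fun_def indicator_def)

section \<open>Finite nets by rounding parameters\<close>

definition grid_round :: "real \<Rightarrow> real \<Rightarrow> real" where
  "grid_round \<delta> x = sgn x * (\<delta> * of_int \<lfloor>\<bar>x\<bar> / \<delta>\<rfloor>)"

lemma grid_round:
  assumes "\<delta> > 0"
  shows "\<bar>grid_round \<delta> x\<bar> \<le> \<bar>x\<bar>" "\<bar>x - grid_round \<delta> x\<bar> \<le> \<delta>"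
    "\<bar>x\<bar> \<le> a \<Longrightarrow> grid_round \<delta> x \<in> (\<lambda>j. \<delta> * of_int j) ` {- \<lceil>a / \<delta>\<rceil>..\<lceil>a / \<delta>\<rceil>}"
proof -
  have 1: "\<delta> * of_int \<lfloor>\<bar>x\<bar> / \<delta>\<rfloor> \<le> \<bar>x\<bar>"
    using mult_left_mono[OF of_int_floor_le[of "\<bar>x\<bar> / \<delta>"], of \<delta>] assms by simp
  have 2: "\<bar>x\<bar> \<le> \<delta> * of_int \<lfloor>\<bar>x\<bar> / \<delta>\<rfloor> + \<delta>"
    using floor_correct[of "\<bar>x\<bar> / \<delta>"] assms by (simp add: pos_divide_less_eq algebra_simps)
  have 3: "0 \<le> \<delta> * of_int \<lfloor>\<bar>x\<bar> / \<delta>\<rfloor>"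
    using assms by simp
  define N where "N = \<delta> * of_int \<lfloor>\<bar>x\<bar> / \<delta>\<rfloor>"
  have "N \<le> \<bar>x\<bar>" "\<bar>x\<bar> \<le> N + \<delta>" "0 \<le> N" "grid_round \<delta> x = sgn x * N"
    using 1 2 3 by (simp_all only: N_def grid_round_def)
  then show "\<bar>grid_round \<delta> x\<bar> \<le> \<bar>x\<bar>" "\<bar>x - grid_round \<delta> x\<bar> \<le> \<delta>"
    using assms by (auto simp: sgn_real_def)
  have signed: "(if P then N else if Q then 0 else - N) \<in> {- C..C}" if "N \<le> C" "0 \<le> N" for N C :: int and P Q
    using that by auto
  assume "\<bar>x\<bar> \<le> a"
  then have "\<lfloor>\<bar>x\<bar> / \<delta>\<rfloor> \<le> \<lceil>a / \<delta>\<rceil>"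
    using assms by (meson divide_right_mono less_imp_le floor_le_ceiling floor_mono order.trans)
  moreover have "0 \<le> \<lfloor>\<bar>x\<bar> / \<delta>\<rfloor>" using assms by simp
  ultimately have "(if x > 0 then \<lfloor>\<bar>x\<bar> / \<delta>\<rfloor> else if x = 0 then 0 else - \<lfloor>\<bar>x\<bar> / \<delta>\<rfloor>) \<in> {- \<lceil>a / \<delta>\<rceil>..\<lceil>a / \<delta>\<rceil>}"
    by (rule signed)
  moreover have "grid_round \<delta> x = \<delta> * of_int (if x > 0 then \<lfloor>\<bar>x\<bar> / \<delta>\<rfloor> else if x = 0 then 0 else - \<lfloor>\<bar>x\<bar> / \<delta>\<rfloor>)"
    by (auto simp: grid_round_def sgn_real_def)
  ultimately show "grid_round \<delta> x \<in> (\<lambda>j. \<delta> * of_int j) ` {- \<lceil>a / \<delta>\<rceil>..\<lceil>a / \<delta>\<rceil>}"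
    by (rule rev_image_eqI)
qed

lemma finite_vec_set:
  fixes S :: "real set"
  assumes "finite S"
  shows "finite {w :: real ^ 'd::finite. \<forall>j. w $ j \<in> S}" "card {w :: real ^ 'd. \<forall>j. w $ j \<in> S} \<le> card S ^ CARD('d)"
proof -
  have eq: "{w :: real ^ 'd. \<forall>j. w $ j \<in> S} = (\<lambda>f. \<chi> j. f j) ` (UNIV \<rightarrow>\<^sub>E S)"
  proof (intro equalityI subsetI)
    fix w :: "real ^ 'd" assume "w \<in> {w. \<forall>j. w $ j \<in> S}"
    then show "w \<in> (\<lambda>f. \<chi> j. f j) ` (UNIV \<rightarrow>\<^sub>E S)"
      by (intro image_eqI[of _ _ "\<lambda>j. w $ j"]) auto
  qed auto
  have fin: "finite ((UNIV :: 'd set) \<rightarrow>\<^sub>E S)"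
    using assms by (intro finite_PiE) auto
  show "finite {w :: real ^ 'd. \<forall>j. w $ j \<in> S}"
    unfolding eq using fin by simp
  show "card {w :: real ^ 'd. \<forall>j. w $ j \<in> S} \<le> card S ^ CARD('d)"
    unfolding eq using card_image_le[OF fin, of "\<lambda>f. \<chi> j. f j"] by (simp add: card_PiE)
qed

text \<open>Rounding all parameters towards 0 keeps the parameter constraints, so the net lies inside the class.\<close>

lemma ball_class_net:
  fixes a1 a2 a3 a4 A \<delta> r :: real and k :: nat
  assumes \<phi>: "admissible_activation \<phi>" and \<delta>: "\<delta> > 0" and r: "0 \<le> r"
    and a: "0 \<le> a1" "0 \<le> a2" "a1 \<le> A" "a2 \<le> A" "a3 \<le> A" "a4 \<le> A"
  defines "E \<equiv> real k * ((a1 * (r + 1) + 1) + a2 * (CARD('d) * r + 1)) + CARD('d) * r + 1"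
  obtains F :: "(real ^ 'd::finite \<Rightarrow> real) set"
  where "finite F" "F \<subseteq> ball_class k a1 a2 a3 a4 \<phi> r"
    "card F \<le> (2 * nat \<lceil>A / \<delta>\<rceil> + 1) ^ (k * (CARD('d) + 2) + CARD('d) + 1)"
    "\<And>g. g \<in> ball_class k a1 a2 a3 a4 \<phi> r \<Longrightarrow> \<exists>f\<in>F. \<forall>x. \<bar>g x - f x\<bar> \<le> \<delta> * E"
proof -
  define L where "L = nat \<lceil>A / \<delta>\<rceil>"
  have A0: "0 \<le> A" using a by linarith
  define S where "S = (\<lambda>j. \<delta> * of_int j) ` {- \<lceil>A / \<delta>\<rceil>..\<lceil>A / \<delta>\<rceil>}"
  have S: "finite S" "card S \<le> 2 * L + 1"
  proof -
    have "card S \<le> card {- \<lceil>A / \<delta>\<rceil>..\<lceil>A / \<delta>\<rceil>}"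
      unfolding S_def by (intro card_image_le) auto
    then show "card S \<le> 2 * L + 1" using A0 \<delta> by (simp add: L_def nat_add_distrib nat_mult_distrib)
  qed (simp add: S_def)
  define V where "V = {w :: real ^ 'd. \<forall>j. w $ j \<in> S}"
  have V: "finite V" "card V \<le> (2 * L + 1) ^ CARD('d)"
    using finite_vec_set[OF S(1)] power_mono[OF S(2), of "CARD('d)"] unfolding V_def by (auto intro: order.trans)
  \<comment> \<open>Functions restricted to \<open>{1..k}\<close> keep the set of tuples finite;
    \<open>nn_fun\<close> reads no other index.\<close>
  define Ps where "Ps = ({1..k} \<rightarrow>\<^sub>E S) \<times> ({1..k} \<rightarrow>\<^sub>E V) \<times> ({1..k} \<rightarrow>\<^sub>E S) \<times> V \<times> S"
  have fin: "finite Ps"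
    unfolding Ps_def using S V by (intro finite_cartesian_product finite_PiE) auto
  \<comment> \<open>Each of the \<open>k\<close> neurons has \<open>d + 2\<close> scalar parameters
    and the affine part has \<open>d + 1\<close>; every scalar takes at most
    \<open>2 * L + 1\<close> grid values.\<close>
  have "card Ps = card S ^ k * (card V ^ k * (card S ^ k * (card V * card S)))"
    unfolding Ps_def by (simp add: card_cartesian_product card_PiE)
  also have "\<dots> \<le> (2 * L + 1) ^ k * (((2 * L + 1) ^ CARD('d)) ^ k * ((2 * L + 1) ^ k * ((2 * L + 1) ^ CARD('d) * (2 * L + 1))))"
    using S V by (intro mult_le_mono power_mono) auto
  also have "\<dots> = (2 * L + 1) ^ (k * (CARD('d) + 2) + CARD('d) + 1)"
    by (simp only: power_mult[symmetric] power_add[symmetric] power_Suc2[symmetric])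
      (simp add: algebra_simps power_add power_mult)
  finally have card: "card Ps \<le> (2 * L + 1) ^ (k * (CARD('d) + 2) + CARD('d) + 1)" .
  define F where "F = (\<lambda>p. ball_fun r (nn_fun k \<phi> p)) ` (Ps \<inter> nn_params k a1 a2 a3 a4)"
  show ?thesis
  proof (rule that)
    show "finite F" using fin by (simp add: F_def)
    show "F \<subseteq> ball_class k a1 a2 a3 a4 \<phi> r" by (auto simp: F_def ball_class_def)
    have "card F \<le> card Ps"
      unfolding F_def using fin by (meson card_image_le card_mono finite_Int inf_le1 order.trans)
    then show "card F \<le> (2 * nat \<lceil>A / \<delta>\<rceil> + 1) ^ (k * (CARD('d) + 2) + CARD('d) + 1)"
      using card by (simp add: L_def)
    fix g :: "real ^ 'd \<Rightarrow> real" assume "g \<in> ball_class k a1 a2 a3 a4 \<phi> r"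
    then obtain \<beta> w b w0 b0 where p: "(\<beta>, w, b, w0, b0) \<in> nn_params k a1 a2 a3 a4"
        "g = ball_fun r (nn_fun k \<phi> (\<beta>, w, b, w0, b0))"
      by (auto simp: ball_class_def)
    define q where "q = grid_round \<delta>"
    define qv where "qv v = (\<chi> j. q (v $ j))" for v :: "real ^ 'd"
    have q: "\<bar>q x\<bar> \<le> \<bar>x\<bar>" "\<bar>x - q x\<bar> \<le> \<delta>" for x
      unfolding q_def by (rule grid_round[OF \<delta>])+
    have qS: "q x \<in> S" if "\<bar>x\<bar> \<le> A" for x
      unfolding q_def S_def by (rule grid_round(3)[OF \<delta> that])
    have qv: "vec_norm1 (qv v) \<le> vec_norm1 v" "vec_norm1 (v - qv v) \<le> CARD('d) * \<delta>" for v
    proof -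
      show "vec_norm1 (qv v) \<le> vec_norm1 v"
        unfolding vec_norm1_def qv_def using q by (intro sum_mono) auto
      have "vec_norm1 (v - qv v) \<le> (\<Sum>j\<in>(UNIV::'d set). \<delta>)"
        unfolding vec_norm1_def qv_def using q by (intro sum_mono) auto
      then show "vec_norm1 (v - qv v) \<le> CARD('d) * \<delta>" by simp
    qed
    have qvV: "qv v \<in> V" if "vec_norm1 v \<le> A" for v
    proof -
      have "\<bar>v $ j\<bar> \<le> vec_norm1 v" for j
        unfolding vec_norm1_def by (intro member_le_sum) auto
      then show ?thesis unfolding V_def qv_def using that by (auto intro!: qS intro: order.trans)
    qed
    define p' where "p' = (\<lambda>i\<in>{1..k}. q (\<beta> i), \<lambda>i\<in>{1..k}. qv (w i), \<lambda>i\<in>{1..k}. q (b i), qv w0, q b0)"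
    have "p' \<in> Ps"
      using p(1) a unfolding p'_def Ps_def nn_params_def
      by (auto intro!: qS qvV; fastforce)
    moreover have "p' \<in> nn_params k a1 a2 a3 a4"
      using p(1) unfolding p'_def nn_params_def
      by (auto intro: order.trans[OF q(1)] order.trans[OF qv(1)])
    ultimately have "ball_fun r (nn_fun k \<phi> p') \<in> F" by (auto simp: F_def)
    moreover have "\<bar>g x - ball_fun r (nn_fun k \<phi> p') x\<bar> \<le> \<delta> * E" for x
      unfolding p(2)
    proof (rule abs_ball_fun_diff_le)
      assume "x \<in> cball 0 r"
      then have x: "norm x \<le> r" by simp
      have inn: "\<bar>v \<bullet> x - qv v \<bullet> x\<bar> \<le> \<delta> * (CARD('d) * r)" for v
      proof -
        have "\<bar>v \<bullet> x - qv v \<bullet> x\<bar> \<le> vec_norm1 (v - qv v) * norm x"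
          using abs_inner_le_vec_norm1[of "v - qv v" x] by (simp add: inner_diff_left)
        also have "\<dots> \<le> (CARD('d) * \<delta>) * r"
          using qv(2) x vec_norm1_nonneg \<delta> by (intro mult_mono) auto
        finally show ?thesis by (simp add: mult_ac)
      qed
      \<comment> \<open>The two summands of the factor in \<open>E\<close>: the rounding error of
        the output weight is multiplied by the size of \<open>\<phi>\<close> on the ball, and that
        of the inner parameters, passed through \<open>\<phi>\<close> by the Lipschitz property, by
        the size of the output weight.\<close>
      have summand: "\<bar>\<beta> i * \<phi> (w i \<bullet> x + b i) - q (\<beta> i) * \<phi> (qv (w i) \<bullet> x + q (b i))\<bar>
          \<le> \<delta> * ((a1 * (r + 1) + 1) + a2 * (CARD('d) * r + 1))" if i: "i \<in> {1..k}" for i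
      proof -
        have pi: "vec_norm1 (w i) \<le> a1" "\<bar>b i\<bar> \<le> a1" "\<bar>\<beta> i\<bar> \<le> a2"
          using p(1) i by (auto simp: nn_params_def)
        have "\<bar>w i \<bullet> x\<bar> \<le> a1 * r"
          using abs_inner_le_vec_norm1[of "w i" x] mult_mono[OF pi(1) x a(1)] by simp
        then have "\<bar>w i \<bullet> x + b i\<bar> \<le> a1 * r + a1"
          using pi(2) by linarith
        moreover have "\<bar>\<phi> (w i \<bullet> x + b i)\<bar> \<le> \<bar>w i \<bullet> x + b i\<bar> + 1"
          using \<phi> by (simp add: admissible_activation_def)
        ultimately have f1: "\<bar>\<phi> (w i \<bullet> x + b i)\<bar> \<le> a1 * (r + 1) + 1"
          by (simp add: algebra_simps)
        have "\<bar>\<phi> (w i \<bullet> x + b i) - \<phi> (qv (w i) \<bullet> x + q (b i))\<bar> \<le> \<bar>(w i \<bullet> x + b i) - (qv (w i) \<bullet> x + q (b i))\<bar>"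
          using \<phi> by (simp add: admissible_activation_def)
        also have "\<dots> \<le> \<delta> * (CARD('d) * r) + \<delta>"
          using inn[of "w i"] q(2)[of "b i"] by linarith
        finally have f2: "\<bar>\<phi> (w i \<bullet> x + b i) - \<phi> (qv (w i) \<bullet> x + q (b i))\<bar> \<le> \<delta> * (CARD('d) * r + 1)"
          by (simp add: algebra_simps)
        have "\<bar>\<beta> i * \<phi> (w i \<bullet> x + b i) - q (\<beta> i) * \<phi> (qv (w i) \<bullet> x + q (b i))\<bar>
          = \<bar>(\<beta> i - q (\<beta> i)) * \<phi> (w i \<bullet> x + b i) + q (\<beta> i) * (\<phi> (w i \<bullet> x + b i) - \<phi> (qv (w i) \<bullet> x + q (b i)))\<bar>"
          by (simp add: algebra_simps)
        also have "\<dots> \<le> \<bar>\<beta> i - q (\<beta> i)\<bar> * \<bar>\<phi> (w i \<bullet> x + b i)\<bar> + \<bar>q (\<beta> i)\<bar> * \<bar>\<phi> (w i \<bullet> x + b i) - \<phi> (qv (w i) \<bullet> x + q (b i))\<bar>"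
          by (rule order.trans[OF abs_triangle_ineq]) (simp add: abs_mult)
        also have "\<dots> \<le> \<delta> * (a1 * (r + 1) + 1) + a2 * (\<delta> * (CARD('d) * r + 1))"
          using f1 f2 q(2)[of "\<beta> i"] order.trans[OF q(1)[of "\<beta> i"] pi(3)] \<delta> a r
          by (intro add_mono mult_mono) auto
        finally show ?thesis by (simp add: algebra_simps)
      qed
      have "nn_fun k \<phi> (\<beta>, w, b, w0, b0) x - nn_fun k \<phi> p' x
          = (\<Sum>i = 1..k. \<beta> i * \<phi> (w i \<bullet> x + b i) - q (\<beta> i) * \<phi> (qv (w i) \<bullet> x + q (b i)))
            + (w0 \<bullet> x - qv w0 \<bullet> x) + (b0 - q b0)"
        by (simp add: nn_fun_def p'_def sum_subtractf)
      also have "\<bar>\<dots>\<bar> \<le> (\<Sum>i = 1..k. \<delta> * ((a1 * (r + 1) + 1) + a2 * (CARD('d) * r + 1))) + \<delta> * (CARD('d) * r) + \<delta>"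
        by (intro order.trans[OF abs_triangle_ineq] add_mono order.trans[OF sum_abs sum_mono] inn q summand)
      finally show "\<bar>nn_fun k \<phi> (\<beta>, w, b, w0, b0) x - nn_fun k \<phi> p' x\<bar> \<le> \<delta> * E"
        by (simp add: E_def algebra_simps)
    next
      show "0 \<le> \<delta> * E" using \<delta> a r by (simp add: E_def)
    qed
    ultimately show "\<exists>f\<in>F. \<forall>x. \<bar>g x - f x\<bar> \<le> \<delta> * E" by blast
  qed
qed

section \<open>Rademacher complexity of rectifier networks\<close>

lemma rademacher_relu_ridge_le:
  fixes x :: "nat \<Rightarrow> real ^ 'd::finite" and W :: "((real ^ 'd) \<times> real) set"
  assumes W: "finite W" "(0, 0) \<in> W" "\<And>w b. (w, b) \<in> W \<Longrightarrow> vec_norm1 w \<le> 1 \<and> \<bar>b\<bar> \<le> 1" and r: "0 \<le> r"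
  defines "h \<equiv> \<lambda>i. indicat_real (cball 0 r) (x i)"
  shows "rademacher_mean n (\<lambda>e. MAX p\<in>W. \<bar>\<Sum>i<n. e i * (h i * relu (fst p \<bullet> x i + snd p))\<bar>) \<le> 2 * (r + 1) * sqrt n"
proof -
  define Z where "Z e p = (\<Sum>i<n. e i * (h i * relu (fst p \<bullet> x i + snd p)))" for e p
  have W': "W \<noteq> {}" using W by auto
  have Z0: "Z e (0, 0) = 0" for e by (simp add: Z_def relu_def)
  have Zneg: "Z (\<lambda>i. - e i) p = - Z e p" for e p by (simp add: Z_def sum_negf)
  have nonneg: "0 \<le> (MAX p\<in>W. Z e p)" for e
  proof -
    have "Z e (0, 0) \<le> (MAX p\<in>W. Z e p)"
      using W(1,2) by (intro Max_ge) auto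
    then show ?thesis by (simp add: Z0)
  qed
  \<comment> \<open>The zero unit makes both one-sided maxima nonnegative, so their sum dominates
    the maximum of the absolute values. They have the same mean because the signs are symmetric,
    whence the factor 2.\<close>
  have "rademacher_mean n (\<lambda>e. MAX p\<in>W. \<bar>Z e p\<bar>)
      \<le> rademacher_mean n (\<lambda>e. (MAX p\<in>W. Z e p) + (MAX p\<in>W. Z (\<lambda>i. - e i) p))"
  proof (intro rademacher_mean_mono)
    fix e :: "nat \<Rightarrow> real"
    show "(MAX p\<in>W. \<bar>Z e p\<bar>) \<le> (MAX p\<in>W. Z e p) + (MAX p\<in>W. Z (\<lambda>i. - e i) p)"
    proof (subst Max_le_iff)
      have "\<bar>Z e p\<bar> \<le> (MAX p\<in>W. Z e p) + (MAX p\<in>W. Z (\<lambda>i. - e i) p)" if "p \<in> W" for p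
      proof -
        have "Z e p \<le> (MAX p\<in>W. Z e p)" "Z (\<lambda>i. - e i) p \<le> (MAX p\<in>W. Z (\<lambda>i. - e i) p)"
          using that W(1) by (auto intro!: Max_ge)
        then show ?thesis
          using nonneg[of e] nonneg[of "\<lambda>i. - e i"] Zneg[of e p] by linarith
      qed
      then show "\<forall>a\<in>(\<lambda>p. \<bar>Z e p\<bar>) ` W. a \<le> (MAX p\<in>W. Z e p) + (MAX p\<in>W. Z (\<lambda>i. - e i) p)" by auto
    qed (use W W' in auto)
  qed
  also have "\<dots> = 2 * rademacher_mean n (\<lambda>e. MAX p\<in>W. Z e p)"
    unfolding rademacher_mean_add rademacher_mean_uminus_signs[of n "\<lambda>e. MAX p\<in>W. Z e p"] by simp
  \<comment> \<open>Contraction removes the rectifier; the indicator \<open>h i\<close> is a common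
    factor 0 or 1 and does not disturb the comparison of increments. What remains is linear in
    \<open>(w, b)\<close>, and its maximum is bounded by norms of Rademacher sums.\<close>
  also have "rademacher_mean n (\<lambda>e. MAX p\<in>W. Z e p)
      \<le> rademacher_mean n (\<lambda>e. MAX p\<in>W. 0 + (\<Sum>i<n. e i * (h i * (fst p \<bullet> x i + snd p))))"
  proof -
    have "rademacher_mean n (\<lambda>e. MAX p\<in>W. 0 + (\<Sum>i<n. e i * (h i * relu (fst p \<bullet> x i + snd p))))
      \<le> rademacher_mean n (\<lambda>e. MAX p\<in>W. 0 + (\<Sum>i<n. e i * (h i * (fst p \<bullet> x i + snd p))))"
      using relu_lipschitz
      by (intro rademacher_contraction[OF W(1) W'])
         (auto simp: h_def abs_mult indicator_def)
    then show ?thesis by (simp add: Z_def)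
  qed
  also have "\<dots> \<le> rademacher_mean n (\<lambda>e. norm (\<Sum>i<n. e i *\<^sub>R (h i *\<^sub>R x i)) + norm (\<Sum>i<n. e i *\<^sub>R h i))"
  proof (intro rademacher_mean_mono)
    fix e :: "nat \<Rightarrow> real"
    show "(MAX p\<in>W. 0 + (\<Sum>i<n. e i * (h i * (fst p \<bullet> x i + snd p)))) \<le> norm (\<Sum>i<n. e i *\<^sub>R (h i *\<^sub>R x i)) + norm (\<Sum>i<n. e i *\<^sub>R h i)"
    proof (subst Max_le_iff)
      have "0 + (\<Sum>i<n. e i * (h i * (w \<bullet> x i + b))) \<le> norm (\<Sum>i<n. e i *\<^sub>R (h i *\<^sub>R x i)) + norm (\<Sum>i<n. e i *\<^sub>R h i)"
        if "(w, b) \<in> W" for w b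
      proof -
        have "0 + (\<Sum>i<n. e i * (h i * (w \<bullet> x i + b))) = w \<bullet> (\<Sum>i<n. e i *\<^sub>R (h i *\<^sub>R x i)) + b * (\<Sum>i<n. e i *\<^sub>R h i)"
          by (simp add: inner_sum_right sum_distrib_left algebra_simps sum.distrib)
        also have "\<dots> \<le> vec_norm1 w * norm (\<Sum>i<n. e i *\<^sub>R (h i *\<^sub>R x i)) + \<bar>b\<bar> * norm (\<Sum>i<n. e i *\<^sub>R h i)"
          by (intro add_mono order.trans[OF abs_ge_self abs_inner_le_vec_norm1]) (simp flip: abs_mult)
        also have "\<dots> \<le> 1 * norm (\<Sum>i<n. e i *\<^sub>R (h i *\<^sub>R x i)) + 1 * norm (\<Sum>i<n. e i *\<^sub>R h i)"
          using W(3)[OF that] by (intro add_mono mult_right_mono) auto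
        finally show ?thesis by simp
      qed
      then show "\<forall>a\<in>(\<lambda>p. 0 + (\<Sum>i<n. e i * (h i * (fst p \<bullet> x i + snd p)))) ` W. a \<le> norm (\<Sum>i<n. e i *\<^sub>R (h i *\<^sub>R x i)) + norm (\<Sum>i<n. e i *\<^sub>R h i)"
        by auto
    qed (use W W' in auto)
  qed
  also have "\<dots> \<le> r * sqrt n + 1 * sqrt n"
    unfolding rademacher_mean_add using r
    by (intro add_mono rademacher_mean_norm_le) (auto simp: h_def indicator_def)
  finally show ?thesis by (simp add: Z_def algebra_simps)
qed

text \<open>Contraction removes the clipping, and what is left is linear in the outer parameters.
  The maximum over networks is then at most \<open>k * a2\<close> times the maximum over single
  hidden units, plus the affine part. With \<open>a2\<close> of order \<open>a / k\<close> the
  number of neurons cancels, and the cardinality of \<open>F\<close> never enters.\<close>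

lemma ball_class_rademacher:
  fixes x :: "nat \<Rightarrow> real ^ 'd::finite"
  assumes F: "finite F" "F \<noteq> {}" "F \<subseteq> ball_class k 1 a2 a3 a4 relu r"
    and r: "0 \<le> r" and a: "0 \<le> a2" "0 \<le> a3" "0 \<le> a4"
  shows "rademacher_mean n (\<lambda>e. MAX f\<in>F. 0 + (\<Sum>i<n. e i * (2 * f (x i))))
    \<le> (4 * real k * a2 * (r + 1) + 2 * a4 * r + 2 * a3) * sqrt n"
proof -
  define h where "h i = indicat_real (cball 0 r) (x i)" for i
  have "\<forall>f\<in>F. \<exists>p. p \<in> nn_params k 1 a2 a3 a4 \<and> f = ball_fun r (nn_fun k relu p)"
    using F(3) unfolding ball_class_def by blast
  then obtain p where p: "\<And>f. f \<in> F \<Longrightarrow> p f \<in> nn_params k 1 a2 a3 a4 \<and> f = ball_fun r (nn_fun k relu (p f))"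
    by metis
  have fx: "f (x i) = clip (nn_fun k relu (p f) (x i)) * h i" if "f \<in> F" for f i
  proof -
    have "f (x i) = ball_fun r (nn_fun k relu (p f)) (x i)"
      by (rule fun_cong) (use p[OF that] in blast)
    then show ?thesis by (simp only: ball_fun_def h_def)
  qed
  define \<beta> w b w0 b0 where "\<beta> f = fst (p f)" and "w f = fst (snd (p f))" and "b f = fst (snd (snd (p f)))"
    and "w0 f = fst (snd (snd (snd (p f))))" and "b0 f = snd (snd (snd (snd (p f))))" for f
  have pf: "p f = (\<beta> f, w f, b f, w0 f, b0 f)" for f
    by (simp add: \<beta>_def w_def b_def w0_def b0_def)
  \<comment> \<open>All hidden units that occur in networks of \<open>F\<close>, together with the
    zero unit that \<open>rademacher_relu_ridge_le\<close> asks for.\<close>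
  define W where "W = insert (0, 0) (\<Union>f\<in>F. (\<lambda>j. (w f j, b f j)) ` {1..k})"
  have W: "finite W" "(0, 0) \<in> W" "\<And>w b. (w, b) \<in> W \<Longrightarrow> vec_norm1 w \<le> 1 \<and> \<bar>b\<bar> \<le> 1"
    using F(1) p by (auto simp: W_def pf nn_params_def vec_norm1_def)
  have "rademacher_mean n (\<lambda>e. MAX f\<in>F. 0 + (\<Sum>i<n. e i * (2 * f (x i))))
    \<le> rademacher_mean n (\<lambda>e. MAX f\<in>F. 0 + (\<Sum>i<n. e i * (2 * (h i * nn_fun k relu (p f) (x i)))))"
  proof (intro rademacher_contraction[OF F(1,2)])
    fix i f f' assume ff: "f' \<in> F" "f \<in> F"
    have "\<bar>f (x i) - f' (x i)\<bar> = \<bar>clip (nn_fun k relu (p f) (x i)) - clip (nn_fun k relu (p f') (x i))\<bar> * h i"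
      unfolding fx[OF ff(1)] fx[OF ff(2)] by (auto simp: h_def indicator_def)
    also have "\<dots> \<le> \<bar>nn_fun k relu (p f) (x i) - nn_fun k relu (p f') (x i)\<bar> * h i"
      by (intro mult_right_mono clip_lipschitz) (auto simp: h_def)
    also have "\<dots> = \<bar>h i * nn_fun k relu (p f) (x i) - h i * nn_fun k relu (p f') (x i)\<bar>"
      by (auto simp: h_def indicator_def)
    finally show "\<bar>2 * f (x i) - 2 * f' (x i)\<bar> \<le> \<bar>2 * (h i * nn_fun k relu (p f) (x i)) - 2 * (h i * nn_fun k relu (p f') (x i))\<bar>"
      by linarith
  qed
  also have "\<dots> \<le> rademacher_mean n (\<lambda>e. (2 * real k * a2) * (MAX q\<in>W. \<bar>\<Sum>i<n. e i * (h i * relu (fst q \<bullet> x i + snd q))\<bar>)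
      + ((2 * a4) * norm (\<Sum>i<n. e i *\<^sub>R (h i *\<^sub>R x i)) + (2 * a3) * norm (\<Sum>i<n. e i *\<^sub>R h i)))"
  proof (intro rademacher_mean_mono)
    fix e :: "nat \<Rightarrow> real"
    define Z where "Z q = (\<Sum>i<n. e i * (h i * relu (fst q \<bullet> x i + snd q)))" for q
    define S where "S = (MAX q\<in>W. \<bar>Z q\<bar>)"
    define U where "U = (\<Sum>i<n. e i *\<^sub>R (h i *\<^sub>R x i))"
    define V where "V = (\<Sum>i<n. e i *\<^sub>R h i)"
    have "0 + (\<Sum>i<n. e i * (2 * (h i * nn_fun k relu (p f) (x i)))) \<le> (2 * real k * a2) * S + ((2 * a4) * norm U + (2 * a3) * norm V)"
      if f: "f \<in> F" for f
    proof -
      have pp: "\<And>j. j \<in> {1..k} \<Longrightarrow> \<bar>\<beta> f j\<bar> \<le> a2" "vec_norm1 (w0 f) \<le> a4" "\<bar>b0 f\<bar> \<le> a3"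
        using p[OF f] by (auto simp: pf nn_params_def)
      have "(\<Sum>i<n. e i * (2 * (h i * nn_fun k relu (p f) (x i))))
        = 2 * ((\<Sum>i<n. \<Sum>j = 1..k. e i * (h i * (\<beta> f j * relu (w f j \<bullet> x i + b f j)))) + w0 f \<bullet> U + b0 f * V)"
        by (simp add: nn_fun_def pf U_def V_def inner_sum_right sum_distrib_left algebra_simps sum.distrib)
      also have "(\<Sum>i<n. \<Sum>j = 1..k. e i * (h i * (\<beta> f j * relu (w f j \<bullet> x i + b f j))))
        = (\<Sum>j = 1..k. \<beta> f j * Z (w f j, b f j))"
        unfolding Z_def sum_distrib_left by (subst sum.swap) (simp add: algebra_simps)
      also have "(\<Sum>j = 1..k. \<beta> f j * Z (w f j, b f j)) \<le> (\<Sum>j = 1..k. a2 * S)"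
      proof (intro sum_mono)
        fix j assume j: "j \<in> {1..k}"
        have "\<bar>Z (w f j, b f j)\<bar> \<le> S"
        proof -
          have "(w f j, b f j) \<in> W" unfolding W_def using f j by blast
          then show ?thesis unfolding S_def using W(1) by (intro Max_ge) auto
        qed
        then have "\<bar>\<beta> f j\<bar> * \<bar>Z (w f j, b f j)\<bar> \<le> a2 * S"
          using pp(1)[OF j] a by (intro mult_mono) auto
        then show "\<beta> f j * Z (w f j, b f j) \<le> a2 * S"
          using abs_ge_self[of "\<beta> f j * Z (w f j, b f j)"] by (simp add: abs_mult)
      qed
      also have "w0 f \<bullet> U \<le> a4 * norm U"
        using abs_inner_le_vec_norm1[of "w0 f" U] mult_right_mono[OF pp(2), of "norm U"] by simp
      also have "b0 f * V \<le> a3 * norm V"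
        using mult_right_mono[OF pp(3), of "norm V"] abs_ge_self[of "b0 f * V"] by (simp add: abs_mult)
      finally show ?thesis by (simp add: algebra_simps)
    qed
    then show "(MAX f\<in>F. 0 + (\<Sum>i<n. e i * (2 * (h i * nn_fun k relu (p f) (x i)))))
      \<le> (2 * real k * a2) * (MAX q\<in>W. \<bar>\<Sum>i<n. e i * (h i * relu (fst q \<bullet> x i + snd q))\<bar>)
      + ((2 * a4) * norm (\<Sum>i<n. e i *\<^sub>R (h i *\<^sub>R x i)) + (2 * a3) * norm (\<Sum>i<n. e i *\<^sub>R h i))"
      using F unfolding S_def Z_def U_def V_def by (subst Max_le_iff) auto
  qed
  also have "\<dots> \<le> (2 * real k * a2) * (2 * (r + 1) * sqrt n) + ((2 * a4) * (r * sqrt n) + (2 * a3) * (1 * sqrt n))"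
    unfolding rademacher_mean_add rademacher_mean_cmult using a r
    by (intro add_mono mult_left_mono rademacher_mean_norm_le)
       (use rademacher_relu_ridge_le[OF W r, of n x] in \<open>auto simp: h_def indicator_def\<close>)
  finally show ?thesis by (simp add: algebra_simps)
qed

text \<open>Meant for finite \<open>F\<close>, where the maximum is measurable. The summand 0 is the
  zero offset in \<open>symmetrization\<close>.\<close>

definition max_dev :: "(real ^ 'd::finite \<Rightarrow> real) set \<Rightarrow> nat \<Rightarrow> (real ^ 'd) measure \<Rightarrow> (nat \<Rightarrow> real ^ 'd) \<Rightarrow> real" where
  "max_dev F n \<mu> x = (MAX f\<in>F. 0 + (\<Sum>i<n. f (x i) - integral\<^sup>L \<mu> f))"

lemma max_dev_nonneg: "finite F \<Longrightarrow> (\<lambda>_. 0) \<in> F \<Longrightarrow> 0 \<le> max_dev F n \<mu> x"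
  unfolding max_dev_def by (rule Max_ge) (auto intro!: image_eqI[of _ _ "\<lambda>_. 0"])

lemma nn_integral_max_dev_le:
  fixes \<mu> :: "(real ^ 'd::finite) measure"
  assumes \<mu>: "borel_prob \<mu>" and F: "finite F" "(\<lambda>_. 0) \<in> F" "F \<subseteq> ball_class k 1 a2 a3 a4 relu r"
    and r: "0 \<le> r" and a: "0 \<le> a2" "0 \<le> a3" "0 \<le> a4"
  shows "max_dev F n \<mu> \<in> borel_measurable (Pi\<^sub>M {..<n} (\<lambda>_. \<mu>))"
    "(\<integral>\<^sup>+x. ennreal (max_dev F n \<mu> x) \<partial>(Pi\<^sub>M {..<n} (\<lambda>_. \<mu>))) \<le> ennreal ((4 * real k * a2 * (r + 1) + 2 * a4 * r + 2 * a3) * sqrt n)"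
proof -
  interpret prob_space \<mu> using \<mu> by (simp add: borel_prob_def)
  interpret Pn: prob_space "Pi\<^sub>M {..<n} (\<lambda>_. \<mu>)"
    by (rule prob_space_PiM) (rule prob_space_axioms)
  have sets: "sets \<mu> = sets borel" using \<mu> by (simp add: borel_prob_def)
  have F': "F \<noteq> {}" using F by auto
  have g: "f \<in> borel_measurable \<mu>" "\<bar>f x\<bar> \<le> 1" if "f \<in> F" for f x
    using ball_class_measurable[OF admissible_relu, of f] ball_class_bounds[of f] that F(3)
    by (auto simp: measurable_cong_sets[OF sets refl])
  have bd: "\<bar>integral\<^sup>L \<mu> f\<bar> \<le> 1" if "f \<in> F" for f
  proof -
    have "integrable \<mu> f" using g[OF that] by (intro integrable_const_bound[of _ 1]) auto
    then show ?thesis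
      using g(2)[OF that] integral_le_const[of f 1] integral_ge_const[of f "- 1"]
      by (auto simp: abs_le_iff minus_le_iff)
  qed
  have gm: "(\<lambda>x. f (x i)) \<in> borel_measurable (Pi\<^sub>M {..<n} (\<lambda>_. \<mu>))" if "f \<in> F" "i < n" for f i
    using that g(1) by (intro measurable_compose[OF measurable_component_singleton]) auto
  show meas: "max_dev F n \<mu> \<in> borel_measurable (Pi\<^sub>M {..<n} (\<lambda>_. \<mu>))"
    unfolding max_dev_def[abs_def] using F(1) gm
    by (intro borel_measurable_Max borel_measurable_add borel_measurable_sum borel_measurable_diff) auto
  have int: "integrable (Pi\<^sub>M {..<n} (\<lambda>_. \<mu>)) (max_dev F n \<mu>)"
  proof (intro Pn.integrable_const_bound[of _ "n * 2"] AE_I2 meas)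
    fix x
    have "\<bar>0 + (\<Sum>i<n. f (x i) - integral\<^sup>L \<mu> f)\<bar> \<le> n * 2" if "f \<in> F" for f
    proof -
      have dev: "\<bar>f (x i) - integral\<^sup>L \<mu> f\<bar> \<le> 2" for i
        using g(2)[OF that, of "x i"] bd[OF that] by linarith
      have "\<bar>\<Sum>i<n. f (x i) - integral\<^sup>L \<mu> f\<bar> \<le> (\<Sum>i<n. 2)"
        by (rule order.trans[OF sum_abs sum_mono])
           (rule dev)
      then show ?thesis by simp
    qed
    then show "norm (max_dev F n \<mu> x) \<le> n * 2"
      unfolding max_dev_def real_norm_def by (intro abs_Max_image_le F F')
  qed
  have "integral\<^sup>L (Pi\<^sub>M {..<n} (\<lambda>_. \<mu>)) (max_dev F n \<mu>)
    \<le> (\<integral>x. rademacher_mean n (\<lambda>e. MAX f\<in>F. 0 + (\<Sum>i<n. e i * (2 * f (x i)))) \<partial>(Pi\<^sub>M {..<n} (\<lambda>_. \<mu>)))"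
    unfolding max_dev_def[abs_def]
    by (rule symmetrization[where T = F and g = "\<lambda>f. f" and b = 1 and c = "\<lambda>_. 0" and n = n]) (use F(1) F' g in auto)
  also have "\<dots> \<le> (4 * real k * a2 * (r + 1) + 2 * a4 * r + 2 * a3) * sqrt n"
  proof (rule Pn.integral_le_const)
    show "integrable (Pi\<^sub>M {..<n} (\<lambda>_. \<mu>)) (\<lambda>x. rademacher_mean n (\<lambda>e. MAX f\<in>F. 0 + (\<Sum>i<n. e i * (2 * f (x i)))))"
    proof (rule Pn.integrable_const_bound)
      show "(\<lambda>x. rademacher_mean n (\<lambda>e. MAX f\<in>F. 0 + (\<Sum>i<n. e i * (2 * f (x i))))) \<in> borel_measurable (Pi\<^sub>M {..<n} (\<lambda>_. \<mu>))"
        using F(1) gm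
        by (intro borel_measurable_rademacher_mean borel_measurable_Max borel_measurable_add borel_measurable_sum borel_measurable_times) auto
      have "\<bar>rademacher_mean n (\<lambda>e. MAX f\<in>F. 0 + (\<Sum>i<n. e i * (2 * f (x i))))\<bar> \<le> n * 2" for x
      proof (intro abs_rademacher_mean_le abs_Max_image_le F(1) F')
        fix f and e :: "nat \<Rightarrow> real" assume f: "f \<in> F" and e: "\<And>i. \<bar>e i\<bar> \<le> 1"
        have "\<bar>e i * (2 * f (x i))\<bar> \<le> 1 * 2" for i
          unfolding abs_mult using g(2)[OF f] e by (intro mult_mono) auto
        then have "\<bar>\<Sum>i<n. e i * (2 * f (x i))\<bar> \<le> (\<Sum>i<n. 2)"
          by (intro order.trans[OF sum_abs sum_mono]) auto
        then show "\<bar>0 + (\<Sum>i<n. e i * (2 * f (x i)))\<bar> \<le> n * 2" by simp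
      qed
      then show "AE x in Pi\<^sub>M {..<n} (\<lambda>_. \<mu>). norm (rademacher_mean n (\<lambda>e. MAX f\<in>F. 0 + (\<Sum>i<n. e i * (2 * f (x i))))) \<le> n * 2"
        by simp
    qed
    show "AE x in Pi\<^sub>M {..<n} (\<lambda>_. \<mu>). rademacher_mean n (\<lambda>e. MAX f\<in>F. 0 + (\<Sum>i<n. e i * (2 * f (x i)))) \<le> (4 * real k * a2 * (r + 1) + 2 * a4 * r + 2 * a3) * sqrt n"
      by (intro AE_I2 ball_class_rademacher) (use F F' r a in auto)
  qed
  finally have "integral\<^sup>L (Pi\<^sub>M {..<n} (\<lambda>_. \<mu>)) (max_dev F n \<mu>) \<le> (4 * real k * a2 * (r + 1) + 2 * a4 * r + 2 * a3) * sqrt n" .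
  then show "(\<integral>\<^sup>+x. ennreal (max_dev F n \<mu> x) \<partial>(Pi\<^sub>M {..<n} (\<lambda>_. \<mu>))) \<le> ennreal ((4 * real k * a2 * (r + 1) + 2 * a4 * r + 2 * a3) * sqrt n)"
    using max_dev_nonneg[OF F(1,2)] by (subst nn_integral_eq_integral[OF int]) (auto intro: ennreal_leI)
qed

section \<open>Total variation as a bound for test functions\<close>

lemma borel_prob_integrable:
  fixes f :: "real ^ 'd::finite \<Rightarrow> real"
  assumes "borel_prob \<mu>" "f \<in> borel_measurable borel" "\<And>x. \<bar>f x\<bar> \<le> b"
  shows "integrable \<mu> f"
proof -
  interpret prob_space \<mu> using assms(1) by (simp add: borel_prob_def)
  show ?thesis
    using assms measurable_cong_sets[of \<mu> borel borel borel]
    by (intro integrable_const_bound[of _ b]) (auto simp: borel_prob_def)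
qed

lemma two_abs_diff_le:
  fixes a b :: real
  assumes "0 \<le> a" "a \<le> 1" "0 \<le> b" "b \<le> 1"
  shows "2 * \<bar>a - b\<bar> \<le> 2"
  using assms by auto

text \<open>On a Hahn set \<open>Y\<close> the difference of the two measures is maximal, so it dominates every test function.\<close>

lemma integral_diff_le_tv_dist:
  fixes f :: "real ^ 'd::finite \<Rightarrow> real"
  assumes \<mu>: "borel_prob \<mu>" and \<nu>: "borel_prob \<nu>" and f: "f \<in> borel_measurable borel" "\<And>x. \<bar>f x\<bar> \<le> 1"
  shows "integral\<^sup>L \<mu> f - integral\<^sup>L \<nu> f \<le> tv_dist \<mu> \<nu>"
proof -
  interpret M: prob_space \<mu> using \<mu> by (simp add: borel_prob_def)
  interpret N: prob_space \<nu> using \<nu> by (simp add: borel_prob_def)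
  have sets[simp, measurable_cong]: "sets \<mu> = sets borel" "sets \<nu> = sets borel"
    using \<mu> \<nu> by (auto simp: borel_prob_def)
  have space[simp]: "space \<mu> = UNIV" "space \<nu> = UNIV"
    using sets_eq_imp_space_eq[OF sets(1)] sets_eq_imp_space_eq[OF sets(2)] by auto
  obtain Y where Y: "Y \<in> sets borel" "\<And>X. X \<in> sets borel \<Longrightarrow> X \<subseteq> Y \<Longrightarrow> emeasure \<nu> X \<le> emeasure \<mu> X"
      "\<And>X. X \<in> sets borel \<Longrightarrow> X \<inter> Y = {} \<Longrightarrow> emeasure \<mu> X \<le> emeasure \<nu> X"
    using finite_unsigned_Hahn_decomposition[of \<mu> \<nu>] M.finite_measure_axioms N.finite_measure_axioms by auto
  have [measurable]: "Y \<in> sets borel" by fact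
  \<comment> \<open>Domination of \<open>M1\<close> by \<open>M2\<close> on all subsets of
    \<open>A\<close> is an inequality between the two restricted measures; monotonicity of the
    integral in the measure carries it over to nonnegative functions that vanish off
    \<open>A\<close>.\<close>
  have le: "integral\<^sup>L M1 g \<le> integral\<^sup>L M2 g"
    if g: "g \<in> borel_measurable borel" "\<And>x. 0 \<le> g x" "\<And>x. g x \<le> 2" "\<And>x. x \<notin> A \<Longrightarrow> g x = 0"
      and M: "borel_prob M1" "borel_prob M2" and A: "A \<in> sets borel" "\<And>X. X \<in> sets borel \<Longrightarrow> X \<subseteq> A \<Longrightarrow> emeasure M1 X \<le> emeasure M2 X"
    for M1 M2 :: "(real ^ 'd) measure" and g :: "real ^ 'd \<Rightarrow> real" and A
  proof -
    have s[simp]: "sets M1 = sets borel" "sets M2 = sets borel" using M by (auto simp: borel_prob_def)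
    have [measurable]: "A \<in> sets M1" "A \<in> sets M2" using A(1) by simp_all
    have gm[measurable]: "g \<in> borel_measurable M1" "g \<in> borel_measurable M2" using g(1) by (auto simp: measurable_cong_sets[OF s(1) refl] measurable_cong_sets[OF s(2) refl])
    have int: "integrable M1 g" "integrable M2 g"
      using g by (auto intro!: borel_prob_integrable[OF M(1), of g 2] borel_prob_integrable[OF M(2), of g 2])
    have restr: "density M1 (indicator A) \<le> density M2 (indicator A)"
    proof (subst le_measure; (intro ballI)?)
      fix X assume "X \<in> sets (density M1 (indicator A))"
      then have X: "X \<in> sets borel" by simp
      have "emeasure (density Mi (indicator A)) X = emeasure Mi (A \<inter> X)" if "sets Mi = sets borel" for Mi :: "(real ^ 'd) measure"
        using X A(1) that by (subst emeasure_density) (auto simp: measurable_cong_sets[OF that refl] indicator_inter_arith[symmetric] nn_integral_indicator that)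
      then show "emeasure (density M1 (indicator A)) X \<le> emeasure (density M2 (indicator A)) X"
        using A(2)[of "A \<inter> X"] A(1) X by simp
    qed simp
    have "(\<integral>\<^sup>+x. ennreal (g x) \<partial>M1) = (\<integral>\<^sup>+x. ennreal (g x) \<partial>density M1 (indicator A))"
      using g(4) A(1) by (subst nn_integral_density) (auto intro!: nn_integral_cong split: split_indicator)
    also have "\<dots> \<le> (\<integral>\<^sup>+x. ennreal (g x) \<partial>density M2 (indicator A))"
      by (intro nn_integral_mono_measure restr) simp
    also have "\<dots> = (\<integral>\<^sup>+x. ennreal (g x) \<partial>M2)"
      using g(4) A(1) by (subst nn_integral_density) (auto intro!: nn_integral_cong split: split_indicator)
    finally have "ennreal (integral\<^sup>L M1 g) \<le> ennreal (integral\<^sup>L M2 g)"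
      using int g by (simp add: nn_integral_eq_integral)
    then show ?thesis
      using g by (simp add: ennreal_le_iff integral_nonneg)
  qed
  \<comment> \<open>\<open>f\<close> is \<open>2 * 1_Y - 1\<close> minus \<open>a\<close> plus
    \<open>b\<close>, with \<open>a\<close> and \<open>b\<close> nonnegative and supported on
    \<open>Y\<close> and on its complement. By the Hahn property both corrections can only lower the
    difference of the integrals, which leaves
    \<open>2 * (measure \<mu> Y - measure \<nu> Y)\<close>.\<close>
  define a where "a x = (1 - f x) * indicat_real Y x" for x
  define b where "b x = (1 + f x) * indicat_real (- Y) x" for x
  have f': "- 1 \<le> f x" "f x \<le> 1" for x using f(2)[of x] by auto
  have ab: "a \<in> borel_measurable borel" "b \<in> borel_measurable borel" "\<And>x. 0 \<le> a x" "\<And>x. 0 \<le> b x"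
    "\<And>x. a x \<le> 2" "\<And>x. b x \<le> 2" "\<And>x. x \<notin> Y \<Longrightarrow> a x = 0" "\<And>x. x \<notin> - Y \<Longrightarrow> b x = 0"
    using f(1) Y(1) f' by (auto simp: a_def[abs_def] b_def[abs_def] indicator_def minus_le_iff) (smt (verit) f')+
  have "integral\<^sup>L \<nu> a \<le> integral\<^sup>L \<mu> a"
    by (rule le[of a Y]) (use ab Y \<mu> \<nu> in auto)
  moreover have "integral\<^sup>L \<mu> b \<le> integral\<^sup>L \<nu> b"
    by (rule le[of b "- Y"]) (use ab Y \<mu> \<nu> in \<open>auto simp: disjoint_eq_subset_Compl\<close>)
  moreover have "integral\<^sup>L Mi f = (2 * measure Mi Y - 1) - integral\<^sup>L Mi a + integral\<^sup>L Mi b" if Mi: "borel_prob Mi" for Mi :: "(real ^ 'd) measure"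
  proof -
    interpret Mi: prob_space Mi using Mi by (simp add: borel_prob_def)
    have s: "sets Mi = sets borel" using Mi by (simp add: borel_prob_def)
    have "f = (\<lambda>x. (2 * indicat_real Y x - 1) - a x + b x)"
      by (auto simp: a_def b_def indicator_def fun_eq_iff)
    then have "integral\<^sup>L Mi f = (\<integral>x. (2 * indicat_real Y x - 1) - a x + b x \<partial>Mi)" by simp
    also have "\<dots> = (2 * measure Mi Y - 1) - integral\<^sup>L Mi a + integral\<^sup>L Mi b"
    proof -
      have iY: "integrable Mi (indicat_real Y)"
        using Y(1) by (intro borel_prob_integrable[OF Mi, of _ 1]) auto
      have "integrable Mi a" "integrable Mi b"
        using ab by (auto intro!: borel_prob_integrable[OF Mi, of _ 2])
      then show ?thesis
        using Y(1) s Mi.prob_space iY sets_eq_imp_space_eq[OF s] by simp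
    qed
    finally show ?thesis .
  qed
  from this[OF \<mu>] this[OF \<nu>] have "integral\<^sup>L \<mu> f - integral\<^sup>L \<nu> f = 2 * (measure \<mu> Y - measure \<nu> Y) - (integral\<^sup>L \<mu> a - integral\<^sup>L \<nu> a) + (integral\<^sup>L \<mu> b - integral\<^sup>L \<nu> b)"
    by simp
  ultimately have "integral\<^sup>L \<mu> f - integral\<^sup>L \<nu> f \<le> 2 * (measure \<mu> Y - measure \<nu> Y)"
    by linarith
  also have "\<dots> \<le> 2 * \<bar>measure \<mu> Y - measure \<nu> Y\<bar>"
    by (intro mult_left_mono abs_ge_self) simp
  also have "\<dots> \<le> tv_dist \<mu> \<nu>"
    unfolding tv_dist_def
  proof (rule cSUP_upper[OF Y(1)])
    show "bdd_above ((\<lambda>C. 2 * \<bar>measure \<mu> C - measure \<nu> C\<bar>) ` sets borel)"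
    proof (rule bdd_aboveI2)
      fix C show "2 * \<bar>measure \<mu> C - measure \<nu> C\<bar> \<le> 2"
        by (intro two_abs_diff_le) simp_all
    qed
  qed
  finally show ?thesis .
qed

lemma tv_dist_bounds:
  fixes \<mu> \<nu> :: "(real ^ 'd::finite) measure"
  assumes \<mu>: "borel_prob \<mu>" and \<nu>: "borel_prob \<nu>"
  shows "0 \<le> tv_dist \<mu> \<nu>" "tv_dist \<mu> \<nu> \<le> 2"
proof -
  interpret M: prob_space \<mu> using \<mu> by (simp add: borel_prob_def)
  interpret N: prob_space \<nu> using \<nu> by (simp add: borel_prob_def)
  show "0 \<le> tv_dist \<mu> \<nu>"
    using integral_diff_le_tv_dist[OF \<mu> \<nu>, of "\<lambda>_. 0"] by simp
  show "tv_dist \<mu> \<nu> \<le> 2"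
    unfolding tv_dist_def
  proof (rule cSUP_least)
    fix C show "2 * \<bar>measure \<mu> C - measure \<nu> C\<bar> \<le> 2"
      by (intro two_abs_diff_le) simp_all
  qed auto
qed

section \<open>The estimator and its expected error\<close>

definition emp_diff :: "nat \<Rightarrow> (nat \<Rightarrow> real ^ 'd::finite) \<Rightarrow> (nat \<Rightarrow> real ^ 'd) \<Rightarrow> (real ^ 'd \<Rightarrow> real) \<Rightarrow> real" where
  "emp_diff n x y g = 1 / real n * (\<Sum>i<n. g (x i) - g (y i))"

lemma abs_emp_diff_le:
  assumes "\<And>z. \<bar>g z\<bar> \<le> b" "0 \<le> b" shows "\<bar>emp_diff n x y g\<bar> \<le> 2 * b"
proof -
  have "\<bar>g (x i) - g (y i)\<bar> \<le> 2 * b" for i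
    using assms(1)[of "x i"] assms(1)[of "y i"] by linarith
  then have "\<bar>\<Sum>i<n. g (x i) - g (y i)\<bar> \<le> (\<Sum>i<n. 2 * b)"
    by (intro order.trans[OF sum_abs sum_mono]) auto
  then show ?thesis
    using assms(2) by (cases "n = 0") (auto simp: emp_diff_def abs_mult divide_le_eq mult.commute)
qed

lemma emp_diff_diff: "emp_diff n x y (\<lambda>z. g z - h z) = emp_diff n x y g - emp_diff n x y h"
  unfolding emp_diff_def sum_subtractf by (simp add: diff_divide_distrib)

lemma tv_estimator_upper:
  assumes "G \<noteq> {}" "\<And>g. g \<in> G \<Longrightarrow> emp_diff n x y g \<le> c"
  shows "tv_estimator G n x y \<le> c"
  unfolding tv_estimator_def using assms by (intro cSUP_least) (auto simp: emp_diff_def)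

lemma tv_estimator_lower:
  assumes "\<And>g z. g \<in> G \<Longrightarrow> \<bar>g z\<bar> \<le> 1" "g \<in> G"
  shows "emp_diff n x y g \<le> tv_estimator G n x y"
proof -
  have "emp_diff n x y h \<le> 2" if "h \<in> G" for h
    using abs_emp_diff_le[of h 1 n x y] assms(1)[OF that] by simp
  then show ?thesis
    using assms(2) unfolding tv_estimator_def emp_diff_def[symmetric]
    by (intro cSUP_upper bdd_aboveI2) auto
qed

lemma sample_law_prob_space:
  assumes "borel_prob \<mu>" "borel_prob \<nu>"
  shows "prob_space (sample_law n \<mu> \<nu>)"
proof -
  interpret M: prob_space "Pi\<^sub>M {..<n} (\<lambda>_. \<mu>)" using assms by (intro prob_space_PiM) (simp add: borel_prob_def)
  interpret N: prob_space "Pi\<^sub>M {..<n} (\<lambda>_. \<nu>)" using assms by (intro prob_space_PiM) (simp add: borel_prob_def)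
  interpret pair_prob_space "Pi\<^sub>M {..<n} (\<lambda>_. \<mu>)" "Pi\<^sub>M {..<n} (\<lambda>_. \<nu>)" ..
  show ?thesis unfolding sample_law_def by unfold_locales
qed

text \<open>The zero function keeps the estimator nonnegative, so estimator and total variation both
  lie between 0 and 2. This disposes of the cases in which the claimed rate is trivial.\<close>

lemma expected_error_le_2:
  fixes G :: "(real ^ 'd::finite \<Rightarrow> real) set"
  assumes \<mu>: "borel_prob \<mu>" and \<nu>: "borel_prob \<nu>"
    and G: "(\<lambda>_. 0) \<in> G" "\<And>g z. g \<in> G \<Longrightarrow> \<bar>g z\<bar> \<le> 1"
  shows "expected_error G n \<mu> \<nu> \<le> 2"
proof -
  interpret prob_space "sample_law n \<mu> \<nu>" by (rule sample_law_prob_space[OF \<mu> \<nu>])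
  have "\<bar>tv_estimator G n x y - tv_dist \<mu> \<nu>\<bar> \<le> 2" for x y
  proof -
    have "emp_diff n x y (\<lambda>_. 0) \<le> tv_estimator G n x y"
      by (rule tv_estimator_lower) (use G in auto)
    then have "0 \<le> tv_estimator G n x y" by (simp add: emp_diff_def)
    moreover have "tv_estimator G n x y \<le> 2"
    proof (rule tv_estimator_upper)
      fix g assume "g \<in> G"
      then show "emp_diff n x y g \<le> 2"
        using abs_emp_diff_le[of g 1 n x y] G(2) by simp
    qed (use G in auto)
    ultimately show ?thesis using tv_dist_bounds[OF \<mu> \<nu>] by linarith
  qed
  then have "ennreal \<bar>tv_estimator G n x y - tv_dist \<mu> \<nu>\<bar> \<le> 2" for x y
    using ennreal_leI[of _ 2] by fastforce
  then have "expected_error G n \<mu> \<nu> \<le> (\<integral>\<^sup>+_. 2 \<partial>sample_law n \<mu> \<nu>)"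
    unfolding expected_error_def by (intro nn_integral_mono) auto
  then show ?thesis by (simp add: emeasure_space_1)
qed

text \<open>From above, every function of the class has an integral difference of at most the total
  variation; from below, the witness \<open>g\<close> misses it by at most \<open>\<beta>\<close>.
  Both comparisons hold up to deviations of empirical means over a finite net. The estimator need
  not be measurable for this: it is dominated pointwise through the measurable
  \<open>max_dev\<close>, and the nonnegative integral is monotone for arbitrary functions. The
  deviation bound does not depend on the net, so the mesh \<open>\<eta>'\<close> can tend to
  0.\<close>

lemma expected_error_le:
  fixes \<mu> \<nu> :: "(real ^ 'd::finite) measure"
  assumes \<mu>: "borel_prob \<mu>" and \<nu>: "borel_prob \<nu>" and n: "1 \<le> n"
    and r: "0 \<le> r" and a: "0 \<le> a2" "0 \<le> a3" "0 \<le> a4"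
    and g: "g \<in> ball_class k 1 a2 a3 a4 relu r" "tv_dist \<mu> \<nu> - \<beta> \<le> integral\<^sup>L \<mu> g - integral\<^sup>L \<nu> g" "0 \<le> \<beta>"
  shows "expected_error (ball_class k 1 a2 a3 a4 relu r) n \<mu> \<nu>
    \<le> ennreal (2 * (4 * real k * a2 * (r + 1) + 2 * a4 * r + 2 * a3) / sqrt n + \<beta>)"
proof -
  let ?G = "ball_class k 1 a2 a3 a4 relu r :: (real ^ 'd \<Rightarrow> real) set"
  define R where "R = 4 * real k * a2 * (r + 1) + 2 * a4 * r + 2 * a3"
  have R0: "0 \<le> R" unfolding R_def using r a by simp
  have G0: "(\<lambda>_. 0) \<in> ?G" using a by (intro ball_class_nonempty) auto
  have Gb: "\<And>g z. g \<in> ?G \<Longrightarrow> \<bar>g z\<bar> \<le> 1" by (rule ball_class_bounds)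
  have Gm: "\<And>g. g \<in> ?G \<Longrightarrow> g \<in> borel_measurable borel" by (rule ball_class_measurable[OF admissible_relu])
  have ineq: "expected_error ?G n \<mu> \<nu> \<le> ennreal (2 * R / sqrt n + \<beta>) + ennreal \<eta>'" if \<eta>': "0 < \<eta>'" for \<eta>'
  proof -
    define E where "E = real k * ((1 * (r + 1) + 1) + a2 * (CARD('d) * r + 1)) + CARD('d) * r + 1"
    have E: "E \<ge> 1" unfolding E_def using r a by simp
    \<comment> \<open>Makes the net error \<open>\<eta>' / 2\<close>, which the difference of two
      empirical means doubles to \<open>\<eta>'\<close>.\<close>
    define \<delta> where "\<delta> = \<eta>' / (2 * E)"
    have \<delta>: "0 < \<delta>" using \<eta>' E by (simp add: \<delta>_def)
    define A where "A = max 1 (max a2 (max a3 a4))"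
    have A: "1 \<le> A" "a2 \<le> A" "a3 \<le> A" "a4 \<le> A" by (auto simp: A_def)
    obtain F0 :: "(real ^ 'd \<Rightarrow> real) set" where F0: "finite F0" "F0 \<subseteq> ?G"
      "card F0 \<le> (2 * nat \<lceil>A / \<delta>\<rceil> + 1) ^ (k * (CARD('d) + 2) + CARD('d) + 1)"
      "\<And>g. g \<in> ?G \<Longrightarrow> \<exists>f\<in>F0. \<forall>x. \<bar>g x - f x\<bar> \<le> \<delta> * E"
      using ball_class_net[OF admissible_relu \<delta> r _ a(1) A, of k] unfolding E_def by (metis zero_le_one)
    have \<delta>E: "\<delta> * E = \<eta>' / 2" using E by (simp add: \<delta>_def)
    \<comment> \<open>The zero function makes \<open>max_dev\<close> nonnegative and
      \<open>g\<close> serves the lower bound; closure under negation serves the second sample and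
      the reversed inequality for \<open>g\<close>.\<close>
    define F1 where "F1 = insert (\<lambda>_. 0) (insert g F0)"
    define F where "F = F1 \<union> (\<lambda>f x. - f x) ` F1"
    have F1: "finite F1" "(\<lambda>_. 0) \<in> F1" "F1 \<subseteq> ?G" using F0 g(1) G0 by (auto simp: F1_def)
    have F: "finite F" "(\<lambda>_. 0) \<in> F" "F \<subseteq> ?G"
      using F1 by (auto simp: F_def intro!: ball_class_uminus)
    have Fneg: "(\<lambda>x. - f x) \<in> F" if "f \<in> F" for f
      using that by (auto simp: F_def image_iff)
    have Fbd: "emp_diff n x y f - (integral\<^sup>L \<mu> f - integral\<^sup>L \<nu> f) \<le> (max_dev F n \<mu> x + max_dev F n \<nu> y) / n"
      if f: "f \<in> F" for f x y
    proof -
      have 1: "0 + (\<Sum>i<n. f (x i) - integral\<^sup>L \<mu> f) \<le> max_dev F n \<mu> x"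
        unfolding max_dev_def using F(1) f by (intro Max_ge) auto
      have 2: "0 + (\<Sum>i<n. - f (y i) - integral\<^sup>L \<nu> (\<lambda>x. - f x)) \<le> max_dev F n \<nu> y"
        unfolding max_dev_def using F(1) Fneg[OF f] by (intro Max_ge) (auto intro!: image_eqI[of _ _ "\<lambda>x. - f x"])
      have "emp_diff n x y f - (integral\<^sup>L \<mu> f - integral\<^sup>L \<nu> f)
        = ((\<Sum>i<n. f (x i) - integral\<^sup>L \<mu> f) + (\<Sum>i<n. - f (y i) - integral\<^sup>L \<nu> (\<lambda>x. - f x))) / n"
        using n by (simp add: emp_diff_def sum_subtractf sum_negf field_simps)
      then show ?thesis using 1 2 by (simp add: divide_right_mono)
    qed
    have pt: "\<bar>tv_estimator ?G n x y - tv_dist \<mu> \<nu>\<bar> \<le> (max_dev F n \<mu> x + max_dev F n \<nu> y) / n + (\<beta> + \<eta>')" for x y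
    proof -
      let ?D = "(max_dev F n \<mu> x + max_dev F n \<nu> y) / n"
      have D0: "0 \<le> ?D" using max_dev_nonneg[OF F(1,2)] by (simp add: add_nonneg_nonneg)
      have "tv_estimator ?G n x y \<le> ?D + tv_dist \<mu> \<nu> + \<eta>'"
      proof (rule tv_estimator_upper)
        fix h assume h: "h \<in> ?G"
        then obtain f where f: "f \<in> F0" "\<And>x. \<bar>h x - f x\<bar> \<le> \<eta>' / 2" using F0(4) \<delta>E by metis
        have "emp_diff n x y h - emp_diff n x y f \<le> \<eta>'"
          using abs_emp_diff_le[of "\<lambda>x. h x - f x" "\<eta>' / 2" n x y] f(2) \<eta>' by (simp add: emp_diff_diff)
        moreover have "emp_diff n x y f \<le> ?D + (integral\<^sup>L \<mu> f - integral\<^sup>L \<nu> f)"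
          using Fbd[of f x y] f(1) by (simp add: F_def F1_def)
        moreover have "integral\<^sup>L \<mu> f - integral\<^sup>L \<nu> f \<le> tv_dist \<mu> \<nu>"
          using f(1) F0(2) Gm Gb by (intro integral_diff_le_tv_dist \<mu> \<nu>) auto
        ultimately show "emp_diff n x y h \<le> ?D + tv_dist \<mu> \<nu> + \<eta>'" by linarith
      qed (use G0 in auto)
      moreover have "emp_diff n x y g \<le> tv_estimator ?G n x y"
        by (rule tv_estimator_lower) (use Gb g in auto)
      moreover have "emp_diff n x y (\<lambda>x. - g x) - (integral\<^sup>L \<mu> (\<lambda>x. - g x) - integral\<^sup>L \<nu> (\<lambda>x. - g x)) \<le> ?D"
        by (rule Fbd) (auto simp: F_def F1_def)
      then have "- emp_diff n x y g + (integral\<^sup>L \<mu> g - integral\<^sup>L \<nu> g) \<le> ?D"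
        by (simp add: emp_diff_def sum_subtractf algebra_simps)
      ultimately show ?thesis using g(2,3) D0 \<eta>' by linarith
    qed
    let ?P = "Pi\<^sub>M {..<n} (\<lambda>_. \<mu>)" and ?Q = "Pi\<^sub>M {..<n} (\<lambda>_. \<nu>)"
    interpret M: prob_space ?P using \<mu> by (intro prob_space_PiM) (simp add: borel_prob_def)
    interpret N: prob_space ?Q using \<nu> by (intro prob_space_PiM) (simp add: borel_prob_def)
    interpret PN: pair_prob_space ?P ?Q ..
    note m1 = nn_integral_max_dev_le[OF \<mu> F r a, of n, folded R_def]
    note m2 = nn_integral_max_dev_le[OF \<nu> F r a, of n, folded R_def]
    have [measurable]: "max_dev F n \<mu> \<in> borel_measurable ?P" "max_dev F n \<nu> \<in> borel_measurable ?Q" by (rule m1 m2)+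
    have "expected_error ?G n \<mu> \<nu> \<le> (\<integral>\<^sup>+(x, y). inverse (ennreal n) * (ennreal (max_dev F n \<mu> x) + ennreal (max_dev F n \<nu> y)) + ennreal (\<beta> + \<eta>') \<partial>(?P \<Otimes>\<^sub>M ?Q))"
      unfolding expected_error_def sample_law_def
    proof (intro nn_integral_mono, clarify)
      fix x y
      have "ennreal \<bar>tv_estimator ?G n x y - tv_dist \<mu> \<nu>\<bar> \<le> ennreal ((max_dev F n \<mu> x + max_dev F n \<nu> y) / n + (\<beta> + \<eta>'))"
        by (intro ennreal_leI pt)
      also have "\<dots> = inverse (ennreal n) * (ennreal (max_dev F n \<mu> x) + ennreal (max_dev F n \<nu> y)) + ennreal (\<beta> + \<eta>')"
        using max_dev_nonneg[OF F(1,2)] g(3) \<eta>' n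
        by (simp add: ennreal_plus inverse_ennreal divide_inverse ennreal_mult mult.commute[of "max_dev F n \<mu> x + max_dev F n \<nu> y"])
      finally show "ennreal \<bar>tv_estimator ?G n x y - tv_dist \<mu> \<nu>\<bar> \<le> inverse (ennreal n) * (ennreal (max_dev F n \<mu> x) + ennreal (max_dev F n \<nu> y)) + ennreal (\<beta> + \<eta>')" .
    qed
    also have "\<dots> = (\<integral>\<^sup>+x. \<integral>\<^sup>+y. inverse (ennreal n) * (ennreal (max_dev F n \<mu> x) + ennreal (max_dev F n \<nu> y)) + ennreal (\<beta> + \<eta>') \<partial>?Q \<partial>?P)"
      by (subst N.nn_integral_fst[symmetric]) simp_all
    also have "\<dots> = (\<integral>\<^sup>+x. inverse (ennreal n) * (ennreal (max_dev F n \<mu> x) + (\<integral>\<^sup>+y. ennreal (max_dev F n \<nu> y) \<partial>?Q)) + ennreal (\<beta> + \<eta>') \<partial>?P)"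
      by (simp add: nn_integral_add nn_integral_cmult N.emeasure_space_1)
    also have "\<dots> = inverse (ennreal n) * ((\<integral>\<^sup>+x. ennreal (max_dev F n \<mu> x) \<partial>?P) + (\<integral>\<^sup>+y. ennreal (max_dev F n \<nu> y) \<partial>?Q)) + ennreal (\<beta> + \<eta>')"
      by (simp add: nn_integral_add nn_integral_cmult M.emeasure_space_1)
    also have "\<dots> \<le> inverse (ennreal n) * (ennreal (R * sqrt n) + ennreal (R * sqrt n)) + ennreal (\<beta> + \<eta>')"
      by (intro add_mono mult_left_mono m1 m2) auto
    also have "\<dots> = ennreal (2 * (R * sqrt n) / n + (\<beta> + \<eta>'))"
      using R0 g(3) \<eta>' n
      by (simp add: ennreal_plus inverse_ennreal divide_inverse mult.commute flip: ennreal_mult ennreal_plus)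
    also have "2 * (R * sqrt n) / n = 2 * R / sqrt n"
      using n by (simp add: field_simps)
    finally show ?thesis
      using R0 g(3) \<eta>' by (simp add: ennreal_plus[symmetric] add.assoc del: ennreal_plus)
  qed
  show ?thesis
    unfolding R_def[symmetric] by (rule ennreal_le_epsilon) (use ineq in auto)
qed

subsection \<open>A radial kernel as an average of ridge functions\<close>

lemma tendsto_poly_times_gaussian:
  "((\<lambda>u. poly p u * exp (- u\<^sup>2 / 2)) \<longlongrightarrow> 0) (at_bot :: real filter)"
proof -
  have mono: "((\<lambda>u. u ^ k * exp (- u\<^sup>2 / 2)) \<longlongrightarrow> 0) (at_bot :: real filter)" for k
  proof (rule Lim_null_comparison)
    have lim: "((\<lambda>u. (- u) ^ k / exp (- u)) \<longlongrightarrow> 0) (at_bot :: real filter)"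
      by (rule filterlim_compose[OF tendsto_power_div_exp_0 filterlim_uminus_at_top_at_bot])
    show "((\<lambda>u. (- u) ^ k / exp (- u)) \<longlongrightarrow> 0) (at_bot :: real filter)" by (rule lim)
    show "eventually (\<lambda>u. norm (u ^ k * exp (- u\<^sup>2 / 2)) \<le> (- u) ^ k / exp (- u)) (at_bot :: real filter)"
      using eventually_le_at_bot[of "- 2"]
    proof eventually_elim
      case (elim u)
      have "2 * (- u) \<le> (- u) * (- u)"
        using elim by (intro mult_right_mono) auto
      then have "exp (- u\<^sup>2 / 2) \<le> exp u" by (simp add: power2_eq_square)
      then have "\<bar>u\<bar> ^ k * exp (- u\<^sup>2 / 2) \<le> (- u) ^ k * exp u"
        using elim by (intro mult_mono) auto
      moreover have "(- u) ^ k / exp (- u) = (- u) ^ k * exp u"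
        by (simp only: exp_minus divide_inverse inverse_inverse_eq)
      ultimately show ?case by (simp only: real_norm_def abs_mult power_abs abs_exp_cancel)
    qed
  qed
  have "((\<lambda>u. \<Sum>i\<le>degree p. coeff p i * (u ^ i * exp (- u\<^sup>2 / 2))) \<longlongrightarrow> (\<Sum>i\<le>degree p. coeff p i * 0)) (at_bot :: real filter)"
    by (intro tendsto_intros mono)
  then show ?thesis by (simp add: poly_altdef sum_distrib_right mult.assoc)
qed

lemma integrable_poly_times_gaussian:
  "integrable lborel (\<lambda>u::real. poly p u * exp (- u\<^sup>2 / 2))"
proof -
  have "integrable lborel (\<lambda>u::real. u ^ k * exp (- u\<^sup>2 / 2))" for k
  proof -
    have "integrable lborel (\<lambda>u. sqrt (2 * pi) * (std_normal_density u * u ^ k))"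
      by (intro integrable_mult_right integrable_std_normal_moment)
    then show ?thesis by (simp add: std_normal_density_def field_simps)
  qed
  then have "integrable lborel (\<lambda>u::real. \<Sum>i\<le>degree p. coeff p i * (u ^ i * exp (- u\<^sup>2 / 2)))"
    by (intro Bochner_Integration.integrable_sum integrable_mult_right)
  then show ?thesis by (simp add: poly_altdef sum_distrib_right mult.assoc)
qed

text \<open>Products of a polynomial and \<open>exp (- u\<^sup>2 / 2)\<close> are closed under
  differentiation; this is the derivative read off on the polynomial factor.\<close>

definition gauss_deriv :: "real poly \<Rightarrow> real poly" where
  "gauss_deriv p = pderiv p - [:0, 1:] * p"

lemma gauss_deriv_mult: "gauss_deriv (p * l) = gauss_deriv p * l + p * pderiv l"
  by (simp add: gauss_deriv_def pderiv_mult algebra_simps)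

lemma gauss_deriv:
  "((\<lambda>u. poly p u * exp (- u\<^sup>2 / 2)) has_real_derivative poly (gauss_deriv p) u * exp (- u\<^sup>2 / 2)) (at u)"
  unfolding gauss_deriv_def
  by (auto intro!: derivative_eq_intros simp: algebra_simps)

text \<open>Taylor's formula with integral remainder, expanded at minus infinity.\<close>

lemma gaussian_eq_relu_superposition:
  "poly p v * exp (- v\<^sup>2 / 2)
     = (\<integral>u. poly (gauss_deriv (gauss_deriv p)) u * exp (- u\<^sup>2 / 2) * relu (v - u) \<partial>lborel)"
proof -
  let ?e = "\<lambda>p u. poly p u * exp (- u\<^sup>2 / 2) :: real"
  let ?q = "gauss_deriv p" let ?q' = "gauss_deriv ?q"
  \<comment> \<open>With \<open>\<kappa>\<close> for the left-hand side as a function,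
    \<open>F u\<close> is \<open>\<kappa>' u * (v - u) + \<kappa> u\<close>, an antiderivative of
    \<open>\<kappa>'' u * (v - u)\<close> that vanishes at minus infinity and equals
    \<open>\<kappa> v\<close> at \<open>v\<close>. The factor \<open>v - u\<close> is written as a
    polynomial so that closure under differentiation covers it too.\<close>
  define F where "F u = ?e (?q * [:v, - 1:]) u + ?e p u" for u
  have eq: "?e ?q' u * (v - u) = ?e (gauss_deriv (?q * [:v, - 1:])) u + ?e ?q u" for u
    unfolding gauss_deriv_mult by (simp add: pderiv_pCons algebra_simps)
  have "(LBINT u=-\<infinity>..ereal v. ?e ?q' u * (v - u)) = F v - 0"
  proof (rule interval_integral_FTC_integrable)
    show "(F has_vector_derivative ?e ?q' u * (v - u)) (at u)" for u
      unfolding F_def[abs_def] eq has_real_derivative_iff_has_vector_derivative[symmetric]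
      by (intro DERIV_add gauss_deriv)
    show "isCont (\<lambda>u. ?e ?q' u * (v - u)) u" for u
      by (intro continuous_intros) simp
    have "integrable lborel (?e (?q' * [:v, - 1:]))"
      by (rule integrable_poly_times_gaussian)
    then have "integrable lborel (\<lambda>u. ?e ?q' u * (v - u))"
      by (simp add: algebra_simps)
    then show "set_integrable lborel (einterval (- \<infinity>) (ereal v)) (\<lambda>u. ?e ?q' u * (v - u))"
      unfolding set_integrable_def by (intro integrable_mult_indicator) auto
    have "(F \<longlongrightarrow> 0 + 0) at_bot"
      unfolding F_def[abs_def] by (intro tendsto_add tendsto_poly_times_gaussian)
    then show "((F \<circ> real_of_ereal) \<longlongrightarrow> 0) (at_right (- \<infinity>))"
      by (simp add: ereal_tendsto_simps)
    have "isCont F v" unfolding F_def[abs_def] by (intro continuous_intros) simp_all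
    then show "((F \<circ> real_of_ereal) \<longlongrightarrow> F v) (at_left (ereal v))"
      unfolding ereal_tendsto_simps isCont_def by (rule filterlim_mono) (auto intro: at_le)
  qed simp
  also have "F v - 0 = ?e p v" by (simp add: F_def)
  also have "(LBINT u=-\<infinity>..ereal v. ?e ?q' u * (v - u)) = (\<integral>u. ?e ?q' u * relu (v - u) \<partial>lborel)"
    unfolding interval_lebesgue_integral_def set_lebesgue_integral_def
    by (auto intro!: Bochner_Integration.integral_cong simp: relu_def einterval_def indicator_def)
  finally show ?thesis by simp
qed

text \<open>The coefficients divide out Gaussian moments: the moment of order \<open>2 * l\<close>
  of a centred normal law with deviation \<open>\<tau>\<close> is
  \<open>fact (2 * l) / (2 ^ l * fact l) * \<tau> ^ (2 * l)\<close>, so the mean of the polynomial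
  is the binomial expansion of \<open>(1 - \<tau>\<^sup>2) ^ d\<close>.\<close>

definition ridge_poly :: "nat \<Rightarrow> real poly" where
  "ridge_poly d = (\<Sum>l\<le>d. monom (real (d choose l) * (- 1) ^ l * (2 ^ l * fact l / fact (2 * l))) (2 * l))"

abbreviation std_normal :: "real measure" where
  "std_normal \<equiv> density lborel std_normal_density"

lemma prob_space_std_normal: "prob_space std_normal"
  using prob_space_normal_density[of 1 0] by simp

text \<open>The normal density with deviation \<open>\<sigma>\<close> times the Gaussian factor is
  again a normal density up to \<open>1 / sqrt (1 + \<sigma>\<^sup>2)\<close>, with variance
  \<open>\<tau>\<^sup>2 = \<sigma>\<^sup>2 / (1 + \<sigma>\<^sup>2)\<close>. The mean of
  \<open>ridge_poly d\<close> under it is \<open>(1 - \<tau>\<^sup>2) ^ d\<close>, and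
  \<open>1 - \<tau>\<^sup>2 = 1 / (1 + \<sigma>\<^sup>2)\<close>.\<close>

lemma normal_integral_ridge:
  assumes \<sigma>: "0 < \<sigma>"
  shows "has_bochner_integral lborel (\<lambda>v. normal_density 0 \<sigma> v * (poly (ridge_poly d) v * exp (- v\<^sup>2 / 2)))
     ((1 / (1 + \<sigma>\<^sup>2)) ^ d / sqrt (1 + \<sigma>\<^sup>2))"
proof -
  define \<tau> where "\<tau> = \<sigma> / sqrt (1 + \<sigma>\<^sup>2)"
  have pos: "0 < 1 + \<sigma>\<^sup>2" by (simp add: add_pos_nonneg)
  have \<tau>: "0 < \<tau>" using \<sigma> pos by (simp add: \<tau>_def)
  have \<tau>2: "\<tau>\<^sup>2 = \<sigma>\<^sup>2 / (1 + \<sigma>\<^sup>2)" using pos by (simp add: \<tau>_def power_divide)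
  have dens: "normal_density 0 \<sigma> v * exp (- v\<^sup>2 / 2) = normal_density 0 \<tau> v / sqrt (1 + \<sigma>\<^sup>2)" for v
  proof -
    have "- v\<^sup>2 / (2 * \<sigma>\<^sup>2) + - v\<^sup>2 / 2 = - v\<^sup>2 / (2 * \<tau>\<^sup>2)"
      using \<sigma> pos by (simp add: \<tau>2 field_simps)
    then have e: "exp (- v\<^sup>2 / (2 * \<sigma>\<^sup>2)) * exp (- v\<^sup>2 / 2) = exp (- v\<^sup>2 / (2 * \<tau>\<^sup>2))"
      by (simp flip: exp_add)
    have s: "sqrt (2 * pi * \<tau>\<^sup>2) * sqrt (1 + \<sigma>\<^sup>2) = sqrt (2 * pi * \<sigma>\<^sup>2)"
      using pos by (simp add: \<tau>2 flip: real_sqrt_mult)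
    have "normal_density 0 \<sigma> v * exp (- v\<^sup>2 / 2) = 1 / sqrt (2 * pi * \<sigma>\<^sup>2) * exp (- v\<^sup>2 / (2 * \<tau>\<^sup>2))"
      by (simp only: normal_density_def diff_zero mult.assoc e)
    also have "\<dots> = normal_density 0 \<tau> v / sqrt (1 + \<sigma>\<^sup>2)"
      unfolding s[symmetric] by (simp add: normal_density_def)
    finally show ?thesis .
  qed
  define c where "c l = real (d choose l) * (- 1) ^ l * (2 ^ l * fact l / fact (2 * l))" for l
  have "has_bochner_integral lborel (\<lambda>v. \<Sum>l\<le>d. c l / sqrt (1 + \<sigma>\<^sup>2) * (normal_density 0 \<tau> v * (v - 0) ^ (2 * l)))
     (\<Sum>l\<le>d. c l / sqrt (1 + \<sigma>\<^sup>2) * (fact (2 * l) / ((2 / \<tau>\<^sup>2) ^ l * fact l)))"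
    by (intro has_bochner_integral_sum has_bochner_integral_mult_right normal_moment_even \<tau>)
  moreover have "(\<Sum>l\<le>d. c l / sqrt (1 + \<sigma>\<^sup>2) * (normal_density 0 \<tau> v * (v - 0) ^ (2 * l)))
      = normal_density 0 \<sigma> v * (poly (ridge_poly d) v * exp (- v\<^sup>2 / 2))" for v
  proof -
    have "normal_density 0 \<sigma> v * (poly (ridge_poly d) v * exp (- v\<^sup>2 / 2))
       = (normal_density 0 \<sigma> v * exp (- v\<^sup>2 / 2)) * (\<Sum>l\<le>d. c l * v ^ (2 * l))"
      by (simp add: ridge_poly_def poly_sum poly_monom c_def)
    then show ?thesis unfolding dens by (simp add: sum_distrib_left mult_ac)
  qed
  moreover have "(\<Sum>l\<le>d. c l / sqrt (1 + \<sigma>\<^sup>2) * (fact (2 * l) / ((2 / \<tau>\<^sup>2) ^ l * fact l)))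
      = (1 / (1 + \<sigma>\<^sup>2)) ^ d / sqrt (1 + \<sigma>\<^sup>2)"
  proof -
    have "c l * (fact (2 * l) / ((2 / \<tau>\<^sup>2) ^ l * fact l)) = real (d choose l) * (- \<tau>\<^sup>2) ^ l * 1 ^ (d - l)" for l
      using \<tau> by (simp add: c_def power_divide power_minus[of "\<tau>\<^sup>2"])
    then have "(\<Sum>l\<le>d. c l * (fact (2 * l) / ((2 / \<tau>\<^sup>2) ^ l * fact l))) = (- \<tau>\<^sup>2 + 1) ^ d"
      unfolding binomial_ring by simp
    also have "- \<tau>\<^sup>2 + 1 = 1 / (1 + \<sigma>\<^sup>2)" using pos by (simp add: \<tau>2 field_simps)
    finally have "(\<Sum>l\<le>d. c l * (fact (2 * l) / ((2 / \<tau>\<^sup>2) ^ l * fact l))) = (1 / (1 + \<sigma>\<^sup>2)) ^ d" .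
    then show ?thesis
      by (simp only: times_divide_eq_left sum_divide_distrib[symmetric])
  qed
  ultimately show ?thesis by simp
qed

text \<open>Functions on the index type instead of vectors, so that the product measure with its
  independent coordinates can be used as it is.\<close>

definition gauss_vec :: "('d::finite \<Rightarrow> real) measure" where
  "gauss_vec = Pi\<^sub>M UNIV (\<lambda>_. std_normal)"

definition radial_kernel :: "real ^ 'd::finite \<Rightarrow> real" where
  "radial_kernel z = (1 / (1 + (norm z)\<^sup>2)) ^ CARD('d) / sqrt (1 + (norm z)\<^sup>2)"

lemma prob_space_gauss_vec: "prob_space gauss_vec"
  unfolding gauss_vec_def by (intro prob_space_PiM prob_space_std_normal)

lemma measurable_gauss_vec_component[measurable]: "(\<lambda>g. g i) \<in> borel_measurable gauss_vec"
  unfolding gauss_vec_def by (rule measurable_PiM_component_rev) auto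

lemma gauss_vec_distr: "distr gauss_vec borel (\<lambda>g. g i) = std_normal"
proof -
  have "distr gauss_vec borel (\<lambda>g. g i) = distr gauss_vec std_normal (\<lambda>g. g i)"
    by (rule distr_cong) auto
  also have "\<dots> = std_normal"
    unfolding gauss_vec_def by (rule distr_PiM_component) (auto intro: prob_space_std_normal)
  finally show ?thesis .
qed

lemma gauss_vec_indep: "prob_space.indep_vars gauss_vec (\<lambda>_. borel) (\<lambda>i g. g i) UNIV"
proof -
  interpret prob_space gauss_vec by (rule prob_space_gauss_vec)
  have "distr gauss_vec (\<Pi>\<^sub>M i\<in>UNIV. borel) (\<lambda>x. \<lambda>i\<in>UNIV. x i) = distr gauss_vec gauss_vec (\<lambda>x. x)"
    by (rule distr_cong) (auto simp: gauss_vec_def intro!: sets_PiM_cong)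
  also have "\<dots> = (\<Pi>\<^sub>M i\<in>UNIV. distr gauss_vec borel (\<lambda>g. g i))"
    unfolding distr_id2[OF refl] gauss_vec_distr by (simp add: gauss_vec_def)
  finally show ?thesis
    by (subst indep_vars_iff_distr_eq_PiM') auto
qed

text \<open>The scalar product of a Gaussian vector with \<open>z\<close> is normal with deviation
  \<open>norm z\<close>, so the average over directions is the one-dimensional integral of
  \<open>normal_integral_ridge\<close> at \<open>\<sigma> = norm z\<close>. This is what makes the
  average radial.\<close>

lemma gauss_vec_ridge:
  fixes z :: "real ^ 'd::finite"
  shows "has_bochner_integral gauss_vec
    (\<lambda>g. poly (ridge_poly CARD('d)) (\<Sum>i\<in>UNIV. g i * z $ i) * exp (- (\<Sum>i\<in>UNIV. g i * z $ i)\<^sup>2 / 2)) (radial_kernel z)"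
proof -
  interpret prob_space "gauss_vec :: ('d \<Rightarrow> real) measure" by (rule prob_space_gauss_vec)
  show ?thesis
  proof (cases "z = 0")
    \<comment> \<open>The law of the scalar product is degenerate here; only the constant
      coefficient of the polynomial counts, and it is 1.\<close>
    case True
    have "poly (ridge_poly d) 0 = 1" for d
    proof -
      have "poly (ridge_poly d) 0 = (\<Sum>l\<in>{0}. real (d choose l) * (- 1) ^ l * (2 ^ l * fact l / fact (2 * l)) * 0 ^ (2 * l))"
        unfolding ridge_poly_def poly_sum poly_monom
        by (intro sum.mono_neutral_right) auto
      then show ?thesis by simp
    qed
    then show ?thesis using True
      by (simp add: radial_kernel_def has_bochner_integral_iff prob_space)
  next
    case False
    \<comment> \<open>Coordinates with \<open>z $ i = 0\<close> are left out, because their terms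
      have no density.\<close>
    define I where "I = {i. z $ i \<noteq> 0}"
    have I: "finite I" "I \<noteq> {}" using False by (auto simp: I_def vec_eq_iff)
    have "indep_vars (\<lambda>_. borel) (\<lambda>i g. g i) I"
      by (rule indep_vars_subset[OF gauss_vec_indep]) auto
    then have ind: "indep_vars (\<lambda>_. borel) (\<lambda>i g. z $ i * g i) I"
      by (rule indep_vars_compose2[where Y = "\<lambda>i x. z $ i * x"]) auto
    have dist: "distributed gauss_vec lborel (\<lambda>g :: 'd \<Rightarrow> real. z $ i * g i) (normal_density 0 \<bar>z $ i\<bar>)" if "i \<in> I" for i
    proof -
      have "distributed gauss_vec lborel (\<lambda>g :: 'd \<Rightarrow> real. g i) std_normal_density"
        unfolding distributed_def using gauss_vec_distr[of i] by (simp cong: distr_cong)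
      then have "distributed gauss_vec lborel (\<lambda>g :: 'd \<Rightarrow> real. 0 + z $ i * g i) (normal_density (0 + z $ i * 0) (\<bar>z $ i\<bar> * 1))"
        using that by (intro normal_density_affine) (auto simp: I_def)
      then show ?thesis by simp
    qed
    have "distributed gauss_vec lborel (\<lambda>g :: 'd \<Rightarrow> real. \<Sum>i\<in>I. z $ i * g i)
      (normal_density (\<Sum>i\<in>I. 0) (sqrt (\<Sum>i\<in>I. \<bar>z $ i\<bar>\<^sup>2)))"
      using I dist ind by (intro sum_indep_normal) (auto simp: I_def)
    also have "(\<Sum>i\<in>I. \<bar>z $ i\<bar>\<^sup>2) = (\<Sum>i\<in>UNIV. \<bar>z $ i\<bar>\<^sup>2)"
      by (intro sum.mono_neutral_left) (auto simp: I_def)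
    also have "sqrt (\<Sum>i\<in>UNIV. \<bar>z $ i\<bar>\<^sup>2) = norm z"
      by (simp add: norm_vec_def L2_set_def)
    also have "(\<lambda>g :: 'd \<Rightarrow> real. \<Sum>i\<in>I. z $ i * g i) = (\<lambda>g. \<Sum>i\<in>UNIV. g i * z $ i)"
      by (rule ext, rule sum.mono_neutral_cong_left) (auto simp: I_def)
    finally have D: "distributed gauss_vec lborel (\<lambda>g :: 'd \<Rightarrow> real. \<Sum>i\<in>UNIV. g i * z $ i) (normal_density 0 (norm z))"
      by simp
    define \<kappa> where "\<kappa> v = poly (ridge_poly CARD('d)) v * exp (- v\<^sup>2 / 2)" for v
    have [measurable]: "\<kappa> \<in> borel_measurable borel" unfolding \<kappa>_def[abs_def]
      by (intro borel_measurable_continuous_onI continuous_intros) auto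
    have N: "has_bochner_integral lborel (\<lambda>v. normal_density 0 (norm z) v * \<kappa> v) (radial_kernel z)"
      unfolding \<kappa>_def radial_kernel_def using False by (intro normal_integral_ridge) auto
    have "integrable gauss_vec (\<lambda>g :: 'd \<Rightarrow> real. \<kappa> (\<Sum>i\<in>UNIV. g i * z $ i))"
      using distributed_integrable[OF D, of \<kappa>] N by (simp add: has_bochner_integral_iff)
    moreover have "(\<integral>g. \<kappa> (\<Sum>i\<in>UNIV. g i * z $ i) \<partial>gauss_vec) = radial_kernel z"
      using distributed_integral[OF D, of \<kappa>] N by (simp add: has_bochner_integral_iff)
    ultimately show ?thesis by (simp add: has_bochner_integral_iff \<kappa>_def)
  qed
qed

subsection \<open>Maurey sampling\<close>

text \<open>Greedy choice instead of independent sampling: since the increment \<open>h - a z\<close> has mean zero under \<open>Q\<close>,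
  some \<open>z\<close> increases the squared norm by at most its second moment.\<close>

lemma maurey_sum:
  fixes a :: "'z \<Rightarrow> 'x \<Rightarrow> real" and V :: real
  assumes Q: "prob_space Q" and \<rho>: "finite_measure \<rho>"
    and a[measurable]: "(\<lambda>(z, x). a z x) \<in> borel_measurable (Q \<Otimes>\<^sub>M \<rho>)"
    and V: "\<And>z x. \<bar>a z x\<bar> \<le> V"
    and h: "\<And>x. x \<in> space \<rho> \<Longrightarrow> h x = (\<integral>z. a z x \<partial>Q)"
  shows "\<exists>z :: nat \<Rightarrow> 'z. (\<lambda>x. \<Sum>i<k. h x - a (z i) x) \<in> borel_measurable \<rho> \<and>
    (\<forall>i<k. z i \<in> space Q) \<and>
    (\<integral>x. (\<Sum>i<k. h x - a (z i) x)\<^sup>2 \<partial>\<rho>) \<le> k * (V\<^sup>2 * measure \<rho> (space \<rho>))"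
proof (induction k)
  case 0
  then show ?case by simp
next
  case (Suc k)
  interpret Q: prob_space Q by (rule Q)
  interpret R: finite_measure \<rho> by (rule \<rho>)
  interpret QR: pair_sigma_finite Q \<rho> ..
  have V0: "0 \<le> V" using V[of undefined undefined] by linarith
  have az: "a z \<in> borel_measurable \<rho>" if "z \<in> space Q" for z
    using measurable_Pair2[OF a that] by simp
  have ax: "(\<lambda>z. a z x) \<in> borel_measurable Q" if "x \<in> space \<rho>" for x
    using measurable_Pair1[OF a that] by simp
  have hm[measurable]: "h \<in> borel_measurable \<rho>"
    using h by (subst measurable_cong[OF h]) (auto intro!: Q.borel_measurable_lebesgue_integral measurable_pair_swap[OF a, unfolded case_prod_unfold] simp: case_prod_unfold)
  have iax: "integrable Q (\<lambda>z. a z x)" if "x \<in> space \<rho>" for x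
    using V ax[OF that] by (intro Q.integrable_const_bound[of _ V]) auto
  have hV: "\<bar>h x\<bar> \<le> V" if "x \<in> space \<rho>" for x
    using iax[OF that] V h[OF that] Q.integral_le_const[of "\<lambda>z. a z x" V] Q.integral_ge_const[of "\<lambda>z. a z x" "- V"]
    by (auto simp: abs_le_iff minus_le_iff)
  obtain z where z: "(\<lambda>x. \<Sum>i<k. h x - a (z i) x) \<in> borel_measurable \<rho>" "\<forall>i<k. z i \<in> space Q"
    "(\<integral>x. (\<Sum>i<k. h x - a (z i) x)\<^sup>2 \<partial>\<rho>) \<le> k * (V\<^sup>2 * measure \<rho> (space \<rho>))"
    using Suc.IH by blast
  define S where "S x = (\<Sum>i<k. h x - a (z i) x)" for x
  have Sm[measurable]: "S \<in> borel_measurable \<rho>" using z(1) by (simp add: S_def[abs_def])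
  have S2: "(\<integral>x. (S x)\<^sup>2 \<partial>\<rho>) \<le> k * (V\<^sup>2 * measure \<rho> (space \<rho>))" using z(3) by (simp add: S_def)
  have Sb: "\<bar>S x\<bar> \<le> k * (2 * V)" if "x \<in> space \<rho>" for x
  proof -
    have "\<bar>h x - a (z i) x\<bar> \<le> 2 * V" for i using hV[OF that] V[of "z i" x] by linarith
    then have "\<bar>S x\<bar> \<le> (\<Sum>i<k. 2 * V)" unfolding S_def by (intro order.trans[OF sum_abs sum_mono]) auto
    then show ?thesis by simp
  qed
  define D where "D z x = (S x + (h x - a z x))\<^sup>2" for z x
  have Db: "\<bar>D z x\<bar> \<le> (Suc k * (2 * V))\<^sup>2" if "x \<in> space \<rho>" for z x
  proof -
    have "\<bar>S x + (h x - a z x)\<bar> \<le> Suc k * (2 * V)"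
      using Sb[OF that] hV[OF that] V[of z x] by (simp add: algebra_simps)
    then show ?thesis unfolding D_def by (simp add: abs_le_square_iff[symmetric])
  qed
  have Dm: "(\<lambda>(z, x). D z x) \<in> borel_measurable (Q \<Otimes>\<^sub>M \<rho>)"
    unfolding D_def by measurable
  have Dint: "integrable (Q \<Otimes>\<^sub>M \<rho>) (\<lambda>(z, x). D z x)"
  proof -
    interpret P: finite_measure "Q \<Otimes>\<^sub>M \<rho>"
      by (rule finite_measure_pair_measure) unfold_locales
    show ?thesis
      using Dm Db by (intro P.integrable_const_bound[of _ "(Suc k * (2 * V))\<^sup>2"]) (auto simp: space_pair_measure)
  qed
  \<comment> \<open>Since \<open>a z x\<close> has mean \<open>h x\<close>, the mean of
    \<open>D z x\<close> is \<open>(S x)\<^sup>2\<close> plus the variance of \<open>a z x\<close>,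
    which is at most \<open>V\<^sup>2\<close>.\<close>
  have inner: "(\<integral>z. D z x \<partial>Q) \<le> (S x)\<^sup>2 + V\<^sup>2" if x: "x \<in> space \<rho>" for x
  proof -
    have i2: "integrable Q (\<lambda>z. (a z x)\<^sup>2)"
      using V ax[OF x] by (intro Q.integrable_const_bound[of _ "V\<^sup>2"])
        (auto simp: abs_le_square_iff[symmetric] V0)
    have "(\<integral>z. D z x \<partial>Q) = (\<integral>z. (S x + h x)\<^sup>2 - 2 * (S x + h x) * a z x + (a z x)\<^sup>2 \<partial>Q)"
      unfolding D_def by (intro Bochner_Integration.integral_cong) (auto simp: power2_eq_square algebra_simps)
    also have "\<dots> = (S x + h x)\<^sup>2 - 2 * (S x + h x) * h x + (\<integral>z. (a z x)\<^sup>2 \<partial>Q)"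
      using i2 iax[OF x] h[OF x] by (simp add: Q.prob_space)
    also have "(\<integral>z. (a z x)\<^sup>2 \<partial>Q) \<le> V\<^sup>2"
      using i2 V by (intro Q.integral_le_const) (auto simp: abs_le_square_iff[symmetric] V0)
    also have "(S x + h x)\<^sup>2 - 2 * (S x + h x) * h x + V\<^sup>2 = (S x)\<^sup>2 - (h x)\<^sup>2 + V\<^sup>2"
      by (simp add: power2_eq_square algebra_simps)
    finally show ?thesis by (smt (verit) zero_le_power2)
  qed
  have S2int: "integrable \<rho> (\<lambda>x. (S x)\<^sup>2)"
  proof (rule R.integrable_const_bound)
    show "AE x in \<rho>. norm ((S x)\<^sup>2) \<le> (k * (2 * V))\<^sup>2"
      using Sb by (auto simp: abs_le_square_iff[symmetric] intro!: AE_I2 intro: order.trans[OF _ abs_ge_self])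
  qed simp
  have "(\<integral>z. (\<integral>x. D z x \<partial>\<rho>) \<partial>Q) = (\<integral>x. (\<integral>z. D z x \<partial>Q) \<partial>\<rho>)"
    using QR.Fubini_integral[OF Dint] by simp
  also have "\<dots> \<le> (\<integral>x. (S x)\<^sup>2 + V\<^sup>2 \<partial>\<rho>)"
    using inner S2int QR.integrable_snd[OF Dint] by (intro integral_mono) auto
  also have "\<dots> = (\<integral>x. (S x)\<^sup>2 \<partial>\<rho>) + V\<^sup>2 * measure \<rho> (space \<rho>)"
    using S2int by simp
  also have "\<dots> \<le> Suc k * (V\<^sup>2 * measure \<rho> (space \<rho>))"
    using S2 by (simp add: algebra_simps)
  finally have E: "(\<integral>z. (\<integral>x. D z x \<partial>\<rho>) \<partial>Q) \<le> Suc k * (V\<^sup>2 * measure \<rho> (space \<rho>))" .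
  have "\<exists>z\<in>space Q. (\<integral>x. D z x \<partial>\<rho>) \<le> Suc k * (V\<^sup>2 * measure \<rho> (space \<rho>))"
  proof (rule ccontr)
    assume "\<not> ?thesis"
    then have "\<And>z. z \<in> space Q \<Longrightarrow> Suc k * (V\<^sup>2 * measure \<rho> (space \<rho>)) < (\<integral>x. D z x \<partial>\<rho>)"
      by force
    then have "Suc k * (V\<^sup>2 * measure \<rho> (space \<rho>)) < (\<integral>z. (\<integral>x. D z x \<partial>\<rho>) \<partial>Q)"
      using QR.integrable_fst[OF Dint] by (intro Q.expectation_greater) auto
    then show False using E by simp
  qed
  then obtain z' where z': "z' \<in> space Q" "(\<integral>x. D z' x \<partial>\<rho>) \<le> Suc k * (V\<^sup>2 * measure \<rho> (space \<rho>))" by blast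
  define Z where "Z = z(k := z')"
  have Zsum: "(\<Sum>i<Suc k. h x - a (Z i) x) = S x + (h x - a z' x)" for x
  proof -
    have "(\<Sum>i<k. h x - a (Z i) x) = S x" unfolding S_def Z_def by (intro sum.cong) auto
    then show ?thesis by (simp add: Z_def)
  qed
  show ?case
  proof (intro exI[of _ Z] conjI)
    show "(\<lambda>x. \<Sum>i<Suc k. h x - a (Z i) x) \<in> borel_measurable \<rho>"
      unfolding Zsum using az[OF z'(1)] by measurable
    show "\<forall>i<Suc k. Z i \<in> space Q" using z(2) z'(1) by (auto simp: Z_def less_Suc_eq)
    show "(\<integral>x. (\<Sum>i<Suc k. h x - a (Z i) x)\<^sup>2 \<partial>\<rho>) \<le> Suc k * (V\<^sup>2 * measure \<rho> (space \<rho>))"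
      unfolding Zsum using z'(2) by (simp add: D_def)
  qed
qed

text \<open>Passes from the squared norm to the \<open>L^1\<close> norm. In place of Cauchy-Schwarz,
  the inequality \<open>2 * \<bar>S x\<bar> \<le> (S x)\<^sup>2 / c + c\<close> is integrated
  against the finite measure \<open>\<rho>\<close>.\<close>

lemma maurey:
  fixes a :: "'z \<Rightarrow> 'x \<Rightarrow> real" and V :: real
  assumes Q: "prob_space Q" and \<rho>: "finite_measure \<rho>"
    and a: "(\<lambda>(z, x). a z x) \<in> borel_measurable (Q \<Otimes>\<^sub>M \<rho>)"
    and V: "\<And>z x. \<bar>a z x\<bar> \<le> V" "0 < V"
    and h: "\<And>x. x \<in> space \<rho> \<Longrightarrow> h x = (\<integral>z. a z x \<partial>Q)" and k: "1 \<le> k"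
  shows "\<exists>z :: nat \<Rightarrow> 'z. (\<forall>i<k. z i \<in> space Q) \<and>
    (\<integral>\<^sup>+x. ennreal \<bar>h x - (\<Sum>i<k. a (z i) x) / k\<bar> \<partial>\<rho>) \<le> ennreal (V * measure \<rho> (space \<rho>) / sqrt k)"
proof -
  interpret R: finite_measure \<rho> by (rule \<rho>)
  interpret Q: prob_space Q by (rule Q)
  obtain z where z: "(\<lambda>x. \<Sum>i<k. h x - a (z i) x) \<in> borel_measurable \<rho>" "\<forall>i<k. z i \<in> space Q"
    "(\<integral>x. (\<Sum>i<k. h x - a (z i) x)\<^sup>2 \<partial>\<rho>) \<le> k * (V\<^sup>2 * measure \<rho> (space \<rho>))"
    using maurey_sum[OF Q \<rho> a V(1) h] by blast
  define S where "S x = (\<Sum>i<k. h x - a (z i) x)" for x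
  have [measurable]: "S \<in> borel_measurable \<rho>" using z(1) by (simp add: S_def[abs_def])
  have hV: "\<bar>h x\<bar> \<le> V" if "x \<in> space \<rho>" for x
  proof -
    have "(\<lambda>z. a z x) \<in> borel_measurable Q" using measurable_Pair1[OF a that] by simp
    then have "integrable Q (\<lambda>z. a z x)" using V by (intro Q.integrable_const_bound[of _ V]) auto
    then show ?thesis
      using V h[OF that] Q.integral_le_const[of "\<lambda>z. a z x" V] Q.integral_ge_const[of "\<lambda>z. a z x" "- V"]
      by (auto simp: abs_le_iff minus_le_iff)
  qed
  have Sb: "\<bar>S x\<bar> \<le> k * (2 * V)" if "x \<in> space \<rho>" for x
  proof -
    have "\<bar>h x - a (z i) x\<bar> \<le> 2 * V" for i using hV[OF that] V(1)[of "z i" x] by linarith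
    then have "\<bar>S x\<bar> \<le> (\<Sum>i<k. 2 * V)" unfolding S_def by (intro order.trans[OF sum_abs sum_mono]) auto
    then show ?thesis by simp
  qed
  have Sint: "integrable \<rho> (\<lambda>x. \<bar>S x\<bar>)" "integrable \<rho> (\<lambda>x. (S x)\<^sup>2)"
  proof -
    show "integrable \<rho> (\<lambda>x. \<bar>S x\<bar>)"
      using Sb by (intro R.integrable_const_bound[of _ "k * (2 * V)"]) auto
    show "integrable \<rho> (\<lambda>x. (S x)\<^sup>2)"
      using Sb by (intro R.integrable_const_bound[of _ "(k * (2 * V))\<^sup>2"])
        (auto simp: abs_le_square_iff[symmetric] intro!: AE_I2 intro: order.trans[OF _ abs_ge_self])
  qed
  \<comment> \<open>The value at which both halves of the bound agree:
    \<open>k * V\<^sup>2 / c = c\<close>.\<close>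
  define c where "c = V * sqrt k"
  have c: "0 < c" using V(2) k by (simp add: c_def)
  have amgm: "\<bar>S x\<bar> \<le> ((S x)\<^sup>2 / c + c) / 2" for x
  proof -
    have "0 \<le> (\<bar>S x\<bar> - c)\<^sup>2" by simp
    then have "2 * \<bar>S x\<bar> * c \<le> (S x)\<^sup>2 + c\<^sup>2" by (simp add: power2_eq_square algebra_simps)
    then show ?thesis using c by (simp add: field_simps power2_eq_square)
  qed
  have "(\<integral>x. \<bar>S x\<bar> \<partial>\<rho>) \<le> (\<integral>x. ((S x)\<^sup>2 / c + c) / 2 \<partial>\<rho>)"
    using Sint amgm by (intro integral_mono) auto
  also have "\<dots> = ((\<integral>x. (S x)\<^sup>2 \<partial>\<rho>) / c + c * measure \<rho> (space \<rho>)) / 2"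
    using Sint by simp
  also have "\<dots> \<le> (k * (V\<^sup>2 * measure \<rho> (space \<rho>)) / c + c * measure \<rho> (space \<rho>)) / 2"
    using z(3) c by (intro divide_right_mono add_right_mono) (auto simp: S_def)
  also have "\<dots> = V * sqrt k * measure \<rho> (space \<rho>)"
    using V(2) k real_sqrt_pow2[of k] by (simp add: c_def field_simps power2_eq_square)
  finally have S1: "(\<integral>x. \<bar>S x\<bar> \<partial>\<rho>) \<le> V * sqrt k * measure \<rho> (space \<rho>)" .
  have eq: "\<bar>h x - (\<Sum>i<k. a (z i) x) / k\<bar> = \<bar>S x\<bar> / k" for x
    using k by (simp add: S_def sum_subtractf abs_divide[symmetric] field_simps)
  have "(\<integral>\<^sup>+x. ennreal \<bar>h x - (\<Sum>i<k. a (z i) x) / k\<bar> \<partial>\<rho>) = ennreal ((\<integral>x. \<bar>S x\<bar> \<partial>\<rho>) / k)"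
    unfolding eq using Sint(1) by (subst nn_integral_eq_integral) auto
  also have "\<dots> \<le> ennreal (V * sqrt k * measure \<rho> (space \<rho>) / k)"
    using S1 by (intro ennreal_leI divide_right_mono) auto
  also have "V * sqrt k * measure \<rho> (space \<rho>) / k = V * measure \<rho> (space \<rho>) / sqrt k"
    using k by (simp add: field_simps)
  finally show ?thesis using z(2) by blast
qed

section \<open>The radial kernel as an approximate identity\<close>

lemma integrable_pair_product:
  fixes f g :: "_ \<Rightarrow> real"
  assumes "sigma_finite_measure M1" "sigma_finite_measure M2" and f: "integrable M1 f" and g: "integrable M2 g"
  shows "integrable (M1 \<Otimes>\<^sub>M M2) (\<lambda>(x, y). f x * g y)"
    "(\<integral>(x, y). f x * g y \<partial>(M1 \<Otimes>\<^sub>M M2)) = integral\<^sup>L M1 f * integral\<^sup>L M2 g"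
proof -
  interpret pair_sigma_finite M1 M2
    using assms by (simp add: pair_sigma_finite_def)
  have [measurable]: "f \<in> borel_measurable M1" "g \<in> borel_measurable M2" using f g by auto
  show int: "integrable (M1 \<Otimes>\<^sub>M M2) (\<lambda>(x, y). f x * g y)"
    by (rule Fubini_integrable) (use f g in \<open>auto simp: abs_mult\<close>)
  show "(\<integral>(x, y). f x * g y \<partial>(M1 \<Otimes>\<^sub>M M2)) = integral\<^sup>L M1 f * integral\<^sup>L M2 g"
    using integral_fst'[OF int] by simp
qed

lemma integrable_prod_Basis:
  fixes f :: "real \<Rightarrow> real"
  assumes f: "integrable lborel f" and f0: "\<And>x. 0 \<le> f x"
  shows "integrable lborel (\<lambda>z :: 'a::euclidean_space. \<Prod>b\<in>Basis. f (z \<bullet> b))"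
proof -
  have [measurable]: "f \<in> borel_measurable borel" using f by auto
  have "(\<integral>\<^sup>+z. ennreal (norm (\<Prod>b\<in>(Basis :: 'a set). f (z \<bullet> b))) \<partial>lborel)
      = (\<integral>\<^sup>+z. (\<Prod>b\<in>(Basis :: 'a set). ennreal (f (z \<bullet> b))) \<partial>lborel)"
    using f0 by (intro nn_integral_cong) (simp add: prod_ennreal abs_prod)
  also have "\<dots> = (\<Prod>b\<in>(Basis :: 'a set). (\<integral>\<^sup>+x. ennreal (f x) \<partial>lborel))"
    by (rule nn_integral_lborel_prod) auto
  also have "\<dots> < \<infinity>"
    using f f0 by (simp add: power_less_top_ennreal integrable_iff_bounded)
  finally show ?thesis
    by (simp add: integrable_iff_bounded)
qed

text \<open>Strict positivity is asked off the origin only, because the integrand of the Gaussian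
  second moment, a later application, vanishes there.\<close>

lemma integral_lborel_pos:
  fixes f :: "'a::euclidean_space \<Rightarrow> real"
  assumes f: "integrable lborel f" and f0: "\<And>x. 0 \<le> f x" "\<And>x. x \<noteq> 0 \<Longrightarrow> 0 < f x"
  shows "0 < integral\<^sup>L lborel f"
proof (rule ccontr)
  assume "\<not> ?thesis"
  moreover have "0 \<le> integral\<^sup>L lborel f" using f0(1) by (rule Bochner_Integration.integral_nonneg)
  ultimately have "AE x in lborel. f x = 0"
    using f f0(1) by (subst integral_nonneg_eq_0_iff_AE[symmetric]) auto
  then have "AE x in (lborel :: 'a measure). False"
    using AE_lborel_singleton[of 0] by eventually_elim (use f0(2) in fastforce)
  then show False
    using emeasure_lborel_UNIV[where 'a = 'a] by (simp add: AE_iff_null null_sets_def)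
qed

lemma radial_kernel_pos: "0 < radial_kernel z"
  unfolding radial_kernel_def by (simp add: add_pos_nonneg)

lemma borel_measurable_radial_kernel[measurable]: "radial_kernel \<in> borel_measurable borel"
  unfolding radial_kernel_def[abs_def] by measurable

text \<open>This explains the exponent of the kernel: each of the \<open>d\<close> factors
  \<open>1 / (1 + |z|^2)\<close> is at most a Cauchy profile in one coordinate, and the remaining
  half power absorbs \<open>1 + norm z\<close>. Integrability of the first moment thereby factorizes
  over the coordinates.\<close>

lemma radial_kernel_le:
  fixes z :: "real ^ 'd::finite"
  shows "(1 + norm z) * radial_kernel z \<le> 2 * (\<Prod>b\<in>Basis. 1 / (1 + (z \<bullet> b)\<^sup>2))"
proof -
  have pos: "0 < 1 + (norm z)\<^sup>2" by (simp add: add_pos_nonneg)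
  have "(\<Prod>b\<in>(Basis :: (real ^ 'd) set). 1 / (1 + (norm z)\<^sup>2)) \<le> (\<Prod>b\<in>Basis. 1 / (1 + (z \<bullet> b)\<^sup>2))"
  proof (intro prod_mono conjI)
    fix b :: "real ^ 'd" assume "b \<in> Basis"
    then have "(z \<bullet> b)\<^sup>2 \<le> (norm z)\<^sup>2"
      using Basis_le_norm[of b z] by (metis abs_le_square_iff abs_norm_cancel)
    then show "1 / (1 + (norm z)\<^sup>2) \<le> 1 / (1 + (z \<bullet> b)\<^sup>2)"
      by (intro divide_left_mono) (auto intro!: mult_pos_pos add_pos_nonneg)
  qed simp
  then have P: "(1 / (1 + (norm z)\<^sup>2)) ^ CARD('d) \<le> (\<Prod>b\<in>Basis. 1 / (1 + (z \<bullet> b)\<^sup>2))"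
    by simp
  have "1 \<le> sqrt (1 + (norm z)\<^sup>2)" by simp
  moreover have "norm z \<le> sqrt (1 + (norm z)\<^sup>2)" by (rule real_le_rsqrt) simp
  ultimately have "(1 + norm z) / sqrt (1 + (norm z)\<^sup>2) \<le> 2"
    by (subst pos_divide_le_eq) linarith+
  then have "(1 + norm z) / sqrt (1 + (norm z)\<^sup>2) * (1 / (1 + (norm z)\<^sup>2)) ^ CARD('d) \<le> 2 * (\<Prod>b\<in>Basis. 1 / (1 + (z \<bullet> b)\<^sup>2))"
    using P pos by (intro mult_mono) auto
  then show ?thesis by (simp add: radial_kernel_def mult_ac)
qed

lemma integrable_radial_kernel:
  "integrable lborel (\<lambda>z :: real ^ 'd::finite. (1 + norm z) * radial_kernel z)"
  "integrable lborel (radial_kernel :: real ^ 'd \<Rightarrow> real)"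
proof -
  have "integrable lborel (\<lambda>x::real. 1 / (1 + x\<^sup>2))"
    using integrable_inverse_1_plus_square by (simp add: set_integrable_def einterval_def inverse_eq_divide)
  then have int: "integrable lborel (\<lambda>z. 2 * (\<Prod>b\<in>(Basis :: (real ^ 'd) set). 1 / (1 + (z \<bullet> b)\<^sup>2)))"
    by (intro integrable_mult_right integrable_prod_Basis) (auto simp: add_nonneg_nonneg)
  show 1: "integrable lborel (\<lambda>z :: real ^ 'd. (1 + norm z) * radial_kernel z)"
  proof (rule Bochner_Integration.integrable_bound[OF int])
    show "AE z in lborel. norm ((1 + norm z) * radial_kernel (z :: real ^ 'd)) \<le> norm (2 * (\<Prod>b\<in>(Basis :: (real ^ 'd) set). 1 / (1 + (z \<bullet> b)\<^sup>2)))"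
    proof (intro AE_I2)
      fix z :: "real ^ 'd"
      have "norm ((1 + norm z) * radial_kernel z) = (1 + norm z) * radial_kernel z"
        using radial_kernel_pos[of z] by (simp add: abs_mult)
      also have "\<dots> \<le> norm (2 * (\<Prod>b\<in>(Basis :: (real ^ 'd) set). 1 / (1 + (z \<bullet> b)\<^sup>2)))"
        unfolding real_norm_def by (rule order.trans[OF radial_kernel_le abs_ge_self])
      finally show "norm ((1 + norm z) * radial_kernel z) \<le> norm (2 * (\<Prod>b\<in>(Basis :: (real ^ 'd) set). 1 / (1 + (z \<bullet> b)\<^sup>2)))" .
    qed
  qed simp
  show "integrable lborel (radial_kernel :: real ^ 'd \<Rightarrow> real)"
  proof (rule Bochner_Integration.integrable_bound[OF 1])
    have "norm (radial_kernel z) \<le> norm ((1 + norm z) * radial_kernel z)" for z :: "real ^ 'd"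
      using mult_right_mono[of 1 "1 + norm z" "\<bar>radial_kernel z\<bar>"] by (simp add: abs_mult)
    then show "AE z in lborel. norm (radial_kernel z) \<le> norm ((1 + norm z) * radial_kernel (z :: real ^ 'd))"
      by (intro AE_I2)
  qed simp
qed

definition kernel_mass :: "'d::finite itself \<Rightarrow> real" where
  "kernel_mass T = integral\<^sup>L lborel (radial_kernel :: real ^ 'd \<Rightarrow> real)"

lemma kernel_mass_pos: "0 < kernel_mass TYPE('d::finite)"
  unfolding kernel_mass_def
  by (intro integral_lborel_pos integrable_radial_kernel less_imp_le radial_kernel_pos)

definition smooth :: "(real ^ 'd::finite \<Rightarrow> real) \<Rightarrow> real \<Rightarrow> real ^ 'd \<Rightarrow> real" where
  "smooth f t x = (\<integral>y. f y * radial_kernel ((1 / t) *\<^sub>R (x - y)) \<partial>lborel) / (t ^ CARD('d) * kernel_mass TYPE('d))"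

text \<open>With \<open>y = x + t *\<^sub>R z\<close> the smoothing error becomes an average over
  \<open>z\<close> of the increments \<open>f (x + t *\<^sub>R z) - f x\<close>, weighted by the
  normalized kernel. After exchanging the integrals the modulus gives
  \<open>m * (t * norm z) powr s\<close>, and \<open>norm z powr s \<le> 1 + norm z\<close> because
  \<open>s \<le> 1\<close>.\<close>

lemma smooth_L1_le:
  fixes f :: "real ^ 'd::finite \<Rightarrow> real"
  assumes t: "0 < t" and f[measurable]: "f \<in> borel_measurable borel" and fb: "\<And>x. \<bar>f x\<bar> \<le> 1"
    and s: "0 < s" "s \<le> 1" and m: "0 \<le> m"
    and mod: "\<And>u. u \<noteq> 0 \<Longrightarrow> (\<integral>\<^sup>+x. ennreal \<bar>f (x + u) - f x\<bar> \<partial>lborel) \<le> ennreal (m * norm u powr s)"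
  shows "(\<integral>\<^sup>+x. ennreal \<bar>smooth f t x - f x\<bar> \<partial>lborel)
    \<le> ennreal (m * t powr s * ((\<integral>z. (1 + norm z) * radial_kernel (z :: real ^ 'd) \<partial>lborel) / kernel_mass TYPE('d)))"
proof -
  define Z where "Z = kernel_mass TYPE('d)"
  have Z: "0 < Z" unfolding Z_def by (rule kernel_mass_pos)
  let ?K = "radial_kernel :: real ^ 'd \<Rightarrow> real"
  have K0: "0 \<le> ?K z" for z using radial_kernel_pos[of z] by simp
  note Kint = integrable_radial_kernel[where 'd = 'd]
  have fK: "integrable lborel (\<lambda>z. f (x + t *\<^sub>R z) * ?K z)" for x
    by (rule Bochner_Integration.integrable_bound[OF Kint(2)])
       (use fb K0 in \<open>auto simp: abs_mult intro!: mult_left_le_one_le\<close>)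
  have sm: "smooth f t x = (\<integral>z. f (x + t *\<^sub>R z) * ?K z \<partial>lborel) / Z" for x
  proof -
    have "(\<integral>y. f y * ?K ((1 / t) *\<^sub>R (x - y)) \<partial>lborel)
      = (\<integral>y. f y * ?K ((1 / t) *\<^sub>R (x - y)) \<partial>density (distr lborel borel (\<lambda>z. x + t *\<^sub>R z)) (\<lambda>_. \<bar>t\<bar> ^ DIM(real ^ 'd)))"
      using t by (subst lborel_affine[of t x]) auto
    also have "\<dots> = (\<integral>z. \<bar>t\<bar> ^ CARD('d) * (f (x + t *\<^sub>R z) * ?K ((1 / t) *\<^sub>R (x - (x + t *\<^sub>R z)))) \<partial>lborel)"
      by (subst integral_density) (auto simp: integral_distr)
    also have "\<dots> = t ^ CARD('d) * (\<integral>z. f (x + t *\<^sub>R z) * ?K z \<partial>lborel)"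
    proof -
      have "?K ((1 / t) *\<^sub>R (x - (x + t *\<^sub>R z))) = ?K z" for z
        using t by (simp add: radial_kernel_def)
      then show ?thesis using t by simp
    qed
    finally show ?thesis
      using t Z by (simp add: smooth_def Z_def)
  qed
  have pt: "ennreal \<bar>smooth f t x - f x\<bar> \<le> (\<integral>\<^sup>+z. ennreal (\<bar>f (x + t *\<^sub>R z) - f x\<bar> * ?K z / Z) \<partial>lborel)" for x
  proof -
    have "f x = (\<integral>z. f x * ?K z \<partial>lborel) / Z"
      using Z by (simp add: Z_def kernel_mass_def)
    then have "smooth f t x - f x = (\<integral>z. f (x + t *\<^sub>R z) * ?K z - f x * ?K z \<partial>lborel) / Z"
      using fK[of x] Kint(2) unfolding sm by (simp add: Bochner_Integration.integral_diff diff_divide_distrib)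
    also have "\<dots> = (\<integral>z. (f (x + t *\<^sub>R z) - f x) * ?K z / Z \<partial>lborel)"
      by (simp add: algebra_simps)
    finally have "ennreal \<bar>smooth f t x - f x\<bar> = ennreal (norm (\<integral>z. (f (x + t *\<^sub>R z) - f x) * ?K z / Z \<partial>lborel))"
      by simp
    also have "\<dots> \<le> (\<integral>\<^sup>+z. ennreal (norm ((f (x + t *\<^sub>R z) - f x) * ?K z / Z)) \<partial>lborel)"
      by (intro integral_norm_bound_ennreal) (use fK[of x] Kint(2) in \<open>auto simp: algebra_simps\<close>)
    also have "\<dots> = (\<integral>\<^sup>+z. ennreal (\<bar>f (x + t *\<^sub>R z) - f x\<bar> * ?K z / Z) \<partial>lborel)"
      using K0 Z by (simp add: abs_mult)
    finally show ?thesis .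
  qed
  have "(\<integral>\<^sup>+x. ennreal \<bar>smooth f t x - f x\<bar> \<partial>lborel)
    \<le> (\<integral>\<^sup>+x. (\<integral>\<^sup>+z. ennreal (\<bar>f (x + t *\<^sub>R z) - f x\<bar> * ?K z / Z) \<partial>lborel) \<partial>lborel)"
    by (intro nn_integral_mono pt)
  also have "\<dots> = (\<integral>\<^sup>+z. (\<integral>\<^sup>+x. ennreal (\<bar>f (x + t *\<^sub>R z) - f x\<bar> * ?K z / Z) \<partial>lborel) \<partial>lborel)"
    by (rule lborel_pair.Fubini') measurable
  also have "\<dots> \<le> (\<integral>\<^sup>+z. ennreal (m * t powr s / Z * ((1 + norm z) * ?K z)) \<partial>lborel)"
  proof (intro nn_integral_mono)
    fix z :: "real ^ 'd"
    have "(\<integral>\<^sup>+x. ennreal \<bar>f (x + t *\<^sub>R z) - f x\<bar> \<partial>lborel) \<le> ennreal (m * (t powr s * (1 + norm z)))"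
    proof (cases "z = 0")
      case False
      have "norm z powr s \<le> 1 + norm z"
      proof (cases "norm z \<le> 1")
        case True
        have "norm z powr s \<le> 1" using s True by (intro powr_le1) auto
        also have "1 \<le> 1 + norm z" by simp
        finally show ?thesis .
      next
        case False
        then have "norm z powr s \<le> norm z powr 1" using s by (intro powr_mono) auto
        then show ?thesis by simp
      qed
      then have "norm (t *\<^sub>R z) powr s \<le> t powr s * (1 + norm z)"
        using t by (simp add: powr_mult)
      then have "m * norm (t *\<^sub>R z) powr s \<le> m * (t powr s * (1 + norm z))"
        using m by (intro mult_left_mono)
      then show ?thesis
        using mod[of "t *\<^sub>R z"] False t by (auto intro: order.trans ennreal_leI)
    qed simp
    then have "(\<integral>\<^sup>+x. ennreal \<bar>f (x + t *\<^sub>R z) - f x\<bar> \<partial>lborel) * ennreal (?K z / Z) \<le> ennreal (m * (t powr s * (1 + norm z))) * ennreal (?K z / Z)"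
      by (rule mult_right_mono) simp
    moreover have "(\<integral>\<^sup>+x. ennreal (\<bar>f (x + t *\<^sub>R z) - f x\<bar> * ?K z / Z) \<partial>lborel)
       = (\<integral>\<^sup>+x. ennreal \<bar>f (x + t *\<^sub>R z) - f x\<bar> \<partial>lborel) * ennreal (?K z / Z)"
    proof -
      have "(\<integral>\<^sup>+x. ennreal (\<bar>f (x + t *\<^sub>R z) - f x\<bar> * ?K z / Z) \<partial>lborel)
        = (\<integral>\<^sup>+x. ennreal \<bar>f (x + t *\<^sub>R z) - f x\<bar> * ennreal (?K z / Z) \<partial>lborel)"
        using K0 Z by (intro nn_integral_cong) (simp add: ennreal_mult[symmetric])
      then show ?thesis by (simp add: nn_integral_multc)
    qed
    moreover have "ennreal (m * (t powr s * (1 + norm z))) * ennreal (?K z / Z) = ennreal (m * t powr s / Z * ((1 + norm z) * ?K z))"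
      using m K0[of z] Z t by (subst ennreal_mult[symmetric]) (auto simp: mult_ac)
    ultimately show "(\<integral>\<^sup>+x. ennreal (\<bar>f (x + t *\<^sub>R z) - f x\<bar> * ?K z / Z) \<partial>lborel)
      \<le> ennreal (m * t powr s / Z * ((1 + norm z) * ?K z))" by simp
  qed
  also have "\<dots> = ennreal (\<integral>z. m * t powr s / Z * ((1 + norm z) * ?K z) \<partial>lborel)"
    using m Z K0 by (intro nn_integral_eq_integral integrable_mult_right Kint) auto
  also have "\<dots> = ennreal (m * t powr s * ((\<integral>z. (1 + norm z) * ?K z \<partial>lborel) / Z))"
    by simp
  finally show ?thesis by (simp add: Z_def)
qed

subsection \<open>Approximation of the smoothed function by networks\<close>

definition gnorm1 :: "('d::finite \<Rightarrow> real) \<Rightarrow> real" where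
  "gnorm1 g = (\<Sum>i\<in>UNIV. \<bar>g i\<bar>)"

lemma gnorm1_nonneg: "0 \<le> gnorm1 g"
  unfolding gnorm1_def by (intro sum_nonneg) auto

lemma borel_measurable_gnorm1[measurable]: "gnorm1 \<in> borel_measurable gauss_vec"
  unfolding gnorm1_def[abs_def] by measurable

lemma integrable_gnorm1: "integrable gauss_vec (\<lambda>g. gnorm1 g + 1)"
proof -
  interpret prob_space gauss_vec by (rule prob_space_gauss_vec)
  have "integrable gauss_vec (\<lambda>g. \<bar>g i\<bar>)" for i
  proof -
    have "integrable lborel (\<lambda>x. std_normal_density x * \<bar>x\<bar>)"
      using integrable_abs[OF integrable_std_normal_moment[of 1]] by (simp add: abs_mult)
    then have "integrable std_normal (\<lambda>x. \<bar>x\<bar>)"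
      by (subst integrable_density) (auto simp: normal_density_nonneg)
    then have "integrable (distr gauss_vec borel (\<lambda>g. g i)) (\<lambda>x. \<bar>x\<bar>)"
      by (simp only: gauss_vec_distr)
    then show ?thesis
      by (subst (asm) integrable_distr_eq) auto
  qed
  then show ?thesis
    unfolding gnorm1_def by (intro Bochner_Integration.integrable_add Bochner_Integration.integrable_sum) auto
qed

text \<open>The second derivative of the ridge profile \<open>\<kappa>\<close>: the signed weight
  with which a rectifier of offset \<open>u\<close> occurs.\<close>

definition ridge_density :: "'d::finite itself \<Rightarrow> real \<Rightarrow> real" where
  "ridge_density T u = poly (gauss_deriv (gauss_deriv (ridge_poly CARD('d)))) u * exp (- u\<^sup>2 / 2)"

lemma borel_measurable_ridge_density[measurable]: "ridge_density T \<in> borel_measurable borel"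
  unfolding ridge_density_def[abs_def]
  by (intro borel_measurable_continuous_onI continuous_intros) auto

lemma integrable_ridge_density: "integrable lborel (\<lambda>u. \<bar>ridge_density T u\<bar> * (\<bar>u\<bar> + 1))"
proof -
  let ?q = "gauss_deriv (gauss_deriv (ridge_poly CARD('a)))"
  have "integrable lborel (\<lambda>u. \<bar>poly (?q * [:0, 1:]) u * exp (- u\<^sup>2 / 2)\<bar> + \<bar>poly ?q u * exp (- u\<^sup>2 / 2)\<bar>)"
    by (intro Bochner_Integration.integrable_add integrable_abs integrable_poly_times_gaussian)
  then show ?thesis by (simp add: ridge_density_def abs_mult algebra_simps)
qed

lemma integrable_gu:
  fixes \<phi> :: "('d::finite \<Rightarrow> real) \<times> real \<Rightarrow> real"
  assumes "\<phi> \<in> borel_measurable (gauss_vec \<Otimes>\<^sub>M lborel)"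
    and "\<And>g u. \<bar>\<phi> (g, u)\<bar> \<le> c * ((gnorm1 g + 1) * (\<bar>ridge_density TYPE('d) u\<bar> * (\<bar>u\<bar> + 1)))"
  shows "integrable (gauss_vec \<Otimes>\<^sub>M lborel) \<phi>"
proof (rule Bochner_Integration.integrable_bound)
  have "sigma_finite_measure (gauss_vec :: ('d \<Rightarrow> real) measure)"
    using prob_space_gauss_vec prob_space_imp_sigma_finite by blast
  then show "integrable (gauss_vec \<Otimes>\<^sub>M lborel) (\<lambda>p :: ('d \<Rightarrow> real) \<times> real. c * (case p of (g, u) \<Rightarrow> (gnorm1 g + 1) * (\<bar>ridge_density TYPE('d) u\<bar> * (\<bar>u\<bar> + 1))))"
    by (intro integrable_mult_right integrable_pair_product integrable_gnorm1 integrable_ridge_density) (auto intro: sigma_finite_lborel)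
  show "AE p in gauss_vec \<Otimes>\<^sub>M lborel. norm (\<phi> p) \<le> norm (c * (case p of (g, u) \<Rightarrow> (gnorm1 g + 1) * (\<bar>ridge_density TYPE('d) u\<bar> * (\<bar>u\<bar> + 1))))"
    using assms(2) by (auto intro!: AE_I2 intro: order.trans[OF _ abs_ge_self])
qed fact

text \<open>The rectifier expansion of the profile averaged over the direction, put under one
  product measure so that direction and offset can later be sampled together.\<close>

lemma radial_kernel_eq_gu:
  fixes z :: "real ^ 'd::finite"
  shows "integrable (gauss_vec \<Otimes>\<^sub>M lborel) (\<lambda>(g, u). ridge_density TYPE('d) u * relu ((\<Sum>i\<in>UNIV. g i * z $ i) - u))"
    "(\<integral>(g, u). ridge_density TYPE('d) u * relu ((\<Sum>i\<in>UNIV. g i * z $ i) - u) \<partial>(gauss_vec \<Otimes>\<^sub>M lborel)) = radial_kernel z"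
proof -
  interpret prob_space "gauss_vec :: ('d \<Rightarrow> real) measure" by (rule prob_space_gauss_vec)
  interpret pair_sigma_finite "gauss_vec :: ('d \<Rightarrow> real) measure" lborel ..
  let ?\<phi> = "\<lambda>p :: ('d \<Rightarrow> real) \<times> real. case p of (g, u) \<Rightarrow> ridge_density TYPE('d) u * relu ((\<Sum>i\<in>UNIV. g i * z $ i) - u)"
  show int: "integrable (gauss_vec \<Otimes>\<^sub>M lborel) ?\<phi>"
  proof (rule integrable_gu)
    show "?\<phi> \<in> borel_measurable (gauss_vec \<Otimes>\<^sub>M lborel)"
      unfolding relu_def by measurable
    fix g :: "'d \<Rightarrow> real" and u :: real
    have "\<bar>\<Sum>i\<in>UNIV. g i * z $ i\<bar> \<le> (\<Sum>i\<in>UNIV. \<bar>g i\<bar> * norm z)"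
      by (intro order.trans[OF sum_abs sum_mono]) (auto simp: abs_mult intro!: mult_left_mono component_le_norm_cart)
    also have "\<dots> = gnorm1 g * norm z" by (simp add: gnorm1_def sum_distrib_right)
    finally have "\<bar>relu ((\<Sum>i\<in>UNIV. g i * z $ i) - u)\<bar> \<le> gnorm1 g * norm z + \<bar>u\<bar>"
      unfolding relu_def by (auto simp: max_def)
    also have "\<dots> \<le> (norm z + 1) * ((gnorm1 g + 1) * (\<bar>u\<bar> + 1))"
      using gnorm1_nonneg[of g] norm_ge_zero[of z] abs_ge_zero[of u]
      by (simp add: algebra_simps add_nonneg_nonneg add_increasing)
    finally have "\<bar>ridge_density TYPE('d) u\<bar> * \<bar>relu ((\<Sum>i\<in>UNIV. g i * z $ i) - u)\<bar> \<le> \<bar>ridge_density TYPE('d) u\<bar> * ((norm z + 1) * ((gnorm1 g + 1) * (\<bar>u\<bar> + 1)))"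
      by (intro mult_left_mono) auto
    then show "\<bar>case (g, u) of (g, u) \<Rightarrow> ridge_density TYPE('d) u * relu ((\<Sum>i\<in>UNIV. g i * z $ i) - u)\<bar>
      \<le> (norm z + 1) * ((gnorm1 g + 1) * (\<bar>ridge_density TYPE('d) u\<bar> * (\<bar>u\<bar> + 1)))"
      by (simp add: abs_mult mult_ac)
  qed
  have "(\<integral>p. ?\<phi> p \<partial>(gauss_vec \<Otimes>\<^sub>M lborel)) = (\<integral>g. (\<integral>u. ridge_density TYPE('d) u * relu ((\<Sum>i\<in>UNIV. g i * z $ i) - u) \<partial>lborel) \<partial>gauss_vec)"
    using integral_fst'[OF int] by simp
  also have "\<dots> = radial_kernel z"
    unfolding ridge_density_def gaussian_eq_relu_superposition[symmetric]
    using gauss_vec_ridge[of z] by (rule has_bochner_integral_integral_eq)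
  finally show "(\<integral>p. ?\<phi> p \<partial>(gauss_vec \<Otimes>\<^sub>M lborel)) = radial_kernel z" .
qed

text \<open>The constant in the bound on the total mass in \<open>smooth_network_approx\<close>:
  \<open>2 ^ CARD('d)\<close> comes from the volume of a cube of side \<open>2 * r\<close> around
  the ball, the further factor 2 from the bound on the normalization \<open>\<Lambda>\<close>
  there.\<close>

definition ridge_const :: "'d::finite itself \<Rightarrow> real" where
  "ridge_const T = 2 ^ (CARD('d) + 1) / kernel_mass TYPE('d) * (\<integral>g. gnorm1 g + 1 \<partial>(gauss_vec :: ('d \<Rightarrow> real) measure))
     * (\<integral>u. \<bar>ridge_density TYPE('d) u\<bar> * (\<bar>u\<bar> + 1) \<partial>lborel)"

text \<open>The ball lies in a cube of side \<open>2 * r\<close>, whose volume is a plain power; the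
  loss against the volume of the ball only affects \<open>ridge_const\<close>.\<close>

lemma lborel_ball_integral_le:
  fixes f :: "real ^ 'd::finite \<Rightarrow> real"
  assumes f: "f \<in> borel_measurable borel" "\<And>x. \<bar>f x\<bar> \<le> 1" "\<And>x. x \<notin> cball 0 r \<Longrightarrow> f x = 0" and r: "0 \<le> r"
  shows "integrable lborel (\<lambda>x. \<bar>f x\<bar>)" "(\<integral>x. \<bar>f x\<bar> \<partial>lborel) \<le> (2 * r) ^ CARD('d)"
proof -
  let ?I = "indicat_real (cbox (- (r *\<^sub>R One)) (r *\<^sub>R One) :: (real ^ 'd) set)"
  have sub: "\<bar>f x\<bar> \<le> ?I x" for x
  proof (cases "x \<in> cball 0 r")
    case True
    then have "x \<in> cbox (- (r *\<^sub>R One)) (r *\<^sub>R One)"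
      unfolding mem_box by (auto simp: abs_le_iff intro: order.trans[OF Basis_le_norm, THEN abs_le_D1] )
        (metis Basis_le_norm abs_le_D2 minus_le_iff order.trans)
    then show ?thesis using f(2)[of x] by simp
  qed (use f(3) in simp)
  have I: "integrable lborel ?I"
    by (intro integrable_real_indicator) (simp, simp, rule emeasure_bounded_finite[OF bounded_cbox, unfolded infinity_ennreal_def])
  show int: "integrable lborel (\<lambda>x. \<bar>f x\<bar>)"
    by (rule Bochner_Integration.integrable_bound[OF I]) (use f(1) sub in auto)
  have "(\<integral>x. \<bar>f x\<bar> \<partial>lborel) \<le> (\<integral>x. ?I x \<partial>lborel)"
    by (intro integral_mono int I sub)
  also have "\<dots> = measure lborel (cbox (- (r *\<^sub>R One)) (r *\<^sub>R One) :: (real ^ 'd) set)" by simp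
  also have "\<dots> = (2 * r) ^ CARD('d)"
  proof -
    have w: "(r *\<^sub>R One - - (r *\<^sub>R One)) \<bullet> b = 2 * r" if "b \<in> Basis" for b :: "real ^ 'd"
      using that by (simp only: inner_diff_left inner_minus_left inner_scaleR_left inner_sum_Basis)
    have "measure lborel (cbox (- (r *\<^sub>R One)) (r *\<^sub>R One) :: (real ^ 'd) set) = (\<Prod>b\<in>(Basis :: (real ^ 'd) set). 2 * r)"
      unfolding measure_lborel_cbox_eq using r
      by (subst if_P) (simp, rule prod.cong[OF refl w])
    then show ?thesis by (simp add: power_mult_distrib)
  qed
  finally show "(\<integral>x. \<bar>f x\<bar> \<partial>lborel) \<le> (2 * r) ^ CARD('d)" .
qed

text \<open>Positive homogeneity of \<open>relu\<close> trades the size of inner parameters for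
  mass: dividing by \<open>\<Lambda> g u\<close> brings weights, bias and values on the ball below
  1, and the factor moves into the signed weight \<open>W\<close>. The total mass \<open>V\<close>
  of \<open>W\<close> is the budget for the output weights. Atoms are drawn from the law
  \<open>\<bar>W\<bar> / V\<close>, their signs move to the output, and the sampled network has
  output weights of modulus at most \<open>V / k\<close>.\<close>

lemma smooth_network_approx:
  fixes f :: "real ^ 'd::finite \<Rightarrow> real" and \<rho> :: "(real ^ 'd) measure"
  assumes t: "0 < t" and r: "1 \<le> r" and f[measurable]: "f \<in> borel_measurable borel"
    and fb: "\<And>x. \<bar>f x\<bar> \<le> 1" and f0: "\<And>x. x \<notin> cball 0 r \<Longrightarrow> f x = 0"
    and \<rho>: "finite_measure \<rho>" "sets \<rho> = sets borel" and k: "1 \<le> k"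
    and a: "ridge_const TYPE('d) * ((r / t) ^ CARD('d) * (r / t + 1)) \<le> a" "0 \<le> a"
  shows "\<exists>p \<in> nn_params k 1 (2 / real k * a) a a.
    (\<integral>\<^sup>+x. ennreal (\<bar>smooth f t x - nn_fun k relu p x\<bar> * indicator (cball 0 r) x) \<partial>\<rho>)
      \<le> ennreal (a * measure \<rho> (space \<rho>) / sqrt k)"
proof -
  interpret R: finite_measure \<rho> by (rule \<rho>)
  interpret G: prob_space "gauss_vec :: ('d \<Rightarrow> real) measure" by (rule prob_space_gauss_vec)
  interpret GU: pair_sigma_finite "gauss_vec :: ('d \<Rightarrow> real) measure" "lborel :: real measure" ..
  let ?GU = "gauss_vec \<Otimes>\<^sub>M lborel :: (('d \<Rightarrow> real) \<times> real) measure"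
  interpret YGU: pair_sigma_finite "lborel :: (real ^ 'd) measure" ?GU
    by (simp add: pair_sigma_finite_def sigma_finite_lborel sigma_finite_pair_measure GU.sigma_finite_measure_axioms)
  let ?S = "lborel \<Otimes>\<^sub>M ?GU :: ((real ^ 'd) \<times> ('d \<Rightarrow> real) \<times> real) measure"
  let ?B = "cball (0 :: real ^ 'd) r"
  have [measurable]: "?B \<in> sets borel" by (intro borel_closed closed_cball)
  define Z where "Z = kernel_mass TYPE('d)"
  have Z: "0 < Z" unfolding Z_def by (rule kernel_mass_pos)
  define q where "q = ridge_density TYPE('d)"
  have [measurable]: "q \<in> borel_measurable borel" unfolding q_def by measurable
  \<comment> \<open>Dominates the norm \<open>gnorm1 g / t\<close> of the weights (by
    \<open>1 \<le> r\<close>), the bias, and the whole argument of the rectifier for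
    \<open>x\<close> and \<open>y\<close> in the ball, whence the factor 2; the summand 1 keeps it
    positive.\<close>
  define \<Lambda> where "\<Lambda> g u = 2 * gnorm1 g * r / t + \<bar>u\<bar> + 1" for g :: "'d \<Rightarrow> real" and u
  have \<Lambda>: "0 < \<Lambda> g u" for g u
    unfolding \<Lambda>_def using gnorm1_nonneg[of g] r t by (intro add_nonneg_pos add_nonneg_nonneg) auto
  have N0: "0 \<le> gnorm1 g * r / t" for g :: "'d \<Rightarrow> real"
    using gnorm1_nonneg[of g] r t by simp
  have \<Lambda>2: "\<Lambda> g u = 2 * (gnorm1 g * r / t) + \<bar>u\<bar> + 1" for g u
    by (simp add: \<Lambda>_def)
  have aux: "2 * (G * X) + U + 1 \<le> 2 * (X + 1) * ((G + 1) * (U + 1))" if "0 \<le> G" "0 \<le> X" "0 \<le> U" for G X U :: real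
  proof -
    have "2 * (X + 1) * ((G + 1) * (U + 1)) - (2 * (G * X) + U + 1)
      = 2 * (X * (G * U)) + 2 * (X * U) + 2 * X + 2 * (G * U) + 2 * G + U + 1"
      by (simp add: algebra_simps)
    also have "0 \<le> \<dots>" using that by simp
    finally show ?thesis by simp
  qed
  have \<Lambda>le: "\<Lambda> g u \<le> 2 * (r / t + 1) * ((gnorm1 g + 1) * (\<bar>u\<bar> + 1))" for g u
  proof -
    have n: "0 \<le> gnorm1 g" "0 \<le> r / t" "0 \<le> \<bar>u\<bar>" using gnorm1_nonneg[of g] r t by auto
    have "\<Lambda> g u = 2 * (gnorm1 g * (r / t)) + \<bar>u\<bar> + 1" by (simp add: \<Lambda>_def)
    also have "\<dots> \<le> 2 * (r / t + 1) * ((gnorm1 g + 1) * (\<bar>u\<bar> + 1))"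
      by (rule aux[OF n])
    finally show ?thesis .
  qed
  define W where "W = (\<lambda>(y :: real ^ 'd, g, u). f y / (t ^ CARD('d) * Z) * (q u * \<Lambda> g u))"
  \<comment> \<open>The indicator switches off units with \<open>y\<close> outside the ball. There
    \<open>W\<close> vanishes, so no integral changes, and the bounds on weights and atoms hold for
    every \<open>z\<close>, as \<open>maurey\<close> requires.\<close>
  define wt where "wt = (\<lambda>(y :: real ^ 'd, g :: 'd \<Rightarrow> real, u :: real). \<chi> i. indicator ?B y * g i / (t * \<Lambda> g u))"
  define bs where "bs = (\<lambda>(y :: real ^ 'd, g :: 'd \<Rightarrow> real, u :: real). indicator ?B y * ((- (\<Sum>i\<in>UNIV. g i * y $ i) / t - u) / \<Lambda> g u))"
  have [measurable]: "(\<lambda>(g, u). \<Lambda> g u) \<in> borel_measurable ?GU"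
    unfolding \<Lambda>_def by measurable
  have Wm[measurable]: "W \<in> borel_measurable ?S"
    unfolding W_def by measurable
  have wtx: "wt (y, g, u) \<bullet> x = indicator ?B y * (\<Sum>i\<in>UNIV. g i * x $ i) / (t * \<Lambda> g u)" for y g u x
    by (simp add: wt_def inner_vec_def sum_divide_distrib sum_distrib_left mult.assoc)
  have gx: "\<bar>\<Sum>i\<in>UNIV. g i * x $ i\<bar> \<le> gnorm1 g * norm x" for g :: "'d \<Rightarrow> real" and x :: "real ^ 'd"
  proof -
    have "\<bar>\<Sum>i\<in>UNIV. g i * x $ i\<bar> \<le> (\<Sum>i\<in>UNIV. \<bar>g i\<bar> * norm x)"
      by (intro order.trans[OF sum_abs sum_mono]) (auto simp: abs_mult intro!: mult_left_mono component_le_norm_cart)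
    then show ?thesis by (simp add: gnorm1_def sum_distrib_right)
  qed
  have gxB: "\<bar>\<Sum>i\<in>UNIV. g i * x $ i\<bar> / t \<le> gnorm1 g * r / t" if "x \<in> ?B" for g :: "'d \<Rightarrow> real" and x :: "real ^ 'd"
    using gx[of g x] mult_left_mono[of "norm x" r "gnorm1 g"] gnorm1_nonneg[of g] that t
    by (intro divide_right_mono) auto
  have wt1: "vec_norm1 (wt z) \<le> 1" for z
  proof -
    obtain y g u where z: "z = (y, g, u)" by (cases z) auto
    have "vec_norm1 (wt z) = indicator ?B y * (gnorm1 g / (t * \<Lambda> g u))"
      unfolding vec_norm1_def wt_def z gnorm1_def using t \<Lambda>[of g u]
      by (simp add: abs_mult sum_divide_distrib sum_distrib_left)
    also have "\<dots> \<le> gnorm1 g / (t * \<Lambda> g u)"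
      using gnorm1_nonneg[of g] t \<Lambda>[of g u] by (auto simp: indicator_def)
    also have "\<dots> \<le> 1"
    proof -
      have "gnorm1 g / t \<le> gnorm1 g * r / t"
        using r t gnorm1_nonneg[of g] by (intro divide_right_mono) (simp_all add: mult_le_cancel_left1)
      then have "gnorm1 g / t \<le> \<Lambda> g u"
        unfolding \<Lambda>2 using N0[of g] by linarith
      then have "gnorm1 g \<le> t * \<Lambda> g u" using t by (simp add: pos_divide_le_eq mult.commute)
      then show ?thesis using t \<Lambda>[of g u] by (simp add: divide_le_eq_1)
    qed
    finally show ?thesis .
  qed
  have bs1: "\<bar>bs z\<bar> \<le> 1" for z
  proof -
    obtain y g u where z: "z = (y, g, u)" by (cases z) auto
    show ?thesis
    proof (cases "y \<in> ?B")
      case True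
      have "\<bar>- (\<Sum>i\<in>UNIV. g i * y $ i) / t - u\<bar> \<le> \<bar>\<Sum>i\<in>UNIV. g i * y $ i\<bar> / t + \<bar>u\<bar>"
        using t abs_triangle_ineq4[of "- (\<Sum>i\<in>UNIV. g i * y $ i) / t" u] by simp
      also have "\<dots> \<le> \<Lambda> g u"
        unfolding \<Lambda>2 using gxB[OF True, of g] N0[of g] by linarith
      finally show ?thesis
        using True \<Lambda>[of g u] by (simp add: z bs_def divide_le_eq)
    qed (simp add: z bs_def)
  qed
  define atom where "atom z x = relu (wt z \<bullet> x + bs z) * indicat_real ?B x" for z x
  have atb: "\<bar>atom z x\<bar> \<le> 1" for z x
  proof -
    obtain y g u where z: "z = (y, g, u)" by (cases z) auto
    show ?thesis
    proof (cases "x \<in> ?B \<and> y \<in> ?B")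
      case True
      then have e: "wt z \<bullet> x + bs z = ((\<Sum>i\<in>UNIV. g i * x $ i) / t - (\<Sum>i\<in>UNIV. g i * y $ i) / t - u) / \<Lambda> g u"
        using t \<Lambda>[of g u] by (simp add: z wtx bs_def diff_divide_distrib)
      have "(\<Sum>i\<in>UNIV. g i * x $ i) / t - (\<Sum>i\<in>UNIV. g i * y $ i) / t - u \<le> \<Lambda> g u"
      proof -
        have le: "X / t \<le> \<bar>X\<bar> / t" "- X / t \<le> \<bar>X\<bar> / t" for X
          using t by (auto intro!: divide_right_mono simp del: divide_minus_left)
        have "(\<Sum>i\<in>UNIV. g i * x $ i) / t \<le> gnorm1 g * r / t" "- (\<Sum>i\<in>UNIV. g i * y $ i) / t \<le> gnorm1 g * r / t"
          using order.trans[OF le(1)[of "\<Sum>i\<in>UNIV. g i * x $ i"] gxB[of x g]]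
            order.trans[OF le(2)[of "\<Sum>i\<in>UNIV. g i * y $ i"] gxB[of y g]] True by blast+
        then show ?thesis unfolding \<Lambda>2 by linarith
      qed
      then have "wt z \<bullet> x + bs z \<le> 1" unfolding e using \<Lambda>[of g u] by (simp add: divide_le_eq)
      then show ?thesis by (auto simp: atom_def relu_def indicator_def)
    next
      case False
      then show ?thesis by (auto simp: atom_def relu_def z wtx bs_def indicator_def)
    qed
  qed
  have atm[measurable]: "(\<lambda>(z, x). atom z x) \<in> borel_measurable (?S \<Otimes>\<^sub>M borel)"
  proof -
    have ip: "(\<lambda>p. \<Sum>i\<in>UNIV. F p i * H p $ i) \<in> borel_measurable (?S \<Otimes>\<^sub>M borel)"
      if F: "F \<in> measurable (?S \<Otimes>\<^sub>M borel) gauss_vec" and H: "H \<in> borel_measurable (?S \<Otimes>\<^sub>M borel)"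
      for F :: "_ \<Rightarrow> 'd \<Rightarrow> real" and H :: "_ \<Rightarrow> real ^ 'd"
    proof -
      have "(\<lambda>p. F p i) \<in> borel_measurable (?S \<Otimes>\<^sub>M borel)" for i
        by (rule measurable_compose[OF F measurable_gauss_vec_component])
      moreover have "(\<lambda>p. H p $ i) \<in> borel_measurable (?S \<Otimes>\<^sub>M borel)" for i
        by (rule measurable_compose[OF H]) (intro borel_measurable_continuous_onI continuous_intros)
      ultimately show ?thesis by (intro borel_measurable_sum borel_measurable_times)
    qed
    define G where "G p = fst (snd (fst p))" for p :: "((real ^ 'd) \<times> ('d \<Rightarrow> real) \<times> real) \<times> (real ^ 'd)"
    have Gm: "G \<in> measurable (?S \<Otimes>\<^sub>M borel) gauss_vec"
      unfolding G_def by measurable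
    have [measurable]: "(\<lambda>p. gnorm1 (G p)) \<in> borel_measurable (?S \<Otimes>\<^sub>M borel)"
      by (rule measurable_compose[OF Gm borel_measurable_gnorm1])
    have [measurable]: "(\<lambda>p. \<Sum>i\<in>UNIV. G p i * snd p $ i) \<in> borel_measurable (?S \<Otimes>\<^sub>M borel)"
      "(\<lambda>p. \<Sum>i\<in>UNIV. G p i * fst (fst p) $ i) \<in> borel_measurable (?S \<Otimes>\<^sub>M borel)"
      by (rule ip[OF Gm]; measurable)+
    have eq: "(\<lambda>(z, x). atom z x) = (\<lambda>p. max (indicator ?B (fst (fst p)) * (\<Sum>i\<in>UNIV. G p i * snd p $ i) / (t * (2 * gnorm1 (G p) * r / t + \<bar>snd (snd (fst p))\<bar> + 1)) +
        indicator ?B (fst (fst p)) * ((- (\<Sum>i\<in>UNIV. G p i * fst (fst p) $ i) / t - snd (snd (fst p))) / (2 * gnorm1 (G p) * r / t + \<bar>snd (snd (fst p))\<bar> + 1))) 0 * indicat_real ?B (snd p))"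
      by (auto simp: fun_eq_iff atom_def wtx bs_def G_def \<Lambda>_def relu_def)
    show ?thesis unfolding eq by measurable
  qed
  have atx: "(\<lambda>z. atom z x) \<in> borel_measurable ?S" for x
    using measurable_Pair1[OF atm, of x] by simp
  have Wle: "\<bar>W (y, g, u)\<bar> \<le> (2 * (r / t + 1) / (t ^ CARD('d) * Z)) * (\<bar>f y\<bar> * ((gnorm1 g + 1) * (\<bar>q u\<bar> * (\<bar>u\<bar> + 1))))" for y g u
  proof -
    have "\<bar>W (y, g, u)\<bar> = \<bar>f y\<bar> * \<bar>q u\<bar> / (t ^ CARD('d) * Z) * \<Lambda> g u"
      using t Z \<Lambda>[of g u] by (simp add: W_def abs_mult)
    also have "\<dots> \<le> \<bar>f y\<bar> * \<bar>q u\<bar> / (t ^ CARD('d) * Z) * (2 * (r / t + 1) * ((gnorm1 g + 1) * (\<bar>u\<bar> + 1)))"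
      using t Z by (intro mult_left_mono \<Lambda>le) auto
    finally show ?thesis by (simp add: mult_ac)
  qed
  note fint = lborel_ball_integral_le[OF f fb f0]
  have fi: "integrable lborel (\<lambda>y. \<bar>f y\<bar>)" "(\<integral>y. \<bar>f y\<bar> \<partial>lborel) \<le> (2 * r) ^ CARD('d)"
    using fint r by auto
  have prodint: "integrable ?S (\<lambda>(y, p). \<bar>f y\<bar> * (case p of (g, u) \<Rightarrow> (gnorm1 g + 1) * (\<bar>q u\<bar> * (\<bar>u\<bar> + 1))))"
    "(\<integral>(y, p). \<bar>f y\<bar> * (case p of (g, u) \<Rightarrow> (gnorm1 g + 1) * (\<bar>q u\<bar> * (\<bar>u\<bar> + 1))) \<partial>?S)
      = (\<integral>y. \<bar>f y\<bar> \<partial>lborel) * ((\<integral>g. gnorm1 g + 1 \<partial>(gauss_vec :: ('d \<Rightarrow> real) measure)) * (\<integral>u. \<bar>q u\<bar> * (\<bar>u\<bar> + 1) \<partial>lborel))"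
  proof -
    note 1 = integrable_pair_product[OF G.sigma_finite_measure_axioms sigma_finite_lborel integrable_gnorm1 integrable_ridge_density[of "TYPE('d)"], folded q_def]
    note 2 = integrable_pair_product[OF sigma_finite_lborel GU.sigma_finite_measure_axioms fi(1) 1(1)]
    show "integrable ?S (\<lambda>(y, p). \<bar>f y\<bar> * (case p of (g, u) \<Rightarrow> (gnorm1 g + 1) * (\<bar>q u\<bar> * (\<bar>u\<bar> + 1))))"
      by (rule 2(1))
    show "(\<integral>(y, p). \<bar>f y\<bar> * (case p of (g, u) \<Rightarrow> (gnorm1 g + 1) * (\<bar>q u\<bar> * (\<bar>u\<bar> + 1))) \<partial>?S)
      = (\<integral>y. \<bar>f y\<bar> \<partial>lborel) * ((\<integral>g. gnorm1 g + 1 \<partial>(gauss_vec :: ('d \<Rightarrow> real) measure)) * (\<integral>u. \<bar>q u\<bar> * (\<bar>u\<bar> + 1) \<partial>lborel))"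
      using 2(2) 1(2) by simp
  qed
  let ?c = "2 * (r / t + 1) / (t ^ CARD('d) * Z)"
  have Wle': "\<bar>W z\<bar> \<le> ?c * (case z of (y, p) \<Rightarrow> \<bar>f y\<bar> * (case p of (g, u) \<Rightarrow> (gnorm1 g + 1) * (\<bar>q u\<bar> * (\<bar>u\<bar> + 1))))" for z
  proof -
    obtain y g u where z: "z = (y, g, u)" by (cases z) auto
    show ?thesis unfolding z prod.case by (rule Wle)
  qed
  have c0: "0 \<le> ?c" using t r Z by (intro divide_nonneg_nonneg mult_nonneg_nonneg) auto
  have Wint: "integrable ?S W"
  proof (rule Bochner_Integration.integrable_bound[OF integrable_mult_right[OF prodint(1), of ?c]])
    show "AE z in ?S. norm (W z) \<le> norm (?c * (case z of (y, p) \<Rightarrow> \<bar>f y\<bar> * (case p of (g, u) \<Rightarrow> (gnorm1 g + 1) * (\<bar>q u\<bar> * (\<bar>u\<bar> + 1)))))"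
      unfolding real_norm_def by (intro AE_I2 order.trans[OF Wle' abs_ge_self])
  qed fact
  define V where "V = (\<integral>z. \<bar>W z\<bar> \<partial>?S)"
  have V0: "0 \<le> V" unfolding V_def by (intro Bochner_Integration.integral_nonneg) auto
  have Va: "V \<le> a"
  proof -
    have "V \<le> (\<integral>z. ?c * (case z of (y, p) \<Rightarrow> \<bar>f y\<bar> * (case p of (g, u) \<Rightarrow> (gnorm1 g + 1) * (\<bar>q u\<bar> * (\<bar>u\<bar> + 1)))) \<partial>?S)"
      unfolding V_def by (intro integral_mono integrable_mult_right[OF prodint(1)] integrable_abs Wint Wle')
    also have "\<dots> = ?c * ((\<integral>y. \<bar>f y\<bar> \<partial>lborel) * ((\<integral>g. gnorm1 g + 1 \<partial>(gauss_vec :: ('d \<Rightarrow> real) measure)) * (\<integral>u. \<bar>q u\<bar> * (\<bar>u\<bar> + 1) \<partial>lborel)))"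
      by (simp only: integral_mult_right_zero prodint(2))
    also have "\<dots> \<le> ?c * ((2 * r) ^ CARD('d) * ((\<integral>g. gnorm1 g + 1 \<partial>(gauss_vec :: ('d \<Rightarrow> real) measure)) * (\<integral>u. \<bar>q u\<bar> * (\<bar>u\<bar> + 1) \<partial>lborel)))"
      by (intro mult_left_mono mult_right_mono fi(2) c0 mult_nonneg_nonneg Bochner_Integration.integral_nonneg)
        (auto simp: gnorm1_nonneg add_nonneg_nonneg)
    also have "\<dots> = ridge_const TYPE('d) * ((r / t) ^ CARD('d) * (r / t + 1))"
      by (simp add: ridge_const_def Z_def q_def power_mult_distrib power_divide mult_ac)
    finally show ?thesis using a(1) by simp
  qed
  have rep: "smooth f t x = (\<integral>z. W z * atom z x \<partial>?S)" if x: "x \<in> ?B" for x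
  proof -
    have int: "integrable ?S (\<lambda>z. W z * atom z x)"
      by (rule Bochner_Integration.integrable_bound[OF Wint])
         (use atx[of x] atb[of _ x] in \<open>auto simp: abs_mult intro!: mult_right_le_one_le\<close>)
    have Wat: "W (y, g, u) * atom (y, g, u) x = f y / (t ^ CARD('d) * Z) * (q u * relu ((\<Sum>i\<in>UNIV. g i * ((1 / t) *\<^sub>R (x - y)) $ i) - u))" for y g u
    proof (cases "y \<in> ?B")
      case True
      have e: "wt (y, g, u) \<bullet> x + bs (y, g, u) = ((\<Sum>i\<in>UNIV. g i * ((1 / t) *\<^sub>R (x - y)) $ i) - u) / \<Lambda> g u"
        using t \<Lambda>[of g u] True
        by (simp add: wtx bs_def sum_divide_distrib[symmetric] sum_subtractf right_diff_distrib diff_divide_distrib)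
      have "\<Lambda> g u * relu (v / \<Lambda> g u) = relu v" for v
        using \<Lambda>[of g u] by (auto simp: relu_def max_def divide_le_0_iff)
      then show ?thesis
        using x by (simp add: atom_def e W_def mult_ac)
    qed (simp add: W_def f0)
    have "(\<integral>z. W z * atom z x \<partial>?S) = (\<integral>y. (\<integral>p. W (y, p) * atom (y, p) x \<partial>?GU) \<partial>lborel)"
      using YGU.integral_fst'[OF int] by simp
    also have "\<dots> = (\<integral>y. f y / (t ^ CARD('d) * Z) * radial_kernel ((1 / t) *\<^sub>R (x - y)) \<partial>lborel)"
    proof (intro Bochner_Integration.integral_cong refl)
      fix y
      have "(\<integral>p. W (y, p) * atom (y, p) x \<partial>?GU) = (\<integral>p. f y / (t ^ CARD('d) * Z) * (case p of (g, u) \<Rightarrow> q u * relu ((\<Sum>i\<in>UNIV. g i * ((1 / t) *\<^sub>R (x - y)) $ i) - u)) \<partial>?GU)"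
        by (intro Bochner_Integration.integral_cong refl) (auto simp only: Wat split: prod.split)
      also have "\<dots> = f y / (t ^ CARD('d) * Z) * radial_kernel ((1 / t) *\<^sub>R (x - y))"
        unfolding integral_mult_right_zero q_def radial_kernel_eq_gu(2) ..
      finally show "(\<integral>p. W (y, p) * atom (y, p) x \<partial>?GU) = f y / (t ^ CARD('d) * Z) * radial_kernel ((1 / t) *\<^sub>R (x - y))" .
    qed
    also have "\<dots> = smooth f t x"
      by (simp add: smooth_def Z_def)
    finally show ?thesis by simp
  qed
  show ?thesis
  \<comment> \<open>No law can be normalized when \<open>V = 0\<close>; the smoothed function then
    vanishes on the ball, and the zero network is exact.\<close>
  proof (cases "V = 0")
    case True
    have "AE z in ?S. W z = 0"
      using True Wint unfolding V_def by (subst (asm) integral_nonneg_eq_0_iff_AE) auto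
    then have zero: "smooth f t x = 0" if "x \<in> ?B" for x
      unfolding rep[OF that] by (intro integral_eq_zero_AE) auto
    show ?thesis
    proof (rule bexI[of _ "(\<lambda>_. 0, \<lambda>_. 0, \<lambda>_. 0, 0, 0)"])
      have "(\<integral>\<^sup>+x. ennreal (\<bar>smooth f t x - nn_fun k relu (\<lambda>_. 0, \<lambda>_. 0, \<lambda>_. 0, 0, 0) x\<bar> * indicator ?B x) \<partial>\<rho>) = (\<integral>\<^sup>+x. 0 \<partial>\<rho>)"
        by (intro nn_integral_cong) (auto simp: nn_fun_def zero indicator_def)
      then show "(\<integral>\<^sup>+x. ennreal (\<bar>smooth f t x - nn_fun k relu (\<lambda>_. 0, \<lambda>_. 0, \<lambda>_. 0, 0, 0) x\<bar> * indicator ?B x) \<partial>\<rho>)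
        \<le> ennreal (a * measure \<rho> (space \<rho>) / sqrt k)" by simp
    qed (use a in \<open>auto simp: nn_params_def vec_norm1_def\<close>)
  next
    case False
    then have V: "0 < V" using V0 by simp
    define Q where "Q = density ?S (\<lambda>z. ennreal (\<bar>W z\<bar> / V))"
    have Q: "prob_space Q"
    proof
      have "emeasure Q (space Q) = (\<integral>\<^sup>+z. ennreal (\<bar>W z\<bar> / V) \<partial>?S)"
      proof -
        have "emeasure Q (space Q) = (\<integral>\<^sup>+z. ennreal (\<bar>W z\<bar> / V) * indicator (space ?S) z \<partial>?S)"
          unfolding Q_def space_density by (rule emeasure_density[OF _ sets.top]) measurable
        also have "\<dots> = (\<integral>\<^sup>+z. ennreal (\<bar>W z\<bar> / V) \<partial>?S)"
          by (rule nn_integral_cong) (simp only: indicator_simps mult_1_right)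
        finally show ?thesis .
      qed
      also have "\<dots> = ennreal (\<integral>z. \<bar>W z\<bar> / V \<partial>?S)"
        using V Wint by (intro nn_integral_eq_integral) auto
      also have "(\<integral>z. \<bar>W z\<bar> / V \<partial>?S) = 1"
        using V by (simp add: V_def)
      finally show "emeasure Q (space Q) = 1" by simp
    qed
    define A where "A z x = V * sgn (W z) * atom z x" for z x
    have Qsets[measurable_cong]: "sets Q = sets ?S" by (simp add: Q_def)
    have \<rho>sets[measurable_cong]: "sets \<rho> = sets borel" by (rule \<rho>(2))
    have Am: "(\<lambda>(z, x). A z x) \<in> borel_measurable (Q \<Otimes>\<^sub>M \<rho>)"
    proof -
      have [measurable]: "(\<lambda>(z, x). atom z x) \<in> borel_measurable (Q \<Otimes>\<^sub>M \<rho>)"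
        using atm by (simp cong: measurable_cong_sets sets_pair_measure_cong add: Qsets \<rho>sets)
      have [measurable]: "W \<in> borel_measurable Q" using Wm by (simp cong: measurable_cong_sets add: Qsets)
      have "(\<lambda>p. V * sgn (W (fst p)) * (case p of (z, x) \<Rightarrow> atom z x)) \<in> borel_measurable (Q \<Otimes>\<^sub>M \<rho>)"
        by measurable
      then show ?thesis by (simp add: A_def case_prod_unfold)
    qed
    have Ab: "\<bar>A z x\<bar> \<le> V" for z x
      using atb[of z x] V by (auto simp: A_def abs_mult sgn_real_def intro!: mult_right_le_one_le)
    have hrep: "smooth f t x * indicat_real ?B x = (\<integral>z. A z x \<partial>Q)" for x
    proof -
      have "(\<integral>z. A z x \<partial>Q) = (\<integral>z. (\<bar>W z\<bar> / V) * A z x \<partial>?S)"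
        unfolding Q_def using V atx[of x] by (subst integral_density) (auto simp: A_def)
      also have "\<dots> = (\<integral>z. W z * atom z x \<partial>?S)"
        using V by (intro Bochner_Integration.integral_cong refl) (auto simp: A_def sgn_real_def)
      also have "\<dots> = smooth f t x * indicat_real ?B x"
        using rep[of x] by (cases "x \<in> ?B") (auto simp: atom_def)
      finally show ?thesis by simp
    qed
    obtain z :: "nat \<Rightarrow> (real ^ 'd) \<times> ('d \<Rightarrow> real) \<times> real" where z:
      "(\<integral>\<^sup>+x. ennreal \<bar>smooth f t x * indicat_real ?B x - (\<Sum>i<k. A (z i) x) / k\<bar> \<partial>\<rho>) \<le> ennreal (V * measure \<rho> (space \<rho>) / sqrt k)"
      using maurey[OF Q \<rho>(1) Am Ab V hrep k] by blast
    \<comment> \<open>Neurons are numbered from 1 and sampled atoms from 0, hence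
      \<open>i - 1\<close>; the affine part is zero.\<close>
    define p where "p = (\<lambda>i. V * sgn (W (z (i - 1))) / k, \<lambda>i. wt (z (i - 1)), \<lambda>i. bs (z (i - 1)), 0 :: real ^ 'd, 0 :: real)"
    show ?thesis
    proof (rule bexI[of _ p])
      have "V / k \<le> 2 / k * a" using Va V by (simp add: divide_right_mono)
      moreover have "\<bar>V * sgn w / k\<bar> \<le> V / k" for w using V by (simp add: abs_mult sgn_real_def)
      ultimately have "\<bar>V * sgn w / k\<bar> \<le> 2 / k * a" for w by (rule order.trans[rotated])
      then show "p \<in> nn_params k 1 (2 / real k * a) a a"
        using wt1 bs1 a unfolding p_def nn_params_def by (auto simp: vec_norm1_def)
      have eq: "\<bar>smooth f t x - nn_fun k relu p x\<bar> * indicator ?B x = \<bar>smooth f t x * indicat_real ?B x - (\<Sum>i<k. A (z i) x) / k\<bar>" for x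
      proof (cases "x \<in> ?B")
        case True
        have "nn_fun k relu p x = (\<Sum>i<k. A (z i) x / k)"
          using True unfolding nn_fun_def p_def
          by (simp add: sum.atLeast1_atMost_eq A_def atom_def)
        then show ?thesis using True by (simp add: sum_divide_distrib)
      qed (simp add: A_def atom_def)
      have "(\<integral>\<^sup>+x. ennreal (\<bar>smooth f t x - nn_fun k relu p x\<bar> * indicator ?B x) \<partial>\<rho>) \<le> ennreal (V * measure \<rho> (space \<rho>) / sqrt k)"
        unfolding eq by (rule z)
      also have "\<dots> \<le> ennreal (a * measure \<rho> (space \<rho>) / sqrt k)"
        using Va by (intro ennreal_leI divide_right_mono mult_right_mono) auto
      finally show "(\<integral>\<^sup>+x. ennreal (\<bar>smooth f t x - nn_fun k relu p x\<bar> * indicator ?B x) \<partial>\<rho>) \<le> ennreal (a * measure \<rho> (space \<rho>) / sqrt k)" .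
    qed
  qed
qed

subsection \<open>The bias over the density classes\<close>

text \<open>The Radon-Nikodym derivative has integral 1, hence is finite almost everywhere, so the
  passage to real values in \<open>leb_density\<close> loses nothing.\<close>

lemma borel_prob_density:
  fixes \<mu> :: "(real ^ 'd::finite) measure"
  assumes \<mu>: "borel_prob \<mu>" and ac: "absolutely_continuous lborel \<mu>"
  shows "leb_density \<mu> \<in> borel_measurable borel" "0 \<le> leb_density \<mu> x"
    "\<mu> = density lborel (\<lambda>x. ennreal (leb_density \<mu> x))" "integrable lborel (leb_density \<mu>)"
proof -
  interpret prob_space \<mu> using \<mu> by (simp add: borel_prob_def)
  have sets: "sets \<mu> = sets (lborel :: (real ^ 'd) measure)" using \<mu> by (simp add: borel_prob_def)
  have fin: "AE x in lborel. RN_deriv lborel \<mu> x \<noteq> \<infinity>"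
  proof (rule nn_integral_PInf_AE)
    have "(\<integral>\<^sup>+x. RN_deriv lborel \<mu> x \<partial>lborel) = (\<integral>\<^sup>+x. 1 \<partial>\<mu>)"
      using sigma_finite_measure.RN_deriv_nn_integral[OF sigma_finite_lborel ac sets, of "\<lambda>_. 1"] by simp
    then show "(\<integral>\<^sup>+x. RN_deriv lborel \<mu> x \<partial>lborel) \<noteq> \<infinity>" by (simp add: emeasure_space_1)
  qed simp
  show m: "leb_density \<mu> \<in> borel_measurable borel"
    unfolding leb_density_def[abs_def] using borel_measurable_RN_deriv[of lborel \<mu>] by measurable
  show nn: "0 \<le> leb_density \<mu> x" for x by (simp add: leb_density_def)
  have "\<mu> = density lborel (RN_deriv lborel \<mu>)"
    using sigma_finite_measure.density_RN_deriv[OF sigma_finite_lborel ac sets] by simp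
  also have "\<dots> = density lborel (\<lambda>x. ennreal (leb_density \<mu> x))"
  proof (rule density_cong)
    show "AE x in lborel. RN_deriv lborel \<mu> x = ennreal (leb_density \<mu> x)"
      using fin by eventually_elim (simp add: leb_density_def less_top[symmetric])
  qed (use m in auto)
  finally show d: "\<mu> = density lborel (\<lambda>x. ennreal (leb_density \<mu> x))" .
  have "(\<integral>\<^sup>+x. ennreal (leb_density \<mu> x) \<partial>lborel) = emeasure (density lborel (\<lambda>x. ennreal (leb_density \<mu> x))) UNIV"
    using m by (subst emeasure_density) auto
  also have "\<dots> = emeasure \<mu> (space \<mu>)"
    using d sets_eq_imp_space_eq[OF sets] by simp
  finally show "integrable lborel (leb_density \<mu>)"
    using m nn by (intro integrableI_nonneg) (auto simp: emeasure_space_1)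
qed

text \<open>Markov's inequality for \<open>\<psi> (norm x / c')\<close>. The infimum defining the
  norm need not be attained, so only constants \<open>c'\<close> below some \<open>c > M\<close> are
  at hand. To compensate, the bound is first proved on the sets \<open>A j\<close>, whose inner
  radius exceeds \<open>r\<close> by the factor \<open>c / M\<close>; they increase to the
  complement of the ball. If \<open>\<psi> (r / M) = 0\<close>, the right-hand side is
  infinite.\<close>

lemma L_orlicz_tail:
  fixes p :: "real ^ 'd::finite \<Rightarrow> real"
  assumes \<psi>: "orlicz_function \<psi>" and M: "0 < M" and r: "0 < r"
    and p[measurable]: "p \<in> borel_measurable borel" and p0: "\<And>x. 0 \<le> p x" and pL: "p \<in> L_orlicz \<psi> M"
  shows "emeasure (density lborel (\<lambda>x. ennreal (p x))) (- cball 0 r) \<le> inverse (ennreal (\<psi> (r / M)))"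
proof -
  let ?\<mu> = "density lborel (\<lambda>x. ennreal (p x))"
  define A where "A j = {x :: real ^ 'd. r * (1 + 1 / real (Suc j)) \<le> norm x}" for j
  have Am[measurable]: "A j \<in> sets borel" for j
    unfolding A_def by measurable
  have mono: "mono_on {0..} \<psi>" and \<psi>0: "\<And>x. 0 \<le> x \<Longrightarrow> 0 \<le> \<psi> x"
    using \<psi> by (auto simp: orlicz_function_def)
  have bound: "ennreal (\<psi> (r / M)) * emeasure ?\<mu> (A j) \<le> 1" for j
  proof -
    define c where "c = M * (1 + 1 / real (Suc j))"
    have "M < c" using M by (simp add: c_def)
    then have "ennreal M < ennreal c" using M by (intro ennreal_lessI) auto
    then have "orlicz_norm \<psi> p < ennreal c"
      using pL by (auto simp: L_orlicz_def intro: le_less_trans)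
    then obtain c' where c': "0 < c'" "(\<integral>\<^sup>+x. ennreal (\<psi> (norm x / c') * p x) \<partial>lborel) \<le> 1" "ennreal c' < ennreal c"
      unfolding orlicz_norm_def by (auto simp: INF_less_iff)
    have "c' < c" using c' by (simp add: ennreal_less_iff)
    have "ennreal (\<psi> (r / M)) * emeasure ?\<mu> (A j) = (\<integral>\<^sup>+x. ennreal (\<psi> (r / M)) * (ennreal (p x) * indicator (A j) x) \<partial>lborel)"
      by (subst emeasure_density) (auto simp: nn_integral_cmult)
    also have "\<dots> \<le> (\<integral>\<^sup>+x. ennreal (\<psi> (norm x / c') * p x) \<partial>lborel)"
    proof (intro nn_integral_mono)
      fix x :: "real ^ 'd"
      show "ennreal (\<psi> (r / M)) * (ennreal (p x) * indicator (A j) x) \<le> ennreal (\<psi> (norm x / c') * p x)"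
      proof (cases "x \<in> A j")
        case True
        have "r / M = r * (1 + 1 / real (Suc j)) / c"
        proof -
        have "(1 + 1 / real (Suc j)) \<noteq> 0" by (smt (verit) divide_nonneg_nonneg of_nat_0_le_iff)
        then show ?thesis
          unfolding c_def by (rule nonzero_mult_divide_mult_cancel_right[symmetric])
      qed
        also have "\<dots> \<le> norm x / c'"
          using True c'(1) \<open>c' < c\<close> by (intro frac_le) (auto simp: A_def)
        finally have "\<psi> (r / M) \<le> \<psi> (norm x / c')"
          using M r c'(1) by (intro mono_onD[OF mono]) auto
        then have "\<psi> (r / M) * p x \<le> \<psi> (norm x / c') * p x"
          using p0 by (intro mult_right_mono) auto
        then show ?thesis
          using True p0[of x] \<psi>0[of "r / M"] M r by (simp add: ennreal_mult[symmetric] ennreal_leI)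
      qed simp
    qed
    finally show ?thesis using c'(2) by (rule order.trans)
  qed
  have "emeasure ?\<mu> (A j) \<le> inverse (ennreal (\<psi> (r / M)))" for j
  proof (cases "\<psi> (r / M) = 0")
    case False
    then have pos: "0 < \<psi> (r / M)" using \<psi>0[of "r / M"] M r by simp
    have "emeasure ?\<mu> (A j) = inverse (ennreal (\<psi> (r / M))) * (ennreal (\<psi> (r / M)) * emeasure ?\<mu> (A j))"
      using pos by (simp add: mult.assoc[symmetric] inverse_ennreal ennreal_mult[symmetric])
    also have "\<dots> \<le> inverse (ennreal (\<psi> (r / M))) * 1"
      by (intro mult_left_mono bound) simp
    finally show ?thesis by simp
  qed simp
  moreover have "(\<Union>j. A j) = - cball 0 r"
  proof (intro equalityI subsetI)
    fix x :: "real ^ 'd" assume "x \<in> (\<Union>j. A j)"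
    then obtain j where "r * (1 + 1 / real (Suc j)) \<le> norm x" by (auto simp: A_def)
    moreover have "r < r * (1 + 1 / real (Suc j))" using r by (simp add: mult_less_cancel_left1)
    ultimately show "x \<in> - cball 0 r" by simp
  next
    fix x :: "real ^ 'd" assume "x \<in> - cball 0 r"
    then have "0 < norm x / r - 1" using r by simp
    then obtain j where "inverse (real (Suc j)) < norm x / r - 1" using reals_Archimedean by blast
    then have "1 + 1 / real (Suc j) \<le> norm x / r" by (simp add: inverse_eq_divide)
    then have "r * (1 + 1 / real (Suc j)) \<le> norm x"
      using r by (simp only: pos_le_divide_eq mult.commute)
    then show "x \<in> (\<Union>j. A j)" by (auto simp: A_def)
  qed
  moreover have "(SUP j. emeasure ?\<mu> (A j)) = emeasure ?\<mu> (\<Union>j. A j)"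
  proof (rule SUP_emeasure_incseq)
    show "incseq A"
    proof (rule incseq_SucI)
      fix j
      have "r * (1 + 1 / real (Suc (Suc j))) \<le> r * (1 + 1 / real (Suc j))"
        using r by (intro mult_left_mono add_left_mono divide_left_mono) auto
      then show "A j \<le> A (Suc j)" by (auto simp: A_def intro: order.trans)
    qed
  qed auto
  ultimately show ?thesis by (metis SUP_least)
qed

text \<open>\<open>f_tv\<close> is a sign of \<open>p - q\<close>, so its integral against
  \<open>p - q\<close> dominates that of every test function bounded by 1, in particular of
  \<open>2 * 1_C - 1\<close> and its negative. Replacing \<open>f_tv\<close> by \<open>g\<close>
  then costs at most the \<open>L^1\<close> distance under the measure with density
  \<open>p + q\<close>.\<close>

lemma tv_bias_le:
  fixes \<mu> \<nu> :: "(real ^ 'd::finite) measure"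
  assumes \<mu>: "borel_prob \<mu>" "absolutely_continuous lborel \<mu>" and \<nu>: "borel_prob \<nu>" "absolutely_continuous lborel \<nu>"
    and g: "g \<in> borel_measurable borel" "\<And>x. \<bar>g x\<bar> \<le> 1"
  shows "ennreal (tv_dist \<mu> \<nu> - (integral\<^sup>L \<mu> g - integral\<^sup>L \<nu> g))
    \<le> (\<integral>\<^sup>+x. ennreal \<bar>f_tv \<mu> \<nu> x - g x\<bar> \<partial>density lborel (\<lambda>x. ennreal (leb_density \<mu> x + leb_density \<nu> x)))"
proof -
  define p where "p = leb_density \<mu>"
  define q where "q = leb_density \<nu>"
  note P = borel_prob_density[OF \<mu>, folded p_def] and Q = borel_prob_density[OF \<nu>, folded q_def]
  note [measurable] = P(1) Q(1) g(1)
  define f where "f = f_tv \<mu> \<nu>"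
  have f: "f x = (if q x \<le> p x then 1 else - 1)" for x
    by (simp add: f_def f_tv_def p_def q_def indicator_def Let_def)
  have fm[measurable]: "f \<in> borel_measurable borel"
    unfolding f[abs_def] by measurable
  have rep: "integral\<^sup>L \<mu> h - integral\<^sup>L \<nu> h = (\<integral>x. (p x - q x) * h x \<partial>lborel)"
    "integrable lborel (\<lambda>x. (p x - q x) * h x)" "integrable lborel (\<lambda>x. (p x + q x) * h x)"
    if h[measurable]: "h \<in> borel_measurable borel" and hb: "\<And>x. \<bar>h x\<bar> \<le> 2" for h
  proof -
    have i: "integrable lborel (\<lambda>x. p x * h x)" "integrable lborel (\<lambda>x. q x * h x)"
    proof -
      have "integrable lborel (\<lambda>x. h x * u x)" if "integrable lborel u" for u
      proof (rule Bochner_Integration.integrable_bound)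
        show "integrable lborel (\<lambda>x. 2 * u x)" using that by simp
        show "AE x in lborel. norm (h x * u x) \<le> norm (2 * u x)"
          using hb by (auto simp: abs_mult intro!: mult_right_mono)
      qed (use that in measurable)
      from this[OF P(4)] this[OF Q(4)] show "integrable lborel (\<lambda>x. p x * h x)" "integrable lborel (\<lambda>x. q x * h x)"
        by (simp_all add: mult.commute)
    qed
    have "integral\<^sup>L \<mu> h = (\<integral>x. p x * h x \<partial>lborel)" "integral\<^sup>L \<nu> h = (\<integral>x. q x * h x \<partial>lborel)"
      by (subst P(3) Q(3), subst integral_density, use P(2) Q(2) in auto)+
    then show "integral\<^sup>L \<mu> h - integral\<^sup>L \<nu> h = (\<integral>x. (p x - q x) * h x \<partial>lborel)"
      using i by (simp add: left_diff_distrib)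
    show "integrable lborel (\<lambda>x. (p x - q x) * h x)" "integrable lborel (\<lambda>x. (p x + q x) * h x)"
      using i by (simp_all add: algebra_simps)
  qed
  have tv: "tv_dist \<mu> \<nu> \<le> (\<integral>x. (p x - q x) * f x \<partial>lborel)"
    unfolding tv_dist_def
  proof (rule cSUP_least)
    fix C :: "(real ^ 'd) set" assume C[measurable]: "C \<in> sets borel"
    have le: "(\<integral>x. (p x - q x) * h x \<partial>lborel) \<le> (\<integral>x. (p x - q x) * f x \<partial>lborel)"
      if "h \<in> borel_measurable borel" "\<And>x. \<bar>h x\<bar> \<le> 1" for h
    proof (intro integral_mono rep)
      show "\<bar>h x\<bar> \<le> 2" "\<bar>f x\<bar> \<le> 2" for x using that(2)[of x] by (auto simp: f)
    next
      fix x
      have "\<bar>(p x - q x) * h x\<bar> \<le> \<bar>p x - q x\<bar> * 1"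
        unfolding abs_mult using that(2)[of x] by (intro mult_left_mono) auto
      then have "(p x - q x) * h x \<le> \<bar>p x - q x\<bar> * 1" by (rule order.trans[OF abs_ge_self])
      then show "(p x - q x) * h x \<le> (p x - q x) * f x" by (auto simp: f split: if_splits)
    qed (use that(1) in auto)
    have prob: "integral\<^sup>L Mi (\<lambda>x. e * (2 * indicat_real C x - 1)) = e * (2 * measure Mi C - 1)" if Mi: "borel_prob Mi" for Mi and e :: real
    proof -
      interpret Mi: prob_space Mi using Mi by (simp add: borel_prob_def)
      have s: "sets Mi = sets borel" using Mi by (simp add: borel_prob_def)
      have "integrable Mi (indicat_real C)"
        by (rule borel_prob_integrable[OF Mi, of _ 1]) auto
      then show ?thesis
        using C s sets_eq_imp_space_eq[OF s] Mi.prob_space by simp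
    qed
    have "e * (2 * (measure \<mu> C - measure \<nu> C)) \<le> (\<integral>x. (p x - q x) * f x \<partial>lborel)" if "\<bar>e\<bar> = 1" for e :: real
    proof -
      have "e * (2 * (measure \<mu> C - measure \<nu> C)) = integral\<^sup>L \<mu> (\<lambda>x. e * (2 * indicat_real C x - 1)) - integral\<^sup>L \<nu> (\<lambda>x. e * (2 * indicat_real C x - 1))"
        unfolding prob[OF \<mu>(1)] prob[OF \<nu>(1)] by (simp add: algebra_simps)
      also have "\<dots> = (\<integral>x. (p x - q x) * (e * (2 * indicat_real C x - 1)) \<partial>lborel)"
        by (rule rep(1)) (use that in \<open>auto simp: abs_mult indicator_def\<close>)
      also have "\<dots> \<le> (\<integral>x. (p x - q x) * f x \<partial>lborel)"
        by (rule le) (use that in \<open>auto simp: abs_mult indicator_def\<close>)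
      finally show ?thesis .
    qed
    from this[of 1] this[of "- 1"] show "2 * \<bar>measure \<mu> C - measure \<nu> C\<bar> \<le> (\<integral>x. (p x - q x) * f x \<partial>lborel)"
      by (simp add: abs_if)
  qed auto
  have fgb: "\<bar>\<bar>f x - g x\<bar>\<bar> \<le> 2" "\<bar>f x\<bar> \<le> 2" "\<bar>g x\<bar> \<le> 2" for x
    using g(2)[of x] by (auto simp: f)
  have "tv_dist \<mu> \<nu> - (integral\<^sup>L \<mu> g - integral\<^sup>L \<nu> g) \<le> (\<integral>x. (p x - q x) * f x \<partial>lborel) - (\<integral>x. (p x - q x) * g x \<partial>lborel)"
    using tv fgb by (simp add: rep(1))
  also have "\<dots> = (\<integral>x. (p x - q x) * f x - (p x - q x) * g x \<partial>lborel)"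
    using fgb by (intro Bochner_Integration.integral_diff[symmetric] rep) auto
  also have "\<dots> \<le> (\<integral>x. (p x + q x) * \<bar>f x - g x\<bar> \<partial>lborel)"
  proof (intro integral_mono Bochner_Integration.integrable_diff rep)
    fix x
    have "(p x - q x) * (f x - g x) \<le> \<bar>p x - q x\<bar> * \<bar>f x - g x\<bar>"
      by (metis abs_ge_self abs_mult)
    also have "\<dots> \<le> (p x + q x) * \<bar>f x - g x\<bar>"
      using P(2)[of x] Q(2)[of x] by (intro mult_right_mono) auto
    finally show "(p x - q x) * f x - (p x - q x) * g x \<le> (p x + q x) * \<bar>f x - g x\<bar>"
      by (simp add: algebra_simps)
  qed (use fgb in auto)
  finally have "ennreal (tv_dist \<mu> \<nu> - (integral\<^sup>L \<mu> g - integral\<^sup>L \<nu> g)) \<le> ennreal (\<integral>x. (p x + q x) * \<bar>f x - g x\<bar> \<partial>lborel)"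
    by (rule ennreal_leI)
  also have "\<dots> = (\<integral>\<^sup>+x. ennreal ((p x + q x) * \<bar>f x - g x\<bar>) \<partial>lborel)"
    using P(2) Q(2) fgb by (intro nn_integral_eq_integral[symmetric] rep) auto
  also have "\<dots> = (\<integral>\<^sup>+x. ennreal \<bar>f x - g x\<bar> \<partial>density lborel (\<lambda>x. ennreal (p x + q x)))"
    using P(2) Q(2) by (subst nn_integral_density) (auto simp: ennreal_mult)
  finally show ?thesis unfolding p_def q_def f_def .
qed

text \<open>The supremum in \<open>lip_norm\<close> is evaluated at \<open>t = norm u\<close> and
  the power of \<open>t\<close> is multiplied back.\<close>

lemma Lip_class_modulus:
  fixes f :: "real ^ 'd::finite \<Rightarrow> real"
  assumes f: "f \<in> Lip_class s b S" and b: "0 \<le> b" and u: "u \<noteq> 0"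
  shows "(\<integral>\<^sup>+x. ennreal \<bar>f (x + u) - f x\<bar> \<partial>lborel) \<le> ennreal (b * norm u powr s)"
proof -
  let ?I = "(\<integral>\<^sup>+x. ennreal \<bar>f (x + u) - f x\<bar> \<partial>lborel)"
  have t: "0 < norm u" using u by simp
  have "?I \<le> l1_modulus f (norm u)"
    unfolding l1_modulus_def l1_norm_def by (rule SUP_upper2[of u]) auto
  then have "ennreal (norm u powr (- s)) * ?I \<le> ennreal (norm u powr (- s)) * l1_modulus f (norm u)"
    by (intro mult_left_mono) auto
  also have "\<dots> \<le> (SUP t\<in>{0<..}. ennreal (t powr (- s)) * l1_modulus f t)"
    using t by (intro SUP_upper) auto
  also have "\<dots> \<le> lip_norm s f"
    by (simp add: lip_norm_def)
  also have "\<dots> \<le> ennreal b" using f by (simp add: Lip_class_def)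
  finally have le: "ennreal (norm u powr (- s)) * ?I \<le> ennreal b" .
  have "?I = ennreal (norm u powr s) * (ennreal (norm u powr (- s)) * ?I)"
    using t by (simp add: mult.assoc[symmetric] ennreal_mult[symmetric] powr_add[symmetric])
  also have "\<dots> \<le> ennreal (norm u powr s) * ennreal b"
    by (intro mult_left_mono le) auto
  also have "\<dots> = ennreal (b * norm u powr s)"
    using b by (simp add: ennreal_mult mult.commute)
  finally show ?thesis .
qed

definition kernel_moment :: "'d::finite itself \<Rightarrow> real" where
  "kernel_moment T = (\<integral>z. (1 + norm z) * radial_kernel (z :: real ^ 'd) \<partial>lborel) / kernel_mass TYPE('d)"

lemma kernel_moment_nonneg: "0 \<le> kernel_moment TYPE('d::finite)"
  unfolding kernel_moment_def using kernel_mass_pos[where 'd = 'd]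
  by (intro divide_nonneg_pos Bochner_Integration.integral_nonneg mult_nonneg_nonneg)
    (auto simp: less_imp_le radial_kernel_pos)

lemma borel_measurable_smooth[measurable]:
  fixes f :: "real ^ 'd::finite \<Rightarrow> real"
  assumes [measurable]: "f \<in> borel_measurable borel"
  shows "smooth f t \<in> borel_measurable borel"
proof -
  have "(\<lambda>x. \<integral>y. f y * radial_kernel ((1 / t) *\<^sub>R (x - y)) \<partial>lborel) \<in> borel_measurable borel"
    by (rule lborel.borel_measurable_lebesgue_integral) measurable
  then show ?thesis unfolding smooth_def[abs_def] by measurable
qed

text \<open>Outside the ball the error is at most 1 and is charged to the Orlicz tails. Inside, the
  smoothing error is measured in Lebesgue \<open>L^1\<close> and transferred by
  \<open>p + q \<le> 2 * M\<close>, while the network error is measured directly under the sum of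
  the two measures, of mass 2, so that sampling produces no volume factor of the ball. Clipping does
  no harm because \<open>f_tv\<close> has modulus 1.\<close>

lemma P_tv_bias:
  fixes \<mu> \<nu> :: "(real ^ 'd::finite) measure"
  assumes P: "(\<mu>, \<nu>) \<in> P_tv \<psi> M s r m" and \<psi>: "orlicz_function \<psi>" and M: "0 < M" and s: "0 < s" "s \<le> 1"
    and k: "1 \<le> k" and r: "1 \<le> r k" and m: "0 \<le> m k" and t: "0 < t"
    and a: "ridge_const TYPE('d) * ((r k / t) ^ CARD('d) * (r k / t + 1)) \<le> a" "0 \<le> a"
  shows "\<exists>g \<in> ball_class k 1 (2 / real k * a) a a relu (r k).
    ennreal (tv_dist \<mu> \<nu> - (integral\<^sup>L \<mu> g - integral\<^sup>L \<nu> g))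
      \<le> 2 * inverse (ennreal (\<psi> (r k / M))) + ennreal (2 * M * (m k * t powr s * kernel_moment TYPE('d)) + 2 * a / sqrt k)"
proof -
  let ?B = "cball (0 :: real ^ 'd) (r k)"
  have B[measurable]: "?B \<in> sets borel" by (intro borel_closed closed_cball)
  have \<mu>: "borel_prob \<mu>" "absolutely_continuous lborel \<mu>" and \<nu>: "borel_prob \<nu>" "absolutely_continuous lborel \<nu>"
    and linf: "linf_norm (\<lambda>x. max (leb_density \<mu> x) (leb_density \<nu> x)) \<le> ereal M"
    and L: "leb_density \<mu> \<in> L_orlicz \<psi> M" "leb_density \<nu> \<in> L_orlicz \<psi> M"
    and lip: "(\<lambda>x. f_tv \<mu> \<nu> x * indicat_real ?B x) \<in> Lip_class s (m k) ?B"
    using P k by (auto simp: P_tv_def)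
  interpret Mu: prob_space \<mu> using \<mu> by (simp add: borel_prob_def)
  interpret Nu: prob_space \<nu> using \<nu> by (simp add: borel_prob_def)
  define p where "p = leb_density \<mu>"
  define q where "q = leb_density \<nu>"
  note P = borel_prob_density[OF \<mu>, folded p_def] and Q = borel_prob_density[OF \<nu>, folded q_def]
  note [measurable] = P(1) Q(1)
  define f where "f x = f_tv \<mu> \<nu> x * indicat_real ?B x" for x
  have fm[measurable]: "f \<in> borel_measurable borel"
    using lip by (auto simp: Lip_class_def f_def[abs_def] dest: borel_measurable_integrable)
  have fb: "\<bar>f x\<bar> \<le> 1" for x
    by (simp add: f_def f_tv_def Let_def indicator_def)
  have f0: "f x = 0" if "x \<notin> ?B" for x using that by (simp add: f_def)
  define \<rho> where "\<rho> = density lborel (\<lambda>x. ennreal (p x + q x))"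
  have \<rho>s[measurable_cong]: "sets \<rho> = sets borel" by (simp add: \<rho>_def)
  have \<rho>A: "emeasure \<rho> A = emeasure \<mu> A + emeasure \<nu> A" if [measurable]: "A \<in> sets borel" for A
  proof -
    have "emeasure \<rho> A = (\<integral>\<^sup>+x. ennreal (p x) * indicator A x + ennreal (q x) * indicator A x \<partial>lborel)"
      unfolding \<rho>_def using P(2) Q(2)
      by (subst emeasure_density) (auto intro!: nn_integral_cong simp: ennreal_plus distrib_right)
    also have "\<dots> = (\<integral>\<^sup>+x. ennreal (p x) * indicator A x \<partial>lborel) + (\<integral>\<^sup>+x. ennreal (q x) * indicator A x \<partial>lborel)"
      by (rule nn_integral_add) measurable
    also have "\<dots> = emeasure \<mu> A + emeasure \<nu> A"
      by (subst P(3), subst Q(3)) (simp add: emeasure_density)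
    finally show ?thesis .
  qed
  have "emeasure \<mu> UNIV = 1" "emeasure \<nu> UNIV = 1"
    using Mu.emeasure_space_1 Nu.emeasure_space_1 \<mu> \<nu> sets_eq_imp_space_eq[of \<mu> borel] sets_eq_imp_space_eq[of \<nu> borel]
    by (auto simp: borel_prob_def)
  then have \<rho>1: "emeasure \<rho> (space \<rho>) = 2"
    using \<rho>A[of UNIV] by (simp add: \<rho>_def)
  have \<rho>fin: "finite_measure \<rho>" by (rule finite_measureI) (simp add: \<rho>1)
  have \<rho>m: "measure \<rho> (space \<rho>) = 2" by (simp add: measure_def \<rho>1)
  obtain w where w: "w \<in> nn_params k 1 (2 / real k * a) a a"
    "(\<integral>\<^sup>+x. ennreal (\<bar>smooth f t x - nn_fun k relu w x\<bar> * indicator ?B x) \<partial>\<rho>) \<le> ennreal (a * 2 / sqrt k)"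
    using smooth_network_approx[OF t r fm fb f0 \<rho>fin \<rho>s k a] unfolding \<rho>m by blast
  define g where "g = ball_fun (r k) (nn_fun k relu w)"
  have g: "g \<in> ball_class k 1 (2 / real k * a) a a relu (r k)"
    using w(1) by (auto simp: g_def ball_class_def)
  have gm: "g \<in> borel_measurable borel" by (rule ball_class_measurable[OF admissible_relu g])
  have nm[measurable]: "nn_fun k relu w \<in> borel_measurable borel"
    by (cases w) (auto simp: nn_fun_def relu_def)
  have L1: "(\<integral>\<^sup>+x. ennreal \<bar>smooth f t x - f x\<bar> \<partial>lborel) \<le> ennreal (m k * t powr s * kernel_moment TYPE('d))"
    unfolding kernel_moment_def
    by (rule smooth_L1_le[OF t fm fb s m]) (rule Lip_class_modulus[OF lip[folded f_def] m])
  have pq: "AE x in lborel. p x + q x \<le> 2 * M"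
  proof -
    have "AE x in lborel. ereal \<bar>max (p x) (q x)\<bar> \<le> linf_norm (\<lambda>x. max (p x) (q x))"
      unfolding linf_norm_def by (rule esssup_AE)
    then show ?thesis
    proof eventually_elim
      case (elim x)
      then have "ereal \<bar>max (p x) (q x)\<bar> \<le> ereal M"
        unfolding p_def q_def using linf by (rule order.trans)
      then show ?case by (auto simp: max_def split: if_splits)
    qed
  qed
  have pt: "\<bar>f_tv \<mu> \<nu> x - g x\<bar> \<le> indicat_real (- ?B) x + \<bar>smooth f t x - f x\<bar> + \<bar>smooth f t x - nn_fun k relu w x\<bar> * indicat_real ?B x" for x
  proof (cases "x \<in> ?B")
    case True
    have "\<bar>f_tv \<mu> \<nu> x - g x\<bar> = \<bar>clip (f x) - clip (nn_fun k relu w x)\<bar>"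
      using True fb[of x] by (simp add: clip_id g_def ball_fun_def f_def)
    also have "\<dots> \<le> \<bar>f x - nn_fun k relu w x\<bar>" by (rule clip_lipschitz)
    also have "\<dots> \<le> \<bar>smooth f t x - f x\<bar> + \<bar>smooth f t x - nn_fun k relu w x\<bar>" by linarith
    finally show ?thesis using True by simp
  next
    case False
    then show ?thesis
      by (simp add: g_def ball_fun_def f_tv_def Let_def indicator_def)
  qed
  have "ennreal (tv_dist \<mu> \<nu> - (integral\<^sup>L \<mu> g - integral\<^sup>L \<nu> g)) \<le> (\<integral>\<^sup>+x. ennreal \<bar>f_tv \<mu> \<nu> x - g x\<bar> \<partial>\<rho>)"
    unfolding \<rho>_def p_def q_def
    by (rule tv_bias_le[OF \<mu> \<nu> gm]) (rule ball_class_bounds[OF g])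
  also have "\<dots> \<le> (\<integral>\<^sup>+x. indicator (- ?B) x + ennreal \<bar>smooth f t x - f x\<bar> + ennreal (\<bar>smooth f t x - nn_fun k relu w x\<bar> * indicator ?B x) \<partial>\<rho>)"
  proof (intro nn_integral_mono)
    fix x
    have "ennreal \<bar>f_tv \<mu> \<nu> x - g x\<bar> \<le> ennreal (indicat_real (- ?B) x + \<bar>smooth f t x - f x\<bar> + \<bar>smooth f t x - nn_fun k relu w x\<bar> * indicat_real ?B x)"
      by (intro ennreal_leI pt)
    then show "ennreal \<bar>f_tv \<mu> \<nu> x - g x\<bar> \<le> indicator (- ?B) x + ennreal \<bar>smooth f t x - f x\<bar> + ennreal (\<bar>smooth f t x - nn_fun k relu w x\<bar> * indicator ?B x)"
      by (simp add: ennreal_plus ennreal_indicator)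
  qed
  also have "\<dots> = emeasure \<rho> (- ?B) + (\<integral>\<^sup>+x. ennreal \<bar>smooth f t x - f x\<bar> \<partial>\<rho>) + (\<integral>\<^sup>+x. ennreal (\<bar>smooth f t x - nn_fun k relu w x\<bar> * indicator ?B x) \<partial>\<rho>)"
  proof -
    have [measurable]: "smooth f t \<in> borel_measurable borel" by (rule borel_measurable_smooth[OF fm])
    have 1: "(\<lambda>x. ennreal \<bar>smooth f t x - f x\<bar>) \<in> borel_measurable \<rho>"
      "(\<lambda>x. ennreal (\<bar>smooth f t x - nn_fun k relu w x\<bar> * indicator ?B x)) \<in> borel_measurable \<rho>"
      unfolding measurable_cong_sets[OF \<rho>s refl] by measurable
    have 2: "(indicator (- ?B) :: _ \<Rightarrow> ennreal) \<in> borel_measurable \<rho>"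
      using B by (simp add: \<rho>s)
    have "(- ?B) \<in> sets \<rho>" using B by (simp only: \<rho>s sets.compl_sets borel_comp)
    then show ?thesis
      by (simp only: nn_integral_add[OF borel_measurable_add[OF 2 1(1)] 1(2)] nn_integral_add[OF 2 1(1)] nn_integral_indicator)
  qed
  also have "\<dots> \<le> 2 * inverse (ennreal (\<psi> (r k / M))) + ennreal (2 * M * (m k * t powr s * kernel_moment TYPE('d))) + ennreal (a * 2 / sqrt k)"
  proof (intro add_mono w(2))
    have "emeasure \<rho> (- ?B) = emeasure \<mu> (- ?B) + emeasure \<nu> (- ?B)" by (rule \<rho>A) measurable
    also have "\<dots> \<le> inverse (ennreal (\<psi> (r k / M))) + inverse (ennreal (\<psi> (r k / M)))"
    proof (intro add_mono)
      have rk: "0 < r k" using r by simp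
      show "emeasure \<mu> (- ?B) \<le> inverse (ennreal (\<psi> (r k / M)))"
        using L_orlicz_tail[OF \<psi> M rk P(1) P(2) L(1)[folded p_def]] by (simp only: P(3)[symmetric])
      show "emeasure \<nu> (- ?B) \<le> inverse (ennreal (\<psi> (r k / M)))"
        using L_orlicz_tail[OF \<psi> M rk Q(1) Q(2) L(2)[folded q_def]] by (simp only: Q(3)[symmetric])
    qed
    finally show "emeasure \<rho> (- ?B) \<le> 2 * inverse (ennreal (\<psi> (r k / M)))" by (simp add: mult_2)
    have "(\<integral>\<^sup>+x. ennreal \<bar>smooth f t x - f x\<bar> \<partial>\<rho>) = (\<integral>\<^sup>+x. ennreal (p x + q x) * ennreal \<bar>smooth f t x - f x\<bar> \<partial>lborel)"
      unfolding \<rho>_def by (rule nn_integral_density) measurable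
    also have "\<dots> \<le> (\<integral>\<^sup>+x. ennreal (2 * M) * ennreal \<bar>smooth f t x - f x\<bar> \<partial>lborel)"
      using pq by (intro nn_integral_mono_AE) (auto intro!: mult_right_mono ennreal_leI elim!: eventually_mono)
    also have "\<dots> = ennreal (2 * M) * (\<integral>\<^sup>+x. ennreal \<bar>smooth f t x - f x\<bar> \<partial>lborel)"
      by (rule nn_integral_cmult) measurable
    also have "\<dots> \<le> ennreal (2 * M) * ennreal (m k * t powr s * kernel_moment TYPE('d))"
      by (intro mult_left_mono L1) simp
    also have "\<dots> = ennreal (2 * M * (m k * t powr s * kernel_moment TYPE('d)))"
      using M by (intro ennreal_mult'[symmetric]) simp
    finally show "(\<integral>\<^sup>+x. ennreal \<bar>smooth f t x - f x\<bar> \<partial>\<rho>) \<le> ennreal (2 * M * (m k * t powr s * kernel_moment TYPE('d)))" .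
  qed
  also have "\<dots> = 2 * inverse (ennreal (\<psi> (r k / M))) + ennreal (2 * M * (m k * t powr s * kernel_moment TYPE('d)) + 2 * a / sqrt k)"
    using kernel_moment_nonneg[where 'd = 'd] M m a(2)
    by (simp add: add.assoc ennreal_plus[symmetric] mult.commute del: ennreal_plus)
  finally show ?thesis using g by blast
qed

subsection \<open>The rate\<close>

text \<open>The integral in \<open>c_check\<close> at \<open>t = 1\<close>.\<close>

definition gauss_second_moment :: "'d::finite itself \<Rightarrow> real" where
  "gauss_second_moment T = (\<integral>\<omega>. (norm \<omega>)\<^sup>2 * exp (- ((norm \<omega>)\<^sup>2 / 2)) \<partial>(lborel :: (real ^ 'd) measure))"

lemma gauss_second_moment_pos: "0 < gauss_second_moment TYPE('d::finite)"
proof -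
  let ?F = "\<lambda>\<omega> :: real ^ 'd. (norm \<omega>)\<^sup>2 * exp (- ((norm \<omega>)\<^sup>2 / 2))"
  have "integrable lborel (\<lambda>x::real. sqrt (2 * pi * (sqrt 2)\<^sup>2) * normal_density 0 (sqrt 2) x)"
    by (intro integrable_mult_right integrable_normal_density) simp
  then have g1: "integrable lborel (\<lambda>x::real. exp (- (x\<^sup>2 / 4)))"
    by (simp add: normal_density_def)
  have exp_prod: "exp (- ((norm \<omega>)\<^sup>2 / 4)) = (\<Prod>b\<in>Basis. exp (- ((\<omega> \<bullet> b)\<^sup>2 / 4)))" for \<omega> :: "real ^ 'd"
    by (simp add: exp_sum[symmetric] sum_negf norm_eq_sqrt_inner euclidean_inner[of \<omega> \<omega>] power2_eq_square sum_divide_distrib sum_nonneg)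
  have int4: "integrable lborel (\<lambda>\<omega> :: real ^ 'd. 4 * exp (- ((norm \<omega>)\<^sup>2 / 4)))"
    unfolding exp_prod by (intro integrable_mult_right integrable_prod_Basis g1) simp
  have int: "integrable lborel ?F"
  proof (rule Bochner_Integration.integrable_bound[OF int4])
    have "norm (?F \<omega>) \<le> norm (4 * exp (- ((norm \<omega>)\<^sup>2 / 4)))" for \<omega> :: "real ^ 'd"
    proof -
      have "(norm \<omega>)\<^sup>2 / 4 \<le> exp ((norm \<omega>)\<^sup>2 / 4)"
        using exp_ge_add_one_self[of "(norm \<omega>)\<^sup>2 / 4"] by linarith
      then have "(norm \<omega>)\<^sup>2 * exp (- ((norm \<omega>)\<^sup>2 / 2)) \<le> (4 * exp ((norm \<omega>)\<^sup>2 / 4)) * exp (- ((norm \<omega>)\<^sup>2 / 2))"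
        by (intro mult_right_mono) auto
      also have "\<dots> = 4 * exp (- ((norm \<omega>)\<^sup>2 / 4))"
        by (simp add: mult.assoc exp_add[symmetric])
      finally show ?thesis by (simp add: abs_mult)
    qed
    then show "AE \<omega> in lborel. norm (?F \<omega>) \<le> norm (4 * exp (- ((norm (\<omega> :: real ^ 'd))\<^sup>2 / 4)))"
      by (intro AE_I2)
  qed simp
  show ?thesis
    unfolding gauss_second_moment_def by (rule integral_lborel_pos[OF int]) auto
qed

definition check_const :: "'d::finite itself \<Rightarrow> real" where
  "check_const T = CARD('d) * pi powr (CARD('d) / 2) / Gamma (CARD('d) / 2 + 1) * gauss_second_moment T"

lemma check_const_pos: "0 < check_const TYPE('d::finite)"
  unfolding check_const_def using gauss_second_moment_pos[where 'd = 'd]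
  by (intro mult_pos_pos divide_pos_pos Gamma_real_pos) (auto simp: add_pos_pos)

text \<open>The substitution of \<open>z / t\<close> for \<open>\<omega>\<close> yields
  \<open>d\<close> powers of \<open>1 / t\<close> from the volume and 2 from the squared
  norm.\<close>

lemma c_check_eq:
  assumes t: "0 < t"
  shows "c_check TYPE('d::finite) r t = check_const TYPE('d) * (r ^ (CARD('d) + 1) / t ^ (CARD('d) + 2))"
proof -
  let ?F = "\<lambda>\<omega> :: real ^ 'd. (norm \<omega>)\<^sup>2 * exp (- (t\<^sup>2 * (norm \<omega>)\<^sup>2 / 2))"
  have "(\<integral>\<omega>. ?F \<omega> \<partial>lborel) = (\<integral>\<omega>. ?F \<omega> \<partial>density (distr lborel borel (\<lambda>z. 0 + (1 / t) *\<^sub>R z)) (\<lambda>_. \<bar>1 / t\<bar> ^ DIM(real ^ 'd)))"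
    using t by (subst lborel_affine[of "1 / t" 0]) auto
  also have "\<dots> = (\<integral>z. \<bar>1 / t\<bar> ^ CARD('d) * ?F ((1 / t) *\<^sub>R z) \<partial>lborel)"
    by (subst integral_density) (auto simp: integral_distr)
  also have "\<dots> = (\<integral>z. (1 / t ^ (CARD('d) + 2)) * ((norm z)\<^sup>2 * exp (- ((norm (z :: real ^ 'd))\<^sup>2 / 2))) \<partial>lborel)"
    using t by (intro Bochner_Integration.integral_cong refl) (simp add: power_divide power_mult_distrib power_add power2_eq_square)
  also have "\<dots> = gauss_second_moment TYPE('d) / t ^ (CARD('d) + 2)"
    by (simp add: gauss_second_moment_def)
  finally show ?thesis
    by (simp add: c_check_def check_const_def)
qed

text \<open>The third identity is the equation that \<open>t\<close> is chosen to solve. The first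
  rewrites the common value of its two sides as the claimed bias term, and the second identifies the
  claimed sampling term. Logarithms turn each of them into linear algebra.\<close>

lemma rate_identities:
  fixes m r k s D :: real
  assumes pos: "0 < m" "0 < r" "0 < k" "0 < s" "0 \<le> D"
    and t: "t = (r powr (D + 1) * k powr (- 1 / 2) / m) powr (1 / (s + D + 2))"
  shows "(m powr (D + 2) * r powr (s * (D + 1)) * k powr (- s / 2)) powr (1 / (s + D + 2)) = m * t powr s" (is "?A1 = ?A2")
    and "(m * r powr (s + 1) * k powr (1 / 2)) powr ((D + 2) / (s + D + 2)) = (r / t) powr (D + 2)" (is "?B1 = ?B2")
    and "r powr (D + 1) / t powr (D + 2) / sqrt k = m * t powr s" (is "?C1 = ?C2")
proof -
  have E: "s + D + 2 \<noteq> 0" "0 < s + D + 2" using pos by auto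
  have tpos: "0 < t" unfolding t using pos by simp
  have lt: "ln t = ((D + 1) * ln r - ln k / 2 - ln m) / (s + D + 2)"
    unfolding t using pos by (simp add: ln_powr ln_div ln_mult)
  have "ln ?A1 = ln ?A2"
    using pos tpos E by (simp add: ln_powr ln_mult lt field_simps)
  then show "?A1 = ?A2" using pos tpos by (subst (asm) ln_inj_iff) auto
  have "ln ?B1 = ln ?B2"
    using pos tpos E by (simp add: ln_powr ln_mult ln_div lt field_simps)
  then show "?B1 = ?B2" using pos tpos by (subst (asm) ln_inj_iff) auto
  have "ln ?C1 = ln ?C2"
    using pos tpos E by (simp add: ln_powr ln_mult ln_div ln_sqrt lt field_simps)
  then show "?C1 = ?C2" using pos tpos by (subst (asm) ln_inj_iff) auto
qed

lemma ridge_const_nonneg: "0 \<le> ridge_const TYPE('d::finite)"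
  unfolding ridge_const_def using kernel_mass_pos[where 'd = 'd]
  by (intro mult_nonneg_nonneg divide_nonneg_nonneg Bochner_Integration.integral_nonneg)
    (auto simp: gnorm1_nonneg add_nonneg_nonneg)

text \<open>\<open>P_tv_bias\<close> is applied at the scale \<open>\<Lambda> * t\<close> instead of
  \<open>t\<close>: this divides the bound on the network mass by \<open>\<Lambda>\<close> and
  multiplies the smoothing error by at most \<open>\<Lambda>\<close>, as \<open>s \<le> 1\<close>.
  The value of \<open>\<Lambda>\<close> is what makes the mass fit below \<open>c0\<close> times
  \<open>r^(d+1) / t^(d+2)\<close>.\<close>

lemma expected_error_rate_small:
  fixes M s :: real and \<mu> \<nu> :: "(real ^ 'd::finite) measure" and k :: nat and m r :: "nat \<Rightarrow> real"
  defines "c0 \<equiv> check_const TYPE('d)"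
  defines "c1 \<equiv> sqrt (2 * CARD('d) * pi powr (- real CARD('d))) * Gamma ((CARD('d) + 1) / 2)"
  defines "C2 \<equiv> max c0 (max 1 c1)"
  defines "\<Lambda> \<equiv> max 1 (2 * ridge_const TYPE('d) / c0)"
  defines "t \<equiv> t_star TYPE('d) k s m r"
  assumes M: "0 < M" and s: "0 < s" "s \<le> 1" and \<psi>: "orlicz_function \<psi>"
    and rk: "1 \<le> r k" and mk: "1 \<le> m k" and k: "1 \<le> k" and n: "1 \<le> n"
    and P: "(\<mu>, \<nu>) \<in> P_tv \<psi> M s r m" and t1: "t < 1" and \<psi>0: "0 < \<psi> (r k / M)"
  shows "expected_error (G_relu k (c_vec TYPE('d) k s m r) (r k)) n \<mu> \<nu>
    \<le> ennreal (40 * C2 * ((r k / t) ^ (CARD('d) + 2) / sqrt n)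
        + (2 / \<psi> (r k / M) + (2 * M * \<Lambda> * kernel_moment TYPE('d) * (m k * t powr s) + 2 * C2 * (r k ^ (CARD('d) + 1) / t ^ (CARD('d) + 2) / sqrt k))))"
proof -
  define a where "a = c_vec TYPE('d) k s m r"
  let ?X = "r k / t"
  have c0: "0 < c0" unfolding c0_def by (rule check_const_pos)
  have tpos: "0 < t" unfolding t_def t_star_def using rk mk k by simp
  have c1: "0 \<le> c1" unfolding c1_def by (intro mult_nonneg_nonneg) (auto intro!: less_imp_le[OF Gamma_real_pos] simp: add_pos_pos)
  have \<Lambda>: "1 \<le> \<Lambda>" "0 < \<Lambda>" by (auto simp: \<Lambda>_def)
  have X1: "1 \<le> ?X" using rk t1 tpos by simp
  let ?R = "r k ^ (CARD('d) + 1) / t ^ (CARD('d) + 2)"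
  have a_eq: "a = max (c0 * ?R) (max 1 (c1 / t))"
    by (simp add: a_def c_vec_def c_breve_def c_check_eq[OF tpos] t_def[symmetric] c0_def c1_def)
  have RX: "?R = ?X ^ (CARD('d) + 1) / t"
    using tpos by (simp add: power_divide)
  \<comment> \<open>Here \<open>t < 1\<close> enters: \<open>?R\<close> carries an additional factor
    \<open>1 / t\<close>.\<close>
  have XR: "?X ^ (CARD('d) + 1) \<le> ?R"
    unfolding RX using tpos t1 X1 by (simp add: pos_le_divide_eq mult_left_le)
  have R1: "1 / t \<le> ?R"
    unfolding RX using one_le_power[OF X1, of "CARD('d) + 1"] tpos by (intro divide_right_mono) auto
  have R1': "1 \<le> ?R" using one_le_power[OF X1, of "CARD('d) + 1"] XR by linarith
  have a0: "0 \<le> a" by (simp add: a_eq)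
  \<comment> \<open>Each term of the maximum in \<open>c_breve\<close> is at most a constant times
    \<open>?R\<close>, so the radius enters the error terms only through \<open>?R\<close>.\<close>
  have a_up: "a \<le> C2 * ?R"
  proof -
    have "c0 * ?R \<le> C2 * ?R" using R1' by (intro mult_right_mono) (auto simp: C2_def)
    moreover have "1 \<le> C2 * ?R" using mult_mono[of 1 C2 1 ?R] R1' by (simp add: C2_def)
    moreover have "c1 / t \<le> C2 * ?R"
    proof -
      have "c1 * (1 / t) \<le> C2 * ?R" using c1 R1 tpos by (intro mult_mono) (auto simp: C2_def)
      then show ?thesis by simp
    qed
    ultimately show ?thesis by (simp add: a_eq)
  qed
  have C2: "0 \<le> C2" by (simp add: C2_def)
  have a_low: "ridge_const TYPE('d) * ((r k / (\<Lambda> * t)) ^ CARD('d) * (r k / (\<Lambda> * t) + 1)) \<le> a"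
  proof -
    have e: "r k / (\<Lambda> * t) = ?X / \<Lambda>" by simp
    have "(?X / \<Lambda>) ^ CARD('d) \<le> ?X ^ CARD('d) / \<Lambda>"
    proof -
      \<comment> \<open>One power of \<open>\<Lambda>\<close> is kept and the others are dropped,
        which is possible because the dimension is at least 1.\<close>
      have "\<Lambda> ^ 1 \<le> \<Lambda> ^ CARD('d)" using \<Lambda> by (intro power_increasing) (auto simp: Suc_le_eq)
      then have "?X ^ CARD('d) / \<Lambda> ^ CARD('d) \<le> ?X ^ CARD('d) / \<Lambda>"
        using \<Lambda> X1 by (intro divide_left_mono) auto
      then show ?thesis by (simp only: power_divide[of ?X \<Lambda>])
    qed
    moreover have "?X / \<Lambda> + 1 \<le> 2 * ?X"
    proof -
      have "?X / \<Lambda> \<le> ?X / 1" using X1 \<Lambda> by (intro divide_left_mono) auto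
      then show ?thesis using X1 by linarith
    qed
    ultimately have "(?X / \<Lambda>) ^ CARD('d) * (?X / \<Lambda> + 1) \<le> (?X ^ CARD('d) / \<Lambda>) * (2 * ?X)"
      using X1 \<Lambda> rk tpos by (intro mult_mono) (auto intro!: divide_nonneg_nonneg add_nonneg_nonneg)
    then have "ridge_const TYPE('d) * ((?X / \<Lambda>) ^ CARD('d) * (?X / \<Lambda> + 1)) \<le> ridge_const TYPE('d) * ((?X ^ CARD('d) / \<Lambda>) * (2 * ?X))"
      by (intro mult_left_mono ridge_const_nonneg)
    also have "\<dots> = (2 * ridge_const TYPE('d) / \<Lambda>) * ?X ^ (CARD('d) + 1)"
      by (simp add: mult_ac)
    also have "\<dots> \<le> c0 * ?R"
    proof (intro mult_mono XR)
      have "2 * ridge_const TYPE('d) / c0 \<le> \<Lambda>" by (simp add: \<Lambda>_def)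
      then show "2 * ridge_const TYPE('d) / \<Lambda> \<le> c0"
        using c0 \<Lambda> by (simp add: field_simps)
    qed (use c0 X1 rk tpos in auto)
    also have "\<dots> \<le> a" by (simp add: a_eq)
    finally show ?thesis unfolding e .
  qed
  have \<Lambda>t: "0 < \<Lambda> * t" using \<Lambda> tpos by simp
  obtain g where g: "g \<in> ball_class k 1 (2 / real k * a) a a relu (r k)"
    "ennreal (tv_dist \<mu> \<nu> - (integral\<^sup>L \<mu> g - integral\<^sup>L \<nu> g))
      \<le> 2 * inverse (ennreal (\<psi> (r k / M))) + ennreal (2 * M * (m k * (\<Lambda> * t) powr s * kernel_moment TYPE('d)) + 2 * a / sqrt k)"
    using P_tv_bias[OF P \<psi> M s k rk _ \<Lambda>t a_low a0] mk by auto
  define \<beta> where "\<beta> = 2 / \<psi> (r k / M) + (2 * M * (m k * (\<Lambda> * t) powr s * kernel_moment TYPE('d)) + 2 * a / sqrt k)"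
  have km: "0 \<le> kernel_moment TYPE('d)" by (rule kernel_moment_nonneg)
  have rest0: "0 \<le> 2 * M * (m k * (\<Lambda> * t) powr s * kernel_moment TYPE('d)) + 2 * a / sqrt k"
    using M mk km a0 by simp
  have \<beta>0: "0 \<le> \<beta>" unfolding \<beta>_def by (rule add_nonneg_nonneg[OF _ rest0]) (use \<psi>0 in simp)
  have "2 * inverse (ennreal (\<psi> (r k / M))) = ennreal (2 / \<psi> (r k / M))"
    using \<psi>0 by (simp add: inverse_ennreal divide_inverse ennreal_mult)
  moreover have "ennreal \<beta> = ennreal (2 / \<psi> (r k / M)) + ennreal (2 * M * (m k * (\<Lambda> * t) powr s * kernel_moment TYPE('d)) + 2 * a / sqrt k)"
    unfolding \<beta>_def by (rule ennreal_plus[OF _ rest0]) (use \<psi>0 in simp)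
  ultimately have "ennreal (tv_dist \<mu> \<nu> - (integral\<^sup>L \<mu> g - integral\<^sup>L \<nu> g)) \<le> ennreal \<beta>"
    using g(2) by simp
  then have bias: "tv_dist \<mu> \<nu> - \<beta> \<le> integral\<^sup>L \<mu> g - integral\<^sup>L \<nu> g"
    using \<beta>0 by (simp add: ennreal_le_iff)
  have \<mu>\<nu>: "borel_prob \<mu>" "borel_prob \<nu>" using P by (auto simp: P_tv_def)
  have "expected_error (G_relu k a (r k)) n \<mu> \<nu>
    \<le> ennreal (2 * (4 * real k * (2 / real k * a) * (r k + 1) + 2 * a * r k + 2 * a) / sqrt n + \<beta>)"
    unfolding G_relu_eq
    by (rule expected_error_le[OF \<mu>\<nu> n _ _ _ _ g(1) bias \<beta>0]) (use rk a0 in auto)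
  also have "\<dots> \<le> ennreal (40 * C2 * (?X ^ (CARD('d) + 2) / sqrt n)
        + (2 / \<psi> (r k / M) + (2 * M * \<Lambda> * kernel_moment TYPE('d) * (m k * t powr s) + 2 * C2 * (?R / sqrt k))))"
  proof (intro ennreal_leI add_mono)
    \<comment> \<open>\<open>16 * a * (r k + 1)\<close> comes from the neurons, where
      \<open>k\<close> cancels, and \<open>4 * a * (r k + 1)\<close> from the affine part; then
      \<open>r k + 1 \<le> 2 * r k\<close> produces 40.\<close>
    have "2 * (4 * real k * (2 / real k * a) * (r k + 1) + 2 * a * r k + 2 * a) = 20 * a * (r k + 1)"
      using k by (simp add: algebra_simps)
    also have "\<dots> \<le> 20 * (C2 * ?R) * (2 * r k)"
      using a_up a0 rk by (intro mult_mono) auto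
    also have "\<dots> = 40 * C2 * ?X ^ (CARD('d) + 2)"
      using tpos by (simp add: power_divide)
    finally have "2 * (4 * real k * (2 / real k * a) * (r k + 1) + 2 * a * r k + 2 * a) / sqrt n \<le> 40 * C2 * ?X ^ (CARD('d) + 2) / sqrt n"
      by (intro divide_right_mono) auto
    then show "2 * (4 * real k * (2 / real k * a) * (r k + 1) + 2 * a * r k + 2 * a) / sqrt n \<le> 40 * C2 * (?X ^ (CARD('d) + 2) / sqrt n)"
      by simp
    have "(\<Lambda> * t) powr s \<le> \<Lambda> * t powr s"
    proof -
      have "\<Lambda> powr s \<le> \<Lambda> powr 1" using \<Lambda> s by (intro powr_mono) auto
      then show ?thesis using \<Lambda> tpos by (simp add: powr_mult mult_right_mono)
    qed
    then have "2 * M * (m k * (\<Lambda> * t) powr s * kernel_moment TYPE('d)) \<le> 2 * M * (m k * (\<Lambda> * t powr s) * kernel_moment TYPE('d))"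
      using M mk km by (intro mult_left_mono mult_right_mono) auto
    moreover have "2 * a / sqrt k \<le> 2 * C2 * (?R / sqrt k)"
      using divide_right_mono[OF a_up, of "sqrt k"] by simp
    ultimately show "\<beta> \<le> 2 / \<psi> (r k / M) + (2 * M * \<Lambda> * kernel_moment TYPE('d) * (m k * t powr s) + 2 * C2 * (?R / sqrt k))"
      unfolding \<beta>_def by (simp add: mult_ac)
  qed
  finally show ?thesis by (simp add: a_def)
qed

lemma expected_error_rate:
  fixes M s :: real
  assumes M: "0 < M" and s: "0 < s" "s \<le> 1"
  shows "\<exists>C :: real. 0 < C \<and>
          (\<forall>(\<psi> :: real \<Rightarrow> real) (r :: nat \<Rightarrow> real) (m :: nat \<Rightarrow> real) (k :: nat) (n :: nat).
             orlicz_function \<psi> \<longrightarrow>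
             mono_on {1..} r \<longrightarrow> (\<forall>j\<ge>1. 1 \<le> r j) \<longrightarrow> filterlim r at_top sequentially \<longrightarrow>
             mono_on {1..} m \<longrightarrow> (\<forall>j\<ge>1. 1 \<le> m j) \<longrightarrow>
             1 \<le> k \<longrightarrow> 1 \<le> n \<longrightarrow>
             (SUP (\<mu>, \<nu>) \<in> (P_tv \<psi> M s r m :: ((real ^ 'd::finite) measure \<times> (real ^ 'd) measure) set).
                expected_error (G_relu k (c_vec TYPE('d) k s m r) (r k)) n \<mu> \<nu>)
             \<le> ennreal C *
                (ennreal ((m k powr (CARD('d) + 2) * r k powr (s * (CARD('d) + 1))
                            * real k powr (- s / 2)) powr (1 / (s + CARD('d) + 2)))
                 + ennreal (real n powr (- 1 / 2)
                            * (m k * r k powr (s + 1) * real k powr (1 / 2))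
                                powr ((CARD('d) + 2) / (s + CARD('d) + 2)))
                 + inverse (ennreal (\<psi> (r k / M)))))"
proof -
  define c0 where "c0 = check_const TYPE('d)"
  define c1 where "c1 = sqrt (2 * CARD('d) * pi powr (- real CARD('d))) * Gamma ((CARD('d) + 1) / 2)"
  define C2 where "C2 = max c0 (max 1 c1)"
  define \<Lambda> where "\<Lambda> = max 1 (2 * ridge_const TYPE('d) / c0)"
  \<comment> \<open>The summand 2 serves both the trivial bound on the error and the two Orlicz
    tails. No ingredient depends on \<open>\<psi>\<close>, \<open>r\<close>, \<open>m\<close>,
    \<open>k\<close> or \<open>n\<close>.\<close>
  define C where "C = 2 + 40 * C2 + 2 * M * \<Lambda> * kernel_moment TYPE('d) + 2 * C2"
  have nn: "0 \<le> C2" "0 \<le> \<Lambda>" "0 \<le> kernel_moment TYPE('d)"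
    by (auto simp: C2_def \<Lambda>_def kernel_moment_nonneg)
  have parts: "0 \<le> 40 * C2" "0 \<le> 2 * M * \<Lambda> * kernel_moment TYPE('d)" "0 \<le> 2 * C2"
    using nn M by auto
  then have C: "2 \<le> C" "40 * C2 \<le> C" "2 * M * \<Lambda> * kernel_moment TYPE('d) + 2 * C2 \<le> C"
    unfolding C_def by linarith+
  show ?thesis
  proof (intro exI[of _ C] conjI allI impI)
    show "0 < C" using C by simp
    fix \<psi> :: "real \<Rightarrow> real" and r m :: "nat \<Rightarrow> real" and k n :: nat
    assume \<psi>: "orlicz_function \<psi>" and r: "\<forall>j\<ge>1. 1 \<le> r j" and m: "\<forall>j\<ge>1. 1 \<le> m j" and k: "1 \<le> k" and n: "1 \<le> n"
    have rk: "1 \<le> r k" and mk: "1 \<le> m k" using r m k by auto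
    let ?A = "(m k powr (CARD('d) + 2) * r k powr (s * (CARD('d) + 1)) * real k powr (- s / 2)) powr (1 / (s + CARD('d) + 2))"
    let ?B = "real n powr (- 1 / 2) * (m k * r k powr (s + 1) * real k powr (1 / 2)) powr ((CARD('d) + 2) / (s + CARD('d) + 2))"
    define t where "t = t_star TYPE('d) k s m r"
    have tpos: "0 < t" unfolding t_def t_star_def using rk mk k by simp
    have teq: "t = (r k powr (real CARD('d) + 1) * real k powr (- 1 / 2) / m k) powr (1 / (s + real CARD('d) + 2))"
      unfolding t_def t_star_def using rk powr_realpow[of "r k" "CARD('d) + 1"] by (simp add: add.commute)
    have kp: "0 < real k" using k by simp
    have mp: "0 < m k" "0 < r k" using mk rk by auto
    note ids = rate_identities[OF mp kp s(1) _ teq, simplified]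
    have A: "?A = m k * t powr s" using ids(1) by (simp add: add.commute)
    have B: "?B = (r k / t) ^ (CARD('d) + 2) / sqrt n"
    proof -
      have "(r k / t) powr (real CARD('d) + 2) = (r k / t) ^ (CARD('d) + 2)"
        using mp tpos powr_realpow[of "r k / t" "CARD('d) + 2"] by (simp add: add.commute)
      moreover have "real n powr (- 1 / 2) = 1 / sqrt n"
        using n by (simp add: powr_minus_divide powr_half_sqrt)
      ultimately show ?thesis using ids(2) by (simp add: add.commute)
    qed
    have R: "r k ^ (CARD('d) + 1) / t ^ (CARD('d) + 2) / sqrt k = m k * t powr s"
      using ids(3) mp tpos powr_realpow[of "r k" "CARD('d) + 1"] powr_realpow[of t "CARD('d) + 2"] by (simp add: add.commute)
    have "expected_error (G_relu k (c_vec TYPE('d) k s m r) (r k)) n \<mu> \<nu>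
        \<le> ennreal C * (ennreal ?A + ennreal ?B + inverse (ennreal (\<psi> (r k / M))))"
      if P: "(\<mu>, \<nu>) \<in> P_tv \<psi> M s r m" for \<mu> \<nu> :: "(real ^ 'd) measure"
    proof -
      have \<mu>\<nu>: "borel_prob \<mu>" "borel_prob \<nu>" using P by (auto simp: P_tv_def)
      have c: "0 \<le> c_vec TYPE('d) k s m r"
        by (simp add: c_vec_def c_breve_def)
      have le2: "expected_error (G_relu k (c_vec TYPE('d) k s m r) (r k)) n \<mu> \<nu> \<le> 2"
        unfolding G_relu_eq using c
        by (intro expected_error_le_2[OF \<mu>\<nu>] ball_class_nonempty ball_class_bounds) auto
      have \<psi>nn: "0 \<le> \<psi> (r k / M)" using \<psi> mp M by (simp add: orlicz_function_def)
      \<comment> \<open>The error never exceeds 2, which settles the first case; in the second the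
        right-hand side is infinite; in the third \<open>t \<ge> 1\<close> would give
        \<open>m k * t powr s \<ge> 1\<close>, against \<open>?A < 1\<close>.\<close>
      consider "1 \<le> ?A" | "\<psi> (r k / M) = 0" | "?A < 1" "0 < \<psi> (r k / M)"
        using \<psi>nn by linarith
      then show ?thesis
      proof cases
        case 1
        have "(2 :: ennreal) = ennreal 2 * ennreal 1" by simp
        also have "\<dots> \<le> ennreal C * (ennreal ?A + ennreal ?B + inverse (ennreal (\<psi> (r k / M))))"
          using C(1) ennreal_leI[OF 1] by (intro mult_mono ennreal_leI) (auto intro: order.trans add_increasing2 simp: add.assoc)
        finally show ?thesis using le2 by (rule order.trans[rotated])
      next
        case 2
        then show ?thesis using C(1) by (simp add: ennreal_mult_top ennreal_top_mult)
      next
        case 3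
        have "t < 1"
        proof (rule ccontr)
          assume "\<not> t < 1"
          then have "1 \<le> t powr s" using s by (intro ge_one_powr_ge_zero) auto
          then have "1 * 1 \<le> m k * t powr s" using mk by (intro mult_mono) auto
          then show False using 3(1) A by simp
        qed
        then have "expected_error (G_relu k (c_vec TYPE('d) k s m r) (r k)) n \<mu> \<nu>
          \<le> ennreal (40 * C2 * ?B + (2 / \<psi> (r k / M) + (2 * M * \<Lambda> * kernel_moment TYPE('d) * ?A + 2 * C2 * ?A)))"
          using expected_error_rate_small[OF M s \<psi> rk mk k n P _ 3(2), folded c0_def c1_def, folded C2_def \<Lambda>_def t_def]
          unfolding A B R by blast
        also have "\<dots> \<le> ennreal (C * (?A + ?B + 1 / \<psi> (r k / M)))"
        proof (rule ennreal_leI)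
          have nn: "0 \<le> ?A" "0 \<le> ?B" "0 \<le> 1 / \<psi> (r k / M)" using 3(2) by auto
          have "40 * C2 * ?B \<le> C * ?B" "2 * (1 / \<psi> (r k / M)) \<le> C * (1 / \<psi> (r k / M))"
            "(2 * M * \<Lambda> * kernel_moment TYPE('d) + 2 * C2) * ?A \<le> C * ?A"
            by (rule mult_right_mono[OF C(2) nn(2)], rule mult_right_mono[OF C(1) nn(3)], rule mult_right_mono[OF C(3) nn(1)])
          then show "40 * C2 * ?B + (2 / \<psi> (r k / M) + (2 * M * \<Lambda> * kernel_moment TYPE('d) * ?A + 2 * C2 * ?A)) \<le> C * (?A + ?B + 1 / \<psi> (r k / M))"
            by (simp add: distrib_left distrib_right)
        qed
        also have "\<dots> = ennreal C * (ennreal ?A + ennreal ?B + inverse (ennreal (\<psi> (r k / M))))"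
        proof -
          have "ennreal (?A + ?B + 1 / \<psi> (r k / M)) = ennreal ?A + ennreal ?B + inverse (ennreal (\<psi> (r k / M)))"
            using 3(2) by (simp add: ennreal_plus inverse_ennreal inverse_eq_divide add_nonneg_nonneg)
          then show ?thesis using C(1) 3(2) by (simp only: ennreal_mult' order.trans[OF _ C(1)] zero_le_numeral)
        qed
        finally show ?thesis .
      qed
    qed
    then show "(SUP (\<mu>, \<nu>) \<in> (P_tv \<psi> M s r m :: ((real ^ 'd) measure \<times> (real ^ 'd) measure) set).
        expected_error (G_relu k (c_vec TYPE('d) k s m r) (r k)) n \<mu> \<nu>)
        \<le> ennreal C * (ennreal ?A + ennreal ?B + inverse (ennreal (\<psi> (r k / M))))"
      by (intro SUP_least) (auto split: prod.split)
  qed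
qed

subsection \<open>Universal approximation with bounded weights\<close>

text \<open>Only the number of neurons is unbounded: large coefficients arise by repeating a neuron.\<close>

inductive ridge_comb :: "(real \<Rightarrow> real) \<Rightarrow> (real ^ 'd::finite \<Rightarrow> real) \<Rightarrow> bool" for \<phi> where
  zero: "ridge_comb \<phi> (\<lambda>_. 0)"
| add: "ridge_comb \<phi> f \<Longrightarrow> \<bar>c\<bar> \<le> 1 \<Longrightarrow> vec_norm1 w \<le> 1 \<Longrightarrow> \<bar>b\<bar> \<le> 1 \<Longrightarrow> ridge_comb \<phi> (\<lambda>x. f x + c * \<phi> (w \<bullet> x + b))"

lemma ridge_comb_plus:
  assumes "ridge_comb \<phi> g" "ridge_comb \<phi> f"
  shows "ridge_comb \<phi> (\<lambda>x. f x + g x)"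
  using assms
proof (induction rule: ridge_comb.induct)
  case (add g c w b)
  then have "ridge_comb \<phi> (\<lambda>x. (f x + g x) + c * \<phi> (w \<bullet> x + b))" by (intro ridge_comb.add) auto
  then show ?case by (simp add: add.assoc)
qed simp

lemma ridge_comb_atom:
  assumes "vec_norm1 w \<le> 1" "\<bar>b\<bar> \<le> 1"
  shows "ridge_comb \<phi> (\<lambda>x. c * \<phi> (w \<bullet> x + b))"
proof -
  have "ridge_comb \<phi> (\<lambda>x. (real n * e) * \<phi> (w \<bullet> x + b))" if "\<bar>e\<bar> \<le> 1" for n e
  proof (induction n)
    case (Suc n)
    have "ridge_comb \<phi> (\<lambda>x. (real n * e) * \<phi> (w \<bullet> x + b) + e * \<phi> (w \<bullet> x + b))"
      by (rule ridge_comb.add[OF Suc.IH that assms])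
    then show ?case by (simp add: algebra_simps)
  qed (simp add: ridge_comb.zero)
  moreover obtain n :: nat where n: "max \<bar>c\<bar> 1 \<le> real n" using real_arch_simple by blast
  then have "\<bar>c / n\<bar> \<le> 1" "real n \<noteq> 0" by (auto simp: divide_le_eq)
  ultimately have "ridge_comb \<phi> (\<lambda>x. (real n * (c / n)) * \<phi> (w \<bullet> x + b))" by blast
  then show ?thesis using \<open>real n \<noteq> 0\<close> by simp
qed

lemma ridge_comb_cmult:
  assumes "ridge_comb \<phi> f" shows "ridge_comb \<phi> (\<lambda>x. a * f x)"
  using assms
proof (induction rule: ridge_comb.induct)
  case (add f c w b)
  have "ridge_comb \<phi> (\<lambda>x. a * f x + (a * c) * \<phi> (w \<bullet> x + b))"
    by (intro ridge_comb_plus ridge_comb_atom add)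
  then show ?case by (simp add: algebra_simps)
qed (simp add: ridge_comb.zero)

text \<open>All large \<open>k\<close> are needed rather than one, since the number of neurons is
  prescribed by a sequence; spare neurons get output weight 0.\<close>

lemma ridge_comb_nn_params:
  assumes "ridge_comb \<phi> f"
  shows "\<exists>K. \<forall>k\<ge>K. \<exists>p \<in> nn_params k 1 1 1 0. nn_fun k \<phi> p = f"
  using assms
proof (induction rule: ridge_comb.induct)
  case zero
  have "nn_fun k \<phi> (\<lambda>_. 0, \<lambda>_. 0, \<lambda>_. 0, 0, 0) = (\<lambda>_. 0)" for k
    by (simp add: nn_fun_def)
  then show ?case
    by (intro exI[of _ 0] allI impI bexI[of _ "(\<lambda>_. 0, \<lambda>_. 0, \<lambda>_. 0, 0, 0)"]) (auto simp: nn_params_def vec_norm1_def)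
next
  case (add f c w b)
  then obtain K where K: "\<And>k. k \<ge> K \<Longrightarrow> \<exists>p \<in> nn_params k 1 1 1 0. nn_fun k \<phi> p = f" by blast
  show ?case
  proof (intro exI[of _ "Suc K"] allI impI)
    fix k assume "Suc K \<le> k"
    then obtain l where l: "k = Suc l" "K \<le> l" by (cases k) auto
    obtain \<beta> W B w0 b0 where p: "(\<beta>, W, B, w0, b0) \<in> nn_params l 1 1 1 0" "nn_fun l \<phi> (\<beta>, W, B, w0, b0) = f"
      using K[OF l(2)] by auto
    let ?p = "(\<beta>(k := c), W(k := w), B(k := b), w0, b0)"
    have "?p \<in> nn_params k 1 1 1 0"
      using p(1) add.hyps by (auto simp: nn_params_def l le_Suc_eq)
    moreover have "nn_fun k \<phi> ?p = (\<lambda>x. f x + c * \<phi> (w \<bullet> x + b))"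
    proof
      fix x
      have "(\<Sum>i = 1..l. (\<beta>(k := c)) i * \<phi> ((W(k := w)) i \<bullet> x + (B(k := b)) i)) = (\<Sum>i = 1..l. \<beta> i * \<phi> (W i \<bullet> x + B i))"
        by (intro sum.cong) (auto simp: l)
      then show "nn_fun k \<phi> ?p x = f x + c * \<phi> (w \<bullet> x + b)"
        unfolding p(2)[symmetric] by (simp add: nn_fun_def l)
    qed
    ultimately show "\<exists>p \<in> nn_params k 1 1 1 0. nn_fun k \<phi> p = (\<lambda>x. f x + c * \<phi> (w \<bullet> x + b))" by blast
  qed
qed

definition ridge_approx :: "(real \<Rightarrow> real) \<Rightarrow> (real ^ 'd::finite) set \<Rightarrow> (real ^ 'd \<Rightarrow> real) \<Rightarrow> bool" where
  "ridge_approx \<phi> S f \<longleftrightarrow> (\<forall>\<epsilon>>0. \<exists>g. ridge_comb \<phi> g \<and> (\<forall>x\<in>S. \<bar>f x - g x\<bar> \<le> \<epsilon>))"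

lemma ridge_approx_comb: "ridge_comb \<phi> f \<Longrightarrow> ridge_approx \<phi> S f"
  unfolding ridge_approx_def by (auto intro!: exI[of _ f])

lemma ridge_approx_add:
  assumes "ridge_approx \<phi> S f" "ridge_approx \<phi> S g"
  shows "ridge_approx \<phi> S (\<lambda>x. f x + g x)"
  unfolding ridge_approx_def
proof (intro allI impI)
  fix \<epsilon> :: real assume "0 < \<epsilon>"
  then have "0 < \<epsilon> / 2" by simp
  then obtain f' g' where "ridge_comb \<phi> f'" "\<forall>x\<in>S. \<bar>f x - f' x\<bar> \<le> \<epsilon> / 2" "ridge_comb \<phi> g'" "\<forall>x\<in>S. \<bar>g x - g' x\<bar> \<le> \<epsilon> / 2"
    using assms unfolding ridge_approx_def by metis
  moreover have "\<bar>f x + g x - (f' x + g' x)\<bar> \<le> \<epsilon>" if "\<bar>f x - f' x\<bar> \<le> \<epsilon> / 2" "\<bar>g x - g' x\<bar> \<le> \<epsilon> / 2" for x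
    using that by linarith
  ultimately show "\<exists>h. ridge_comb \<phi> h \<and> (\<forall>x\<in>S. \<bar>f x + g x - h x\<bar> \<le> \<epsilon>)"
    using ridge_comb_plus by (intro exI[of _ "\<lambda>x. f' x + g' x"]) blast
qed

lemma ridge_approx_cmult:
  assumes "ridge_approx \<phi> S f"
  shows "ridge_approx \<phi> S (\<lambda>x. c * f x)"
  unfolding ridge_approx_def
proof (intro allI impI)
  fix \<epsilon> :: real assume \<epsilon>: "0 < \<epsilon>"
  then have "0 < \<epsilon> / (\<bar>c\<bar> + 1)" by (simp add: add_nonneg_pos)
  then obtain f' where f': "ridge_comb \<phi> f'" "\<forall>x\<in>S. \<bar>f x - f' x\<bar> \<le> \<epsilon> / (\<bar>c\<bar> + 1)"
    using assms unfolding ridge_approx_def by metis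
  have "\<bar>c * f x - c * f' x\<bar> \<le> \<epsilon>" if "x \<in> S" for x
  proof -
    have "\<bar>c * f x - c * f' x\<bar> = \<bar>c\<bar> * \<bar>f x - f' x\<bar>" by (simp add: right_diff_distrib[symmetric] abs_mult)
    also have "\<dots> \<le> (\<bar>c\<bar> + 1) * (\<epsilon> / (\<bar>c\<bar> + 1))" using f'(2) that by (intro mult_mono) auto
    also have "\<dots> = \<epsilon>" by (simp add: add_nonneg_eq_0_iff)
    finally show ?thesis .
  qed
  then show "\<exists>h. ridge_comb \<phi> h \<and> (\<forall>x\<in>S. \<bar>c * f x - h x\<bar> \<le> \<epsilon>)"
    using ridge_comb_cmult[OF f'(1)] by blast
qed

text \<open>Closure under uniform limits, so that a target can be reached through intermediate
  functions that are not themselves combinations of neurons.\<close>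

lemma ridge_approx_limit:
  assumes "\<And>\<epsilon>. 0 < \<epsilon> \<Longrightarrow> \<exists>g. ridge_approx \<phi> S g \<and> (\<forall>x\<in>S. \<bar>f x - g x\<bar> \<le> \<epsilon>)"
  shows "ridge_approx \<phi> S f"
  unfolding ridge_approx_def
proof (intro allI impI)
  fix \<epsilon> :: real assume "0 < \<epsilon>"
  then have e: "0 < \<epsilon> / 2" by simp
  obtain g where g: "ridge_approx \<phi> S g" "\<forall>x\<in>S. \<bar>f x - g x\<bar> \<le> \<epsilon> / 2" using assms[OF e] by blast
  obtain h where "ridge_comb \<phi> h" "\<forall>x\<in>S. \<bar>g x - h x\<bar> \<le> \<epsilon> / 2" using g(1) e unfolding ridge_approx_def by blast
  moreover have "\<bar>f x - h x\<bar> \<le> \<epsilon>" if "\<bar>f x - g x\<bar> \<le> \<epsilon> / 2" "\<bar>g x - h x\<bar> \<le> \<epsilon> / 2" for x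
    using that by linarith
  ultimately show "\<exists>h. ridge_comb \<phi> h \<and> (\<forall>x\<in>S. \<bar>f x - h x\<bar> \<le> \<epsilon>)"
    using g(2) by blast
qed

lemma ridge_approx_sum:
  "(\<And>i. i \<in> I \<Longrightarrow> ridge_approx \<phi> S (f i)) \<Longrightarrow> ridge_approx \<phi> S (\<lambda>x. \<Sum>i\<in>I. f i x)"
proof (induction I rule: infinite_finite_induct)
  case (insert i I)
  then show ?case by (simp add: ridge_approx_add)
qed (auto intro: ridge_approx_comb ridge_comb.zero)

section \<open>Exponentials from rectifiers\<close>

lemma ridge_approx_relu_atom: "ridge_approx relu S (\<lambda>x. relu (w \<bullet> x + b))"
proof -
  \<comment> \<open>Positive homogeneity: dividing by \<open>L\<close> brings the parameters into
    range, and \<open>L\<close> returns as an output coefficient, which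
    \<open>ridge_comb_atom\<close> leaves unrestricted.\<close>
  define L where "L = max 1 (max (vec_norm1 w) \<bar>b\<bar>)"
  have L: "0 < L" "vec_norm1 w \<le> L" "\<bar>b\<bar> \<le> L" by (auto simp: L_def)
  have "vec_norm1 ((1 / L) *\<^sub>R w) \<le> 1" "\<bar>b / L\<bar> \<le> 1"
    using L by (auto simp: vec_norm1_def abs_mult sum_divide_distrib[symmetric] divide_le_eq)
  then have "ridge_approx relu S (\<lambda>x. L * relu (((1 / L) *\<^sub>R w) \<bullet> x + b / L))"
    by (intro ridge_approx_comb ridge_comb_atom)
  moreover have "L * relu (((1 / L) *\<^sub>R w) \<bullet> x + b / L) = relu (w \<bullet> x + b)" for x
  proof -
    have "((1 / L) *\<^sub>R w) \<bullet> x + b / L = (w \<bullet> x + b) / L" by (simp add: add_divide_distrib)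
    moreover have "L * relu (v / L) = relu v" for v
      using L(1) by (auto simp: relu_def max_def divide_le_0_iff)
    ultimately show ?thesis by simp
  qed
  ultimately show ?thesis by simp
qed

text \<open>Between two neighbouring grid points exactly one ramp is active, so the combination of ramps
  lies between the two grid values of the monotone function.\<close>

lemma exp_ramp_approx:
  fixes R :: real and N :: nat
  assumes R: "0 < R" and N: "1 \<le> N" and v: "\<bar>v\<bar> \<le> R"
  defines "h \<equiv> 2 * R / N"
  defines "u \<equiv> \<lambda>j::nat. - R + j * h"
  shows "\<bar>exp v - (exp (- R) + (\<Sum>j<N. (exp (u (Suc j)) - exp (u j)) * ((relu (v - u j) - relu (v - u (Suc j))) / h)))\<bar>
    \<le> exp R * (exp h - 1)"
proof -
  have h: "0 < h" using R N by (simp add: h_def)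
  define ramp where "ramp j = (relu (v - u j) - relu (v - u (Suc j))) / h" for j
  have uS: "u (Suc j) = u j + h" for j by (simp add: u_def algebra_simps)
  have u_mono: "u i \<le> u j" if "i \<le> j" for i j using that h by (simp add: u_def mult_right_mono)
  have u0: "u 0 = - R" by (simp add: u_def)
  have uN: "u N = R" using N by (simp add: u_def h_def)
  have ramp1: "ramp j = 1" if "u (Suc j) \<le> v" for j
    using that h unfolding ramp_def relu_def uS by auto
  have ramp0: "ramp j = 0" if "v \<le> u j" for j
    using that h unfolding ramp_def relu_def uS by auto
  have ramp_bd: "0 \<le> ramp j" "ramp j \<le> 1" for j
    using h unfolding ramp_def relu_def uS by (auto simp: divide_le_eq max_def)
  define d where "d j = exp (u (Suc j)) - exp (u j)" for j
  have d0: "0 \<le> d j" for j using u_mono[of j "Suc j"] by (simp add: d_def)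
  have "\<exists>J<N. u J \<le> v \<and> v \<le> u (Suc J)"
  \<comment> \<open>The right end point lies in none of the half-open cells located by the floor
    function, so it is assigned to the last cell.\<close>
  proof (cases "v = R")
    case True
    then show ?thesis using N uN u_mono[of "N - 1" N] by (intro exI[of _ "N - 1"]) auto
  next
    case False
    define J where "J = nat \<lfloor>(v + R) / h\<rfloor>"
    have Nh: "real N * h = 2 * R" using N by (simp add: h_def)
    have x: "0 \<le> (v + R) / h" "(v + R) / h < N"
      using v False h Nh by (auto simp: pos_divide_less_eq intro!: divide_nonneg_pos)
    have J: "real J \<le> (v + R) / h" "(v + R) / h < real J + 1" using x(1) by (auto simp: J_def)
    have "real J < real N" using J(1) x(2) by linarith
    then have "J < N" by simp
    moreover have "u J \<le> v" using J(1) h by (simp add: u_def pos_le_divide_eq)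
    moreover have "v \<le> u (Suc J)" using J(2) h by (simp add: u_def pos_divide_less_eq algebra_simps)
    ultimately show ?thesis by blast
  qed
  then obtain J where J: "J < N" "u J \<le> v" "v \<le> u (Suc J)" by blast
  have "(\<Sum>j<N. d j * ramp j) = (\<Sum>j<Suc J. d j * ramp j)"
  proof (rule sum.mono_neutral_right)
    show "\<forall>j\<in>{..<N} - {..<Suc J}. d j * ramp j = 0"
    proof
      fix j assume "j \<in> {..<N} - {..<Suc J}"
      then have "u (Suc J) \<le> u j" by (intro u_mono) auto
      then show "d j * ramp j = 0" using ramp0[of j] J(3) by simp
    qed
  qed (use J in auto)
  also have "\<dots> = (\<Sum>j<J. d j * ramp j) + d J * ramp J" by simp
  also have "(\<Sum>j<J. d j * ramp j) = (\<Sum>j<J. d j)"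
  proof (rule sum.cong)
    fix j assume "j \<in> {..<J}"
    then have "u (Suc j) \<le> v" using u_mono[of "Suc j" J] J(2) by auto
    then show "d j * ramp j = d j" using ramp1 by simp
  qed simp
  also have "(\<Sum>j<J. d j) = exp (u J) - exp (- R)"
    unfolding d_def u0[symmetric] by (rule sum_lessThan_telescope)
  finally have S: "exp (- R) + (\<Sum>j<N. d j * ramp j) = exp (u J) + d J * ramp J" by simp
  have "0 \<le> d J * ramp J" "d J * ramp J \<le> d J * 1"
    using d0[of J] ramp_bd[of J] by (auto intro: mult_left_le)
  moreover have "exp (u J) \<le> exp v" "exp v \<le> exp (u J) + d J"
    using J by (auto simp: d_def)
  ultimately have "\<bar>exp v - (exp (- R) + (\<Sum>j<N. d j * ramp j))\<bar> \<le> d J"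
    unfolding S abs_le_iff by (simp only: mult_1_right) linarith
  also have "d J = exp (u J) * (exp h - 1)" by (simp add: d_def uS exp_add algebra_simps)
  also have "\<dots> \<le> exp R * (exp h - 1)"
    using J v h by (intro mult_right_mono) auto
  finally show ?thesis by (simp add: d_def ramp_def)
qed

lemma compact_norm_bound:
  fixes S :: "(real ^ 'd::finite) set"
  assumes "compact S"
  obtains R where "0 < R" "\<And>x. x \<in> S \<Longrightarrow> norm x \<le> R"
  using compact_imp_bounded[OF assms] bounded_pos by metis

lemma ridge_approx_relu_exp:
  assumes S: "compact S"
  shows "ridge_approx relu S (\<lambda>x. exp (w \<bullet> x))"
proof (rule ridge_approx_limit)
  fix \<epsilon> :: real assume \<epsilon>: "0 < \<epsilon>"
  obtain R0 where R0: "0 < R0" "\<And>x. x \<in> S \<Longrightarrow> norm x \<le> R0" using compact_norm_bound[OF S] by blast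
  define R where "R = norm w * R0 + 1"
  have R: "0 < R" unfolding R_def using R0 by (simp add: add_nonneg_pos)
  have wx: "\<bar>w \<bullet> x\<bar> \<le> R" if "x \<in> S" for x
  proof -
    have "\<bar>w \<bullet> x\<bar> \<le> norm w * norm x" by (rule Cauchy_Schwarz_ineq2)
    also have "\<dots> \<le> norm w * R0" using R0(2)[OF that] by (intro mult_left_mono) auto
    finally show ?thesis by (simp add: R_def)
  qed
  have "(\<lambda>N. exp R * (exp (2 * R / real N) - 1)) \<longlonglongrightarrow> exp R * (exp 0 - 1)"
    by (intro tendsto_intros lim_const_over_n)
  then have "eventually (\<lambda>N. exp R * (exp (2 * R / real N) - 1) < \<epsilon>) sequentially"
    using \<epsilon> by (intro order_tendstoD(2)) auto
  then have "eventually (\<lambda>N. exp R * (exp (2 * R / real N) - 1) < \<epsilon> \<and> 1 \<le> N) sequentially"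
    using eventually_ge_at_top by (rule eventually_conj)
  then obtain N where N: "exp R * (exp (2 * R / real N) - 1) < \<epsilon>" "1 \<le> N"
    using eventually_happens by fastforce
  define h where "h = 2 * R / N"
  define u where "u j = - R + real j * h" for j :: nat
  \<comment> \<open>The constant \<open>exp (- R)\<close> is produced by the unit
    \<open>relu (0 \<bullet> x + 1)\<close>, as combinations consist of neurons only.\<close>
  define g where "g x = exp (- R) * relu (0 \<bullet> x + 1) + (\<Sum>j<N. ((exp (u (Suc j)) - exp (u j)) / h) * relu (w \<bullet> x + (- u j))
      + (- (exp (u (Suc j)) - exp (u j)) / h) * relu (w \<bullet> x + (- u (Suc j))))" for x
  have "ridge_approx relu S g"
    unfolding g_def by (intro ridge_approx_add ridge_approx_cmult ridge_approx_sum ridge_approx_relu_atom)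
  moreover have "\<bar>exp (w \<bullet> x) - g x\<bar> \<le> \<epsilon>" if "x \<in> S" for x
  proof -
    have "g x = exp (- R) + (\<Sum>j<N. (exp (u (Suc j)) - exp (u j)) * ((relu (w \<bullet> x - u j) - relu (w \<bullet> x - u (Suc j))) / h))"
      by (simp add: g_def relu_def diff_divide_distrib algebra_simps)
    then show ?thesis
      using exp_ramp_approx[OF R N(2) wx[OF that]] N(1) by (simp add: u_def h_def)
  qed
  ultimately show "\<exists>g. ridge_approx relu S g \<and> (\<forall>x\<in>S. \<bar>exp (w \<bullet> x) - g x\<bar> \<le> \<epsilon>)" by blast
qed

section \<open>Exponentials from sigmoids\<close>

primrec sigmoid_poly :: "nat \<Rightarrow> real poly" where
  "sigmoid_poly 0 = [:0, 1:]"
| "sigmoid_poly (Suc n) = pderiv (sigmoid_poly n) * [:0, 1, - 1:]"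

text \<open>The exact degree shows that the polynomial is nonzero and hence has finitely many roots,
  which later yields a bias at which a given derivative of \<open>sigmoid\<close> does not
  vanish.\<close>

lemma degree_sigmoid_poly: "degree (sigmoid_poly n) = Suc n"
proof (induction n)
  case (Suc n)
  have "pderiv (sigmoid_poly n) \<noteq> 0" using Suc by (simp add: pderiv_eq_0_iff)
  then have "degree (sigmoid_poly (Suc n)) = degree (pderiv (sigmoid_poly n)) + degree [:0, 1, - 1 :: real:]"
    unfolding sigmoid_poly.simps by (intro degree_mult_eq) auto
  then show ?case using Suc by (simp add: degree_pderiv)
qed simp

text \<open>Since the derivative of \<open>sigmoid\<close> is
  \<open>sigmoid * (1 - sigmoid)\<close>, all its derivatives are polynomials in
  \<open>sigmoid\<close> itself; the factor \<open>[:0, 1, - 1:]\<close> is the inner derivative of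
  the chain rule. So \<open>sigmoid_poly n\<close> describes the \<open>n\<close>-th
  derivative.\<close>

lemma sigmoid_poly_deriv:
  "((\<lambda>z. poly (sigmoid_poly n) (sigmoid z)) has_real_derivative poly (sigmoid_poly (Suc n)) (sigmoid z)) (at z)"
proof -
  have "((\<lambda>z. poly (sigmoid_poly n) (sigmoid z)) has_real_derivative poly (pderiv (sigmoid_poly n)) (sigmoid z) * (sigmoid z * (1 - sigmoid z))) (at z)"
    by (rule DERIV_chain2[OF poly_DERIV sigmoid_has_real_derivative])
  then show ?thesis by (simp add: algebra_simps)
qed

lemma sigmoid_poly_bounded: "\<exists>B. \<forall>z. \<bar>poly (sigmoid_poly n) (sigmoid z)\<bar> \<le> B"
proof -
  have "compact ((\<lambda>y. \<bar>poly (sigmoid_poly n) y\<bar>) ` {0..1})"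
    by (intro compact_continuous_image continuous_intros) auto
  then obtain B where "\<And>y. y \<in> {0..1} \<Longrightarrow> \<bar>poly (sigmoid_poly n) y\<bar> \<le> B"
    using compact_imp_bounded bounded_real by (metis (no_types, lifting) abs_abs image_eqI)
  then show ?thesis
    using sigmoid_bounds by (intro exI[of _ B] allI) (simp add: less_imp_le)
qed

text \<open>The constant is uniform in \<open>z\<close> because \<open>sigmoid\<close> takes values
  in the unit interval, on which the polynomial of the derivative two orders higher is
  bounded.\<close>

lemma sigmoid_poly_taylor:
  "\<exists>B\<ge>0. \<forall>z s. \<bar>poly (sigmoid_poly n) (sigmoid (z + s)) - poly (sigmoid_poly n) (sigmoid z) - s * poly (sigmoid_poly (Suc n)) (sigmoid z)\<bar> \<le> B * s\<^sup>2"
proof -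
  obtain B where B: "\<And>z. \<bar>poly (sigmoid_poly (Suc (Suc n))) (sigmoid z)\<bar> \<le> B"
    using sigmoid_poly_bounded[of "Suc (Suc n)"] by blast
  have B0: "0 \<le> B" using B[of 0] by linarith
  let ?G = "\<lambda>z. poly (sigmoid_poly n) (sigmoid z)" and ?G' = "\<lambda>z. poly (sigmoid_poly (Suc n)) (sigmoid z)"
  have lip: "\<bar>?G' y - ?G' z\<bar> \<le> B * \<bar>y - z\<bar>" for y z
  proof -
    have "norm (?G' y - ?G' z) \<le> B * norm (y - z)"
      by (rule field_differentiable_bound[of UNIV ?G' "\<lambda>z. poly (sigmoid_poly (Suc (Suc n))) (sigmoid z)"])
         (use B sigmoid_poly_deriv[of "Suc n"] in auto)
    then show ?thesis by simp
  qed
  have "\<bar>?G (z + s) - ?G z - s * ?G' z\<bar> \<le> B * s\<^sup>2" for z s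
  proof -
    have "norm ((?G (z + s) - (z + s) * ?G' z) - (?G z - z * ?G' z)) \<le> (B * \<bar>s\<bar>) * norm ((z + s) - z)"
    proof (rule field_differentiable_bound[of "closed_segment z (z + s)" _ "\<lambda>y. ?G' y - ?G' z"])
      show "((\<lambda>y. ?G y - y * ?G' z) has_field_derivative ?G' y - ?G' z) (at y within closed_segment z (z + s))" for y
        by (rule has_field_derivative_at_within, rule DERIV_cong[OF DERIV_diff[OF sigmoid_poly_deriv DERIV_cmult_right[OF DERIV_ident]]])
          (simp del: sigmoid_poly.simps)
      show "norm (?G' y - ?G' z) \<le> B * \<bar>s\<bar>" if "y \<in> closed_segment z (z + s)" for y
      proof -
        have "\<bar>y - z\<bar> \<le> \<bar>s\<bar>" using that by (auto simp: closed_segment_eq_real_ivl split: if_splits)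
        then have "B * \<bar>y - z\<bar> \<le> B * \<bar>s\<bar>" using B0 by (rule mult_left_mono)
        then show ?thesis using lip[of y z] by (simp del: sigmoid_poly.simps)
      qed
    qed auto
    then show ?thesis by (simp add: algebra_simps power2_eq_square del: sigmoid_poly.simps)
  qed
  then show ?thesis using B0 by blast
qed

text \<open>\<open>sigmoid\<close> is not homogeneous, so weights cannot be rescaled. Instead the
  scale \<open>l\<close> is differentiated: the \<open>n\<close>-th derivative of
  \<open>sigmoid (l * v + b)\<close> in \<open>l\<close> is \<open>v ^ n\<close> times the
  \<open>n\<close>-th derivative of \<open>sigmoid\<close>. The open condition on \<open>l\<close>
  leaves room for difference quotients that use admissible weights only.\<close>

lemma ridge_approx_sigmoid_deriv:
  assumes S: "compact S" and w: "vec_norm1 w \<le> 1" and b: "\<bar>b\<bar> \<le> 1" and l: "\<bar>l\<bar> < 1"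
  shows "ridge_approx sigmoid S (\<lambda>x. (w \<bullet> x) ^ n * poly (sigmoid_poly n) (sigmoid (l * (w \<bullet> x) + b)))"
  using l
proof (induction n arbitrary: l)
  case 0
  have "vec_norm1 (l *\<^sub>R w) = \<bar>l\<bar> * vec_norm1 w" by (simp add: vec_norm1_def abs_mult sum_distrib_left)
  also have "\<dots> \<le> 1 * 1" using 0 w vec_norm1_nonneg[of w] by (intro mult_mono) auto
  finally have "ridge_comb sigmoid (\<lambda>x. 1 * sigmoid ((l *\<^sub>R w) \<bullet> x + b))"
    using b by (intro ridge_comb_atom) auto
  then show ?case using ridge_approx_comb by simp
next
  case (Suc n)
  show ?case
  proof (rule ridge_approx_limit)
    fix \<epsilon> :: real assume \<epsilon>: "0 < \<epsilon>"
    obtain R0 where R0: "0 < R0" "\<And>x. x \<in> S \<Longrightarrow> norm x \<le> R0" using compact_norm_bound[OF S] by blast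
    have wx: "\<bar>w \<bullet> x\<bar> \<le> R0" if "x \<in> S" for x
      using abs_inner_le_vec_norm1[of w x] mult_mono[OF w R0(2)[OF that]] by simp
    obtain B where B: "0 \<le> B" "\<And>z s. \<bar>poly (sigmoid_poly n) (sigmoid (z + s)) - poly (sigmoid_poly n) (sigmoid z) - s * poly (sigmoid_poly (Suc n)) (sigmoid z)\<bar> \<le> B * s\<^sup>2"
      using sigmoid_poly_taylor by blast
    \<comment> \<open>The first bound keeps \<open>l + h\<close> inside the open interval, the
      second makes the Taylor error of the difference quotient at most \<open>\<epsilon>\<close>;
      the summand 1 avoids a zero denominator.\<close>
    define h where "h = min ((1 - \<bar>l\<bar>) / 2) (\<epsilon> / (R0 ^ n * (B * R0\<^sup>2) + 1))"
    have den: "0 < R0 ^ n * (B * R0\<^sup>2) + 1" using R0 B by (intro add_nonneg_pos mult_nonneg_nonneg) auto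
    have h: "0 < h" "\<bar>l + h\<bar> < 1" "h \<le> \<epsilon> / (R0 ^ n * (B * R0\<^sup>2) + 1)"
    proof -
      show "0 < h" using Suc.prems \<epsilon> den by (simp add: h_def)
      moreover have "h \<le> (1 - \<bar>l\<bar>) / 2" unfolding h_def by (rule min.cobounded1)
      ultimately show "\<bar>l + h\<bar> < 1" using Suc.prems by (auto simp: abs_if split: if_splits)
    qed (simp add: h_def)
    define F where "F l x = (w \<bullet> x) ^ n * poly (sigmoid_poly n) (sigmoid (l * (w \<bullet> x) + b))" for l x
    define g where "g x = (1 / h) * F (l + h) x + (- 1 / h) * F l x" for x
    have "ridge_approx sigmoid S g"
      unfolding g_def F_def by (intro ridge_approx_add ridge_approx_cmult Suc.IH h Suc.prems)
    moreover have "\<bar>(w \<bullet> x) ^ Suc n * poly (sigmoid_poly (Suc n)) (sigmoid (l * (w \<bullet> x) + b)) - g x\<bar> \<le> \<epsilon>" if x: "x \<in> S" for x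
    proof -
      define v where "v = w \<bullet> x"
      define z where "z = l * v + b"
      define T where "T = poly (sigmoid_poly n) (sigmoid (z + h * v)) - poly (sigmoid_poly n) (sigmoid z) - h * v * poly (sigmoid_poly (Suc n)) (sigmoid z)"
      have "v ^ Suc n * poly (sigmoid_poly (Suc n)) (sigmoid z) - g x = - (v ^ n * (T / h))"
        using h(1) unfolding g_def F_def T_def v_def[symmetric] z_def
        by (simp add: field_simps del: sigmoid_poly.simps)
      then have "\<bar>v ^ Suc n * poly (sigmoid_poly (Suc n)) (sigmoid z) - g x\<bar> = \<bar>v\<bar> ^ n * (\<bar>T\<bar> / h)"
        using h(1) by (simp add: abs_mult power_abs del: sigmoid_poly.simps)
      also have "\<dots> \<le> R0 ^ n * (B * (h * v)\<^sup>2 / h)"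
        using wx[OF x] B(2)[of z "h * v"] h(1) R0(1) unfolding v_def[symmetric] T_def
        by (intro mult_mono power_mono divide_right_mono) auto
      also have "B * (h * v)\<^sup>2 / h = h * (B * v\<^sup>2)"
        using h(1) by (simp add: power2_eq_square)
      also have "R0 ^ n * (h * (B * v\<^sup>2)) \<le> R0 ^ n * (h * (B * R0\<^sup>2))"
        using wx[OF x] B(1) h(1) R0(1) unfolding v_def[symmetric]
        by (intro mult_left_mono) (auto simp: abs_le_square_iff[symmetric])
      also have "\<dots> = h * (R0 ^ n * (B * R0\<^sup>2))" by simp
      also have "\<dots> \<le> h * (R0 ^ n * (B * R0\<^sup>2) + 1)" using h(1) by simp
      also have "\<dots> \<le> \<epsilon>" using h(3) den by (simp add: pos_le_divide_eq)
      finally show ?thesis by (simp only: v_def z_def)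
    qed
    ultimately show "\<exists>g. ridge_approx sigmoid S g \<and> (\<forall>x\<in>S. \<bar>(w \<bullet> x) ^ Suc n * poly (sigmoid_poly (Suc n)) (sigmoid (l * (w \<bullet> x) + b)) - g x\<bar> \<le> \<epsilon>)"
      by blast
  qed
qed

text \<open>At \<open>l = 0\<close> the functions of \<open>ridge_approx_sigmoid_deriv\<close> are
  \<open>(w \<bullet> x) ^ n\<close> times a constant. Some admissible bias makes it nonzero, as a
  nonzero polynomial cannot vanish at the infinitely many values of \<open>sigmoid\<close> on
  \<open>{- 1..1}\<close>. Homogeneity of the power then removes the restriction on
  \<open>w\<close>.\<close>

lemma ridge_approx_sigmoid_power:
  assumes S: "compact S"
  shows "ridge_approx sigmoid S (\<lambda>x. (w \<bullet> x) ^ n)"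
proof -
  have "\<exists>b. \<bar>b\<bar> \<le> 1 \<and> poly (sigmoid_poly n) (sigmoid b) \<noteq> 0"
  proof (rule ccontr)
    assume "\<not> ?thesis"
    then have "sigmoid ` {- 1..1} \<subseteq> {x. poly (sigmoid_poly n) x = 0}" by (auto simp: abs_le_iff)
    moreover have "finite {x. poly (sigmoid_poly n) x = 0}"
      using degree_sigmoid_poly[of n] by (intro poly_roots_finite) auto
    ultimately have "finite (sigmoid ` {- 1..1})" by (rule finite_subset)
    moreover have "inj_on sigmoid {- 1..1}"
    proof (rule inj_onI)
      fix x y assume "sigmoid x = sigmoid y"
      moreover have "1 + exp (- x) \<noteq> 0" "1 + exp (- y) \<noteq> 0" using exp_gt_zero[of "- x"] exp_gt_zero[of "- y"] by linarith+
      ultimately show "x = y" by (simp add: sigmoid_def field_simps)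
    qed
    ultimately have "finite {- 1..1 :: real}" by (simp add: finite_image_iff)
    then show False by (simp add: infinite_Icc)
  qed
  then obtain b where b: "\<bar>b\<bar> \<le> 1" "poly (sigmoid_poly n) (sigmoid b) \<noteq> 0" by blast
  define L where "L = max 1 (vec_norm1 w)"
  have L: "0 < L" "vec_norm1 w \<le> L" by (auto simp: L_def)
  have "vec_norm1 ((1 / L) *\<^sub>R w) \<le> 1"
    using L by (auto simp: vec_norm1_def abs_mult sum_divide_distrib[symmetric] divide_le_eq)
  then have "ridge_approx sigmoid S (\<lambda>x. (((1 / L) *\<^sub>R w) \<bullet> x) ^ n * poly (sigmoid_poly n) (sigmoid (0 * (((1 / L) *\<^sub>R w) \<bullet> x) + b)))"
    using b by (intro ridge_approx_sigmoid_deriv S) auto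
  then have "ridge_approx sigmoid S (\<lambda>x. (L ^ n / poly (sigmoid_poly n) (sigmoid b)) * ((((1 / L) *\<^sub>R w) \<bullet> x) ^ n * poly (sigmoid_poly n) (sigmoid (0 * (((1 / L) *\<^sub>R w) \<bullet> x) + b))))"
    by (rule ridge_approx_cmult)
  then show ?thesis using L b by (simp add: power_divide)
qed

text \<open>The exponential series converges uniformly on the bounded range of
  \<open>w \<bullet> x\<close> over \<open>S\<close>, and its partial sums are sums of
  powers.\<close>

lemma ridge_approx_sigmoid_exp:
  assumes S: "compact S"
  shows "ridge_approx sigmoid S (\<lambda>x. exp (w \<bullet> x))"
proof (rule ridge_approx_limit)
  fix \<epsilon> :: real assume \<epsilon>: "0 < \<epsilon>"
  obtain R0 where R0: "0 < R0" "\<And>x. x \<in> S \<Longrightarrow> norm x \<le> R0" using compact_norm_bound[OF S] by blast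
  define R where "R = norm w * R0"
  have wx: "\<bar>w \<bullet> x\<bar> \<le> R" if "x \<in> S" for x
  proof -
    have "\<bar>w \<bullet> x\<bar> \<le> norm w * norm x" by (rule Cauchy_Schwarz_ineq2)
    also have "\<dots> \<le> norm w * R0" using R0(2)[OF that] by (intro mult_left_mono) auto
    finally show ?thesis by (simp add: R_def)
  qed
  have "uniform_limit {- R..R} (\<lambda>N v. \<Sum>n<N. v ^ n /\<^sub>R fact n) (\<lambda>v. \<Sum>n. v ^ n /\<^sub>R fact n) sequentially"
  proof (rule Weierstrass_m_test)
    show "norm (v ^ n /\<^sub>R fact n) \<le> R ^ n /\<^sub>R fact n" if "v \<in> {- R..R}" for n and v :: real
      using that by (auto simp: abs_mult power_abs abs_le_iff intro!: mult_left_mono power_mono)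
    show "summable (\<lambda>n. R ^ n /\<^sub>R fact n)" by (rule summable_exp_generic)
  qed
  then have "eventually (\<lambda>N. \<forall>v\<in>{- R..R}. dist (\<Sum>n<N. v ^ n /\<^sub>R fact n) (\<Sum>n. v ^ n /\<^sub>R fact n) < \<epsilon>) sequentially"
    using \<epsilon> by (simp add: uniform_limit_iff)
  then obtain N where N: "\<And>v. v \<in> {- R..R} \<Longrightarrow> dist (\<Sum>n<N. v ^ n /\<^sub>R fact n) (\<Sum>n. v ^ n /\<^sub>R fact n) < \<epsilon>"
    using eventually_happens by fastforce
  define g where "g x = (\<Sum>n<N. inverse (fact n) * (w \<bullet> x) ^ n)" for x
  have "ridge_approx sigmoid S g"
    unfolding g_def by (intro ridge_approx_sum ridge_approx_cmult ridge_approx_sigmoid_power S)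
  moreover have "\<bar>exp (w \<bullet> x) - g x\<bar> \<le> \<epsilon>" if "x \<in> S" for x
  proof -
    have "w \<bullet> x \<in> {- R..R}" using wx[OF that] by (auto simp: abs_le_iff)
    from N[OF this] show ?thesis
      by (simp add: g_def exp_def dist_real_def abs_minus_commute less_imp_le)
  qed
  ultimately show "\<exists>g. ridge_approx sigmoid S g \<and> (\<forall>x\<in>S. \<bar>exp (w \<bullet> x) - g x\<bar> \<le> \<epsilon>)" by blast
qed

section \<open>Stone-Weierstrass for sums of exponentials\<close>

inductive exp_comb :: "(real ^ 'd::finite \<Rightarrow> real) \<Rightarrow> bool" where
  atom: "exp_comb (\<lambda>x. c * exp (w \<bullet> x))"
| plus: "exp_comb f \<Longrightarrow> exp_comb g \<Longrightarrow> exp_comb (\<lambda>x. f x + g x)"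

lemma exp_comb_mult:
  assumes "exp_comb f" "exp_comb g"
  shows "exp_comb (\<lambda>x. f x * g x)"
  using assms(1)
proof (induction rule: exp_comb.induct)
  case (atom c w)
  show ?case
    using assms(2)
  proof (induction rule: exp_comb.induct)
    case (atom c' w')
    have "exp_comb (\<lambda>x. (c * c') * exp ((w + w') \<bullet> x))" by (rule exp_comb.atom)
    then show ?case by (simp add: inner_add_left exp_add mult_ac)
  next
    case (plus f g)
    then show ?case using exp_comb.plus[OF plus.IH] by (simp add: distrib_left)
  qed
next
  case (plus f g)
  then show ?case using exp_comb.plus[OF plus.IH] by (simp add: distrib_right)
qed

text \<open>Exponentials of linear functionals are ridge functions closed under products; they
  contain the constants and separate \<open>x\<close> from \<open>y\<close> by the direction
  \<open>x - y\<close>. Hence it suffices that each activation approximates a single exponential,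
  and products of neurons never occur.\<close>

lemma universal_approximation:
  fixes S :: "(real ^ 'd::finite) set"
  assumes S: "compact S" and \<phi>: "\<phi> \<in> {sigmoid, relu}" and f: "continuous_on S f"
  shows "ridge_approx \<phi> S f"
proof (rule ridge_approx_limit)
  fix \<epsilon> :: real assume \<epsilon>: "0 < \<epsilon>"
  have "\<exists>g. exp_comb g \<and> (\<forall>x\<in>S. \<bar>f x - g x\<bar> < \<epsilon>)"
  proof (rule Stone_Weierstrass_HOL[OF S _ _ _ _ _ f \<epsilon>])
    show "exp_comb (\<lambda>x. c)" for c using exp_comb.atom[of c 0] by simp
    show "continuous_on S g" if "exp_comb g" for g
      using that by (induction rule: exp_comb.induct) (auto intro!: continuous_intros)
    show "exp_comb (\<lambda>x. g x + h x)" if "exp_comb g \<and> exp_comb h" for g h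
      using that by (auto intro: exp_comb.plus)
    show "exp_comb (\<lambda>x. g x * h x)" if "exp_comb g \<and> exp_comb h" for g h
      using that by (auto intro: exp_comb_mult)
    show "\<exists>g. exp_comb g \<and> g x \<noteq> g y" if "x \<in> S \<and> y \<in> S \<and> x \<noteq> y" for x y
    proof (intro exI[of _ "\<lambda>z. 1 * exp ((x - y) \<bullet> z)"] conjI exp_comb.atom)
      have "(x - y) \<bullet> x \<noteq> (x - y) \<bullet> y"
        using that inner_eq_zero_iff[of "x - y"] by (auto simp: inner_diff_right)
      then show "1 * exp ((x - y) \<bullet> x) \<noteq> 1 * exp ((x - y) \<bullet> y)" by simp
    qed
  qed
  then obtain g where g: "exp_comb g" "\<forall>x\<in>S. \<bar>f x - g x\<bar> < \<epsilon>" by blast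
  from g(1) have "ridge_approx \<phi> S g"
  proof (induction rule: exp_comb.induct)
    case (atom c w)
    show ?case using \<phi> ridge_approx_sigmoid_exp[OF S] ridge_approx_relu_exp[OF S]
      by (intro ridge_approx_cmult) auto
  qed (auto intro: ridge_approx_add)
  then show "\<exists>g. ridge_approx \<phi> S g \<and> (\<forall>x\<in>S. \<bar>f x - g x\<bar> \<le> \<epsilon>)"
    using g(2) by (auto intro: less_imp_le)
qed

subsection \<open>Almost sure consistency\<close>

text \<open>Stated for a finite index set \<open>I\<close>, because the two samples are parts of one
  independent family indexed by a sum type.\<close>

lemma hoeffding_sample_mean:
  fixes \<mu> :: "(real ^ 'd::finite) measure"
  assumes P: "prob_space P" and ind: "prob_space.indep_vars P (\<lambda>_. borel) Z I" and I: "finite I" "I \<noteq> {}"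
    and distr: "\<And>i. i \<in> I \<Longrightarrow> distr P borel (Z i) = \<mu>"
    and g[measurable]: "g \<in> borel_measurable borel" and gb: "\<And>x. \<bar>g x\<bar> \<le> 1" and \<epsilon>: "0 \<le> \<epsilon>"
  shows "{\<omega>\<in>space P. \<epsilon> \<le> \<bar>(\<Sum>i\<in>I. g (Z i \<omega>)) / card I - integral\<^sup>L \<mu> g\<bar>} \<in> sets P"
    and "measure P {\<omega>\<in>space P. \<epsilon> \<le> \<bar>(\<Sum>i\<in>I. g (Z i \<omega>)) / card I - integral\<^sup>L \<mu> g\<bar>} \<le> 2 * exp (- (real (card I) * \<epsilon>\<^sup>2 / 2))"
proof -
  interpret prob_space P by (rule P)
  have Zm: "Z i \<in> borel_measurable P" if "i \<in> I" for i
    using ind that unfolding indep_vars_def by blast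
  have gZ: "(\<lambda>\<omega>. g (Z i \<omega>)) \<in> borel_measurable P" if "i \<in> I" for i
    using Zm[OF that] by measurable
  obtain i0 where i0: "i0 \<in> I" using I by blast
  interpret H: Hoeffding_ineq_iid P I "\<lambda>i \<omega>. g (Z i \<omega>)" "\<lambda>\<omega>. g (Z i0 \<omega>)" "- 1" 1 "expectation (\<lambda>\<omega>. g (Z i0 \<omega>))"
  proof unfold_locales
    show "indep_vars (\<lambda>_. borel) (\<lambda>i \<omega>. g (Z i \<omega>)) I"
      by (rule indep_vars_compose2[OF ind]) measurable
    show "distr P borel (\<lambda>\<omega>. g (Z i \<omega>)) = distr P borel (\<lambda>\<omega>. g (Z i0 \<omega>))" if "i \<in> I" for i
    proof -
      have "distr P borel (\<lambda>\<omega>. g (Z j \<omega>)) = distr (distr P borel (Z j)) borel g" if "j \<in> I" for j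
        using Zm[OF that] by (subst distr_distr) (auto simp: comp_def)
      then show ?thesis using distr that i0 by simp
    qed
    show "AE \<omega> in P. g (Z i0 \<omega>) \<in> {- 1..1}" using gb by (auto simp: abs_le_iff minus_le_iff)
  qed (use I gZ[OF i0] in auto)
  have e: "expectation (\<lambda>\<omega>. g (Z i0 \<omega>)) = integral\<^sup>L \<mu> g"
    unfolding distr[OF i0, symmetric] using Zm[OF i0] by (subst integral_distr) auto
  show "{\<omega>\<in>space P. \<epsilon> \<le> \<bar>(\<Sum>i\<in>I. g (Z i \<omega>)) / card I - integral\<^sup>L \<mu> g\<bar>} \<in> sets P"
    using gZ by (intro borel_measurable_le borel_measurable_const borel_measurable_abs borel_measurable_diff borel_measurable_divide borel_measurable_sum) auto
  show "measure P {\<omega>\<in>space P. \<epsilon> \<le> \<bar>(\<Sum>i\<in>I. g (Z i \<omega>)) / card I - integral\<^sup>L \<mu> g\<bar>} \<le> 2 * exp (- (real (card I) * \<epsilon>\<^sup>2 / 2))"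
    using H.Hoeffding_ineq_abs_ge'[OF \<epsilon> _ I(2)] by (simp add: e)
qed

text \<open>A deviation of \<open>2 * \<epsilon>\<close> in the difference forces one of at least
  \<open>\<epsilon>\<close> in one of the samples; the two Hoeffding bounds add up to the factor
  4.\<close>

lemma iid_samples_deviation:
  fixes \<mu> \<nu> :: "(real ^ 'd::finite) measure"
  assumes iid: "iid_samples P \<mu> \<nu> X Y" and n: "1 \<le> n" and \<epsilon>: "0 \<le> \<epsilon>"
    and g: "g \<in> borel_measurable borel" "\<And>x. \<bar>g x\<bar> \<le> 1"
  defines "B \<equiv> {\<omega>\<in>space P. 2 * \<epsilon> \<le> \<bar>emp_diff n (\<lambda>i. X i \<omega>) (\<lambda>i. Y i \<omega>) g - (integral\<^sup>L \<mu> g - integral\<^sup>L \<nu> g)\<bar>}"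
  shows "B \<in> sets P" "measure P B \<le> 4 * exp (- (real n * \<epsilon>\<^sup>2 / 2))"
proof -
  interpret prob_space P using iid by (simp add: iid_samples_def)
  have ind: "indep_vars (\<lambda>_. borel) (case_sum X Y) UNIV"
    and dX: "\<And>i. distr P borel (X i) = \<mu>" and dY: "\<And>i. distr P borel (Y i) = \<nu>"
    using iid by (auto simp: iid_samples_def)
  define BX where "BX = {\<omega>\<in>space P. \<epsilon> \<le> \<bar>(\<Sum>i<n. g (X i \<omega>)) / n - integral\<^sup>L \<mu> g\<bar>}"
  define BY where "BY = {\<omega>\<in>space P. \<epsilon> \<le> \<bar>(\<Sum>i<n. g (Y i \<omega>)) / n - integral\<^sup>L \<nu> g\<bar>}"
  have indL: "indep_vars (\<lambda>_. borel) (case_sum X Y) (Inl ` {..<n})" and indR: "indep_vars (\<lambda>_. borel) (case_sum X Y) (Inr ` {..<n})"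
    by (auto intro: indep_vars_subset[OF ind])
  have ne: "finite (Inl ` {..<n})" "Inl ` {..<n} \<noteq> {}" "finite (Inr ` {..<n})" "Inr ` {..<n} \<noteq> {}"
    using n by (auto simp: lessThan_empty_iff)
  have c: "card (Inl ` {..<n}) = n" "card (Inr ` {..<n}) = n" by (auto simp: card_image)
  have s: "(\<Sum>i\<in>Inl ` {..<n}. g (case_sum X Y i \<omega>)) = (\<Sum>i<n. g (X i \<omega>))"
    "(\<Sum>i\<in>Inr ` {..<n}. g (case_sum X Y i \<omega>)) = (\<Sum>i<n. g (Y i \<omega>))" for \<omega>
    by (auto simp: sum.reindex)
  have dL: "distr P borel (case_sum X Y i) = \<mu>" if "i \<in> Inl ` {..<n}" for i
    using that dX by auto
  have dR: "distr P borel (case_sum X Y i) = \<nu>" if "i \<in> Inr ` {..<n}" for i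
    using that dY by auto
  have BX: "BX \<in> sets P" "measure P BX \<le> 2 * exp (- (real n * \<epsilon>\<^sup>2 / 2))"
    using hoeffding_sample_mean[OF prob_space_axioms indL ne(1,2) dL g \<epsilon>] unfolding BX_def c s by auto
  have BY: "BY \<in> sets P" "measure P BY \<le> 2 * exp (- (real n * \<epsilon>\<^sup>2 / 2))"
    using hoeffding_sample_mean[OF prob_space_axioms indR ne(3,4) dR g \<epsilon>] unfolding BY_def c s by auto
  have Xm: "X i \<in> borel_measurable P" "Y i \<in> borel_measurable P" for i
    using ind unfolding indep_vars_def by (metis UNIV_I sum.case)+
  have gX: "(\<lambda>\<omega>. g (X i \<omega>)) \<in> borel_measurable P" "(\<lambda>\<omega>. g (Y i \<omega>)) \<in> borel_measurable P" for i
    using measurable_compose[OF Xm(1) g(1)] measurable_compose[OF Xm(2) g(1)] by auto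
  show B: "B \<in> sets P"
    unfolding B_def emp_diff_def using gX by measurable
  have "B \<subseteq> BX \<union> BY"
  proof
    fix \<omega> assume \<omega>: "\<omega> \<in> B"
    have "emp_diff n (\<lambda>i. X i \<omega>) (\<lambda>i. Y i \<omega>) g = (\<Sum>i<n. g (X i \<omega>)) / n - (\<Sum>i<n. g (Y i \<omega>)) / n"
      by (simp add: emp_diff_def sum_subtractf diff_divide_distrib)
    with \<omega> show "\<omega> \<in> BX \<union> BY"
      unfolding B_def BX_def BY_def by auto
  qed
  then have "measure P B \<le> measure P (BX \<union> BY)"
    using BX(1) BY(1) by (intro finite_measure_mono) auto
  also have "\<dots> \<le> measure P BX + measure P BY" by (rule measure_Un_le[OF BX(1) BY(1)])
  finally show "measure P B \<le> 4 * exp (- (real n * \<epsilon>\<^sup>2 / 2))" using BX(2) BY(2) by linarith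
qed

text \<open>The linear term beats the entropy of order \<open>sqrt n * ln n\<close> by more than
  \<open>2 * ln n\<close>, so the terms are eventually below the inverse squares.\<close>

lemma summable_net_bound:
  fixes a b e :: real
  assumes "0 < a" "0 < b" "0 < e"
  shows "summable (\<lambda>n. exp (b * sqrt (real n) * ln (a * real n + 3) - e * real n))"
proof (rule summable_comparison_test_ev)
  have "eventually (\<lambda>n. b * sqrt (real n) * ln (a * real n + 3) - e * real n \<le> - 2 * ln (real n)) sequentially"
    using assms by real_asymp
  then show "eventually (\<lambda>n. norm (exp (b * sqrt (real n) * ln (a * real n + 3) - e * real n)) \<le> inverse (real n ^ 2)) sequentially"
    using eventually_gt_at_top[of 0]
  proof eventually_elim
    case (elim n)
    have "exp (b * sqrt (real n) * ln (a * real n + 3) - e * real n) \<le> exp (- 2 * ln (real n))"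
      using elim by simp
    also have "\<dots> = inverse (real n ^ 2)"
      using elim by (simp add: exp_minus exp_of_nat_mult[of 2, simplified])
    finally show ?case by simp
  qed
  show "summable (\<lambda>n. inverse (real n ^ 2))" by (rule inverse_power_summable) simp
qed

text \<open>The growth condition bounds \<open>k n\<close> by \<open>c * sqrt n\<close> and
  \<open>k n * r n\<close> by \<open>c\<^sup>2 * n\<close>. So the number of grid values per
  parameter grows at most linearly in \<open>n\<close> and the number of parameters like
  \<open>sqrt n\<close>: the logarithm of the size of the net is of order
  \<open>sqrt n * ln n\<close>, while the Hoeffding exponent is linear in \<open>n\<close>.\<close>

lemma uniform_deviation:
  fixes \<mu> \<nu> :: "(real ^ 'd::finite) measure" and k :: "nat \<Rightarrow> nat" and r :: "nat \<Rightarrow> real"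
  assumes \<mu>: "borel_prob \<mu>" and \<nu>: "borel_prob \<nu>" and \<phi>: "admissible_activation \<phi>"
    and k: "eventually (\<lambda>n. 1 \<le> k n) sequentially" and r: "eventually (\<lambda>n. 1 \<le> r n) sequentially"
    and c: "0 < c" and rate: "eventually (\<lambda>n. real (k n) * sqrt (r n) \<le> c * sqrt (real n)) sequentially"
    and iid: "iid_samples P \<mu> \<nu> X Y" and \<epsilon>: "0 < \<epsilon>"
  shows "AE \<omega> in P. eventually (\<lambda>n. \<forall>g \<in> G_star (k n) \<phi> (r n).
    \<bar>emp_diff n (\<lambda>i. X i \<omega>) (\<lambda>i. Y i \<omega>) g - (integral\<^sup>L \<mu> g - integral\<^sup>L \<nu> g)\<bar> \<le> 6 * \<epsilon>) sequentially"
proof -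
  interpret prob_space P using iid by (simp add: iid_samples_def)
  define D where "D = real CARD('d)"
  have D1: "1 \<le> D" unfolding D_def by (simp add: Suc_le_eq)
  define ok where "ok n \<longleftrightarrow> 1 \<le> n \<and> 1 \<le> k n \<and> 1 \<le> r n" for n
  define E where "E n = real (k n) * ((1 * (r n + 1) + 1) + 1 * (D * r n + 1)) + D * r n + 1" for n
  define N where "N n = (2 * nat \<lceil>1 / (\<epsilon> / E n)\<rceil> + 1) ^ (k n * (CARD('d) + 2) + CARD('d) + 1)" for n
  \<comment> \<open>Where \<open>ok n\<close> fails the empty set serves, so that a net can be
    chosen for every \<open>n\<close> at once.\<close>
  have "\<exists>F :: (real ^ 'd \<Rightarrow> real) set. finite F \<and> F \<subseteq> G_star (k n) \<phi> (r n) \<and> card F \<le> N n \<and> (ok n \<longrightarrow> (\<forall>g \<in> G_star (k n) \<phi> (r n). \<exists>f\<in>F. \<forall>x. \<bar>g x - f x\<bar> \<le> \<epsilon>))" for n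
  proof (cases "ok n")
    case True
    have E: "0 < E n" unfolding E_def using True D1 by (intro add_nonneg_pos add_nonneg_nonneg mult_nonneg_nonneg) (auto simp: ok_def)
    have d: "0 < \<epsilon> / E n" "0 \<le> r n" using E \<epsilon> True by (auto simp: ok_def)
    show ?thesis
    proof (rule ball_class_net[OF \<phi> d, of 1 1 1 1 0 "k n", where ?'d = 'd])
      fix F :: "(real ^ 'd \<Rightarrow> real) set"
      assume "finite F" "F \<subseteq> ball_class (k n) 1 1 1 0 \<phi> (r n)"
        "card F \<le> (2 * nat \<lceil>1 / (\<epsilon> / E n)\<rceil> + 1) ^ (k n * (CARD('d) + 2) + CARD('d) + 1)"
        "\<And>g. g \<in> ball_class (k n) 1 1 1 0 \<phi> (r n) \<Longrightarrow> \<exists>f\<in>F. \<forall>x. \<bar>g x - f x\<bar> \<le> \<epsilon> / E n * (real (k n) * (1 * (r n + 1) + 1 + 1 * (real CARD('d) * r n + 1)) + real CARD('d) * r n + 1)"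
      moreover have "\<epsilon> / E n * (real (k n) * (1 * (r n + 1) + 1 + 1 * (real CARD('d) * r n + 1)) + real CARD('d) * r n + 1) = \<epsilon>"
      proof -
        have "real (k n) * (1 * (r n + 1) + 1 + 1 * (real CARD('d) * r n + 1)) + real CARD('d) * r n + 1 = E n"
          by (simp only: E_def D_def)
        then show ?thesis using E by simp
      qed
      ultimately show ?thesis unfolding G_star_eq N_def by (intro exI[of _ F]) auto
    qed auto
  next
    case False
    then show ?thesis by (intro exI[of _ "{}"]) auto
  qed
  then obtain F :: "nat \<Rightarrow> (real ^ 'd \<Rightarrow> real) set" where F: "\<And>n. finite (F n)" "\<And>n. F n \<subseteq> G_star (k n) \<phi> (r n)" "\<And>n. card (F n) \<le> N n"
    "\<And>n g. ok n \<Longrightarrow> g \<in> G_star (k n) \<phi> (r n) \<Longrightarrow> \<exists>f\<in>F n. \<forall>x. \<bar>g x - f x\<bar> \<le> \<epsilon>"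
    by metis
  have G: "g \<in> borel_measurable borel" "\<bar>g x\<bar> \<le> 1" if "g \<in> G_star (k n) \<phi> (r n)" for g n and x :: "real ^ 'd"
    using that ball_class_measurable[OF \<phi>] ball_class_bounds unfolding G_star_eq by blast+
  define dev where "dev n g \<omega> = \<bar>emp_diff n (\<lambda>i. X i \<omega>) (\<lambda>i. Y i \<omega>) g - (integral\<^sup>L \<mu> g - integral\<^sup>L \<nu> g)\<bar>" for n g \<omega>
  define B where "B n g = {\<omega>\<in>space P. 2 * \<epsilon> \<le> dev n g \<omega>}" for n g
  define A where "A n = (if ok n then (\<Union>g\<in>F n. B n g) else {})" for n
  have Bm: "B n g \<in> sets P" "measure P (B n g) \<le> 4 * exp (- (real n * \<epsilon>\<^sup>2 / 2))" if "ok n" "g \<in> F n" for n g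
    using iid_samples_deviation[OF iid, of n \<epsilon> g] that \<epsilon> F(2)[of n] G[of g n] unfolding B_def dev_def ok_def by auto
  have Am: "A n \<in> sets P" for n
    using Bm(1) F(1) by (auto simp: A_def)
  have Abd: "measure P (A n) \<le> real (N n) * (4 * exp (- (real n * \<epsilon>\<^sup>2 / 2)))" for n
  proof (cases "ok n")
    case True
    have "measure P (\<Union>g\<in>F n. B n g) \<le> (\<Sum>g\<in>F n. measure P (B n g))"
      using Bm(1)[OF True] F(1) by (intro finite_measure_subadditive_finite) auto
    also have "\<dots> \<le> (\<Sum>g\<in>F n. 4 * exp (- (real n * \<epsilon>\<^sup>2 / 2)))"
      by (intro sum_mono Bm(2) True)
    also have "\<dots> \<le> real (N n) * (4 * exp (- (real n * \<epsilon>\<^sup>2 / 2)))"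
      using F(3)[of n] by (simp add: mult_right_mono)
    finally show ?thesis using True by (simp add: A_def)
  qed (simp add: A_def)
  define a where "a = 2 * (3 + 4 * D) * c\<^sup>2 / \<epsilon>"
  define b where "b = (2 * D + 3) * c"
  have ab: "0 < a" "0 < b" using c \<epsilon> D1 by (auto simp: a_def b_def intro!: divide_pos_pos mult_pos_pos)
  have Nbd: "eventually (\<lambda>n. real (N n) \<le> exp (b * sqrt (real n) * ln (a * real n + 3))) sequentially"
    using k r rate eventually_ge_at_top[of 1]
  proof eventually_elim
    case (elim n)
    have k1: "1 \<le> real (k n)" using elim by simp
    have sr: "1 \<le> sqrt (r n)" using elim by simp
    have k2: "real (k n) \<le> c * sqrt (real n)"
      using elim(3) mult_left_mono[OF sr, of "real (k n)"] by simp
    have s2: "sqrt (r n) \<le> c * sqrt (real n)"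
    proof -
      have "1 * sqrt (r n) \<le> real (k n) * sqrt (r n)"
        using k1 elim(2) by (intro mult_right_mono) auto
      then show ?thesis using elim(3) by simp
    qed
    have kr: "real (k n) * r n \<le> c\<^sup>2 * real n"
    proof -
      have "real (k n) * r n = (real (k n) * sqrt (r n)) * sqrt (r n)"
        using elim(2) by simp
      also have "\<dots> \<le> (c * sqrt (real n)) * (c * sqrt (real n))"
        by (rule mult_mono[OF elim(3) s2]) (use c elim(2) in auto)
      also have "\<dots> = (c * sqrt (real n))\<^sup>2" by (simp only: power2_eq_square)
      finally show ?thesis by (simp add: power_mult_distrib)
    qed
    have krr: "r n \<le> real (k n) * r n" "1 \<le> r n" "0 \<le> real (k n) * r n" "1 \<le> real (k n) * r n" "real (k n) \<le> real (k n) * r n"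
    proof -
      have "1 * 1 \<le> real (k n) * r n" by (intro mult_mono) (use k1 elim(2) in auto)
      then show "1 \<le> real (k n) * r n" by simp
    qed (use k1 elim(2) in \<open>auto simp: mult_le_cancel_right1 mult_le_cancel_left1\<close>)
    have E1: "E n \<le> (3 + 4 * D) * (real (k n) * r n)"
    proof -
      have "E n = (1 + D) * (real (k n) * r n) + 3 * real (k n) + D * r n + 1"
        by (simp add: E_def algebra_simps)
      also have "\<dots> \<le> (1 + D) * (real (k n) * r n) + 3 * (real (k n) * r n) + D * (real (k n) * r n) + 1 * (real (k n) * r n)"
        by (intro add_mono mult_left_mono krr order.refl, use D1 in simp_all, rule krr)
      also have "\<dots> = (5 + 2 * D) * (real (k n) * r n)" by (simp add: algebra_simps)
      also have "\<dots> \<le> (3 + 4 * D) * (real (k n) * r n)"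
        using krr D1 by (intro mult_right_mono) auto
      finally show ?thesis .
    qed
    have E0: "0 \<le> E n" unfolding E_def using elim(2) D1 by (intro add_nonneg_nonneg mult_nonneg_nonneg) auto
    have base: "real (2 * nat \<lceil>1 / (\<epsilon> / E n)\<rceil> + 1) \<le> a * real n + 3"
    proof -
      have "real (nat \<lceil>E n / \<epsilon>\<rceil>) \<le> E n / \<epsilon> + 1"
        using E0 \<epsilon> by (simp add: of_nat_nat)
      also have "E n / \<epsilon> \<le> (3 + 4 * D) * (c\<^sup>2 * real n) / \<epsilon>"
        using order.trans[OF E1 mult_left_mono[OF kr]] D1 \<epsilon> by (intro divide_right_mono) auto
      finally have "real (nat \<lceil>E n / \<epsilon>\<rceil>) \<le> (3 + 4 * D) * (c\<^sup>2 * real n) / \<epsilon> + 1" by simp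
      moreover have "a * real n = 2 * ((3 + 4 * D) * (c\<^sup>2 * real n) / \<epsilon>)" by (simp add: a_def)
      moreover have "real (2 * nat \<lceil>1 / (\<epsilon> / E n)\<rceil> + 1) = 2 * real (nat \<lceil>E n / \<epsilon>\<rceil>) + 1" by simp
      ultimately show ?thesis by linarith
    qed
    have L: "0 \<le> ln (a * real n + 3)" using ab(1) by (intro ln_ge_zero) simp
    have ex: "real (k n * (CARD('d) + 2) + CARD('d) + 1) \<le> b * sqrt (real n)"
    proof -
      have "real (k n * (CARD('d) + 2) + CARD('d) + 1) = real (k n) * (D + 2) + (D + 1) * 1" by (simp add: D_def distrib_left)
      also have "\<dots> \<le> real (k n) * (D + 2) + (D + 1) * real (k n)"
        using k1 D1 by (intro add_left_mono mult_left_mono) auto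
      also have "\<dots> = (2 * D + 3) * real (k n)" by (simp add: algebra_simps)
      also have "\<dots> \<le> (2 * D + 3) * (c * sqrt (real n))" using k2 D1 by (intro mult_left_mono) auto
      finally show ?thesis by (simp add: b_def)
    qed
    have pos: "0 < a * real n + 3" using ab(1) by (simp add: add_nonneg_pos)
    have "real (N n) = real (2 * nat \<lceil>1 / (\<epsilon> / E n)\<rceil> + 1) ^ (k n * (CARD('d) + 2) + CARD('d) + 1)"
      unfolding N_def by (rule of_nat_power)
    also have "\<dots> \<le> (a * real n + 3) ^ (k n * (CARD('d) + 2) + CARD('d) + 1)"
      using base by (intro power_mono) auto
    also have "\<dots> = exp (ln (a * real n + 3)) ^ (k n * (CARD('d) + 2) + CARD('d) + 1)"
      using pos by simp
    also have "\<dots> = exp (real (k n * (CARD('d) + 2) + CARD('d) + 1) * ln (a * real n + 3))"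
      by (rule exp_of_nat_mult[symmetric])
    also have "\<dots> \<le> exp (b * sqrt (real n) * ln (a * real n + 3))"
      using mult_right_mono[OF ex L] by simp
    finally show ?case .
  qed
  have "summable (\<lambda>n. measure P (A n))"
  proof (rule summable_comparison_test_ev)
    show "eventually (\<lambda>n. norm (measure P (A n)) \<le> 4 * exp (b * sqrt (real n) * ln (a * real n + 3) - \<epsilon>\<^sup>2 / 2 * real n)) sequentially"
      using Nbd
    proof eventually_elim
      case (elim n)
      have "measure P (A n) \<le> exp (b * sqrt (real n) * ln (a * real n + 3)) * (4 * exp (- (real n * \<epsilon>\<^sup>2 / 2)))"
        by (rule order.trans[OF Abd mult_right_mono[OF elim]]) simp
      also have "\<dots> = 4 * exp (b * sqrt (real n) * ln (a * real n + 3) - \<epsilon>\<^sup>2 / 2 * real n)"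
        unfolding diff_conv_add_uminus exp_add by (simp add: mult_ac)
      finally show ?case by simp
    qed
    show "summable (\<lambda>n. 4 * exp (b * sqrt (real n) * ln (a * real n + 3) - \<epsilon>\<^sup>2 / 2 * real n))"
      using ab \<epsilon> by (intro summable_mult summable_net_bound) auto
  qed
  then have "AE \<omega> in P. eventually (\<lambda>n. \<omega> \<in> space P - A n) sequentially"
    using Am by (intro borel_cantelli_AE1) (auto simp: less_top[symmetric])
  then show ?thesis
  proof eventually_elim
    case (elim \<omega>)
    have "eventually ok sequentially"
      unfolding ok_def using k r eventually_ge_at_top[of 1] by eventually_elim auto
    with elim show ?case
    proof eventually_elim
      case (elim n)
      show ?case
      proof
        fix g :: "real ^ 'd \<Rightarrow> real" assume g: "g \<in> G_star (k n) \<phi> (r n)"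
        obtain f where f: "f \<in> F n" "\<And>x. \<bar>g x - f x\<bar> \<le> \<epsilon>" using F(4)[OF elim(2) g] by blast
        have fG: "f \<in> G_star (k n) \<phi> (r n)" using f(1) F(2) by blast
        have "dev n f \<omega> < 2 * \<epsilon>" using elim f(1) by (auto simp: A_def B_def not_le)
        moreover have "\<bar>emp_diff n (\<lambda>i. X i \<omega>) (\<lambda>i. Y i \<omega>) g - emp_diff n (\<lambda>i. X i \<omega>) (\<lambda>i. Y i \<omega>) f\<bar> \<le> 2 * \<epsilon>"
          using abs_emp_diff_le[of "\<lambda>x. g x - f x" \<epsilon>] f(2) \<epsilon> by (simp add: emp_diff_diff)
        moreover have "\<bar>integral\<^sup>L Mi g - integral\<^sup>L Mi f\<bar> \<le> \<epsilon>" if Mi: "borel_prob Mi" for Mi :: "(real ^ 'd) measure"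
        proof -
          interpret Mi: prob_space Mi using Mi by (simp add: borel_prob_def)
          have i: "integrable Mi g" "integrable Mi f"
            using borel_prob_integrable[OF Mi] G[OF g] G[OF fG] by blast+
          have "\<bar>integral\<^sup>L Mi g - integral\<^sup>L Mi f\<bar> = \<bar>\<integral>x. g x - f x \<partial>Mi\<bar>" using i by simp
          also have "\<dots> \<le> (\<integral>x. \<bar>g x - f x\<bar> \<partial>Mi)" using i by (intro integral_abs_bound)
          also have "\<dots> \<le> \<epsilon>" using i f(2) by (intro Mi.integral_le_const) auto
          finally show ?thesis .
        qed
        from this[OF \<mu>] this[OF \<nu>] have "\<bar>integral\<^sup>L \<mu> g - integral\<^sup>L \<mu> f\<bar> \<le> \<epsilon>" "\<bar>integral\<^sup>L \<nu> g - integral\<^sup>L \<nu> f\<bar> \<le> \<epsilon>" .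
        \<comment> \<open>\<open>2 * \<epsilon>\<close> for the element of the net,
          \<open>2 * \<epsilon>\<close> for the change of the empirical means and
          \<open>\<epsilon>\<close> for each of the two integrals.\<close>
        ultimately show "\<bar>emp_diff n (\<lambda>i. X i \<omega>) (\<lambda>i. Y i \<omega>) g - (integral\<^sup>L \<mu> g - integral\<^sup>L \<nu> g)\<bar> \<le> 6 * \<epsilon>"
          unfolding dev_def by linarith
      qed
    qed
  qed
qed

section \<open>Networks that nearly attain the total variation\<close>

lemma compact_inner_approx:
  fixes \<mu> :: "(real ^ 'd::finite) measure"
  assumes \<mu>: "borel_prob \<mu>" and C: "C \<in> sets borel" and \<epsilon>: "0 < \<epsilon>"
  shows "\<exists>K. compact K \<and> K \<subseteq> C \<and> measure \<mu> (C - K) \<le> \<epsilon>"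
proof -
  interpret prob_space \<mu> using \<mu> by (simp add: borel_prob_def)
  have s: "sets \<mu> = sets borel" using \<mu> by (simp add: borel_prob_def)
  have reg: "emeasure \<mu> C = (SUP K \<in> {K. K \<subseteq> C \<and> compact K}. emeasure \<mu> K)"
    by (rule inner_regular[OF s _ C]) simp
  have "\<exists>K\<in>{K. K \<subseteq> C \<and> compact K}. measure \<mu> C - \<epsilon> < measure \<mu> K"
  proof (rule ccontr)
    assume "\<not> ?thesis"
    then have le: "measure \<mu> K \<le> measure \<mu> C - \<epsilon>" if "K \<subseteq> C" "compact K" for K using that by force
    \<comment> \<open>The empty compact set shows that the bound is nonnegative, so
      \<open>ennreal\<close> does not truncate it.\<close>
    have nn: "0 \<le> measure \<mu> C - \<epsilon>" using le[of "{}"] by simp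
    have "emeasure \<mu> C \<le> ennreal (measure \<mu> C - \<epsilon>)"
      unfolding reg using le by (intro SUP_least) (auto simp: emeasure_eq_measure intro: ennreal_leI)
    then show False using \<epsilon> nn by (simp add: emeasure_eq_measure)
  qed
  then obtain K where K: "K \<subseteq> C" "compact K" "measure \<mu> C - \<epsilon> < measure \<mu> K" by blast
  have "measure \<mu> (C - K) = measure \<mu> C - measure \<mu> K"
    using K C s by (intro finite_measure_Diff) (auto intro: borel_compact)
  then show ?thesis using K by auto
qed

text \<open>The measures are arbitrary, so the target is \<open>2 * 1_C - 1\<close> for a nearly
  optimal Borel set \<open>C\<close>. Inner regularity gives compact subsets of \<open>C\<close> and
  of its complement that carry almost all mass of both measures; on the union of these the target is
  continuous and can be approximated uniformly. The approximating combination does not depend on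
  \<open>n\<close>, so its clipped restriction to the ball of radius \<open>r n\<close> lies in the
  class once \<open>k n\<close> is large, and the ball contains the compact set once
  \<open>r n\<close> is large.\<close>

lemma G_star_tv_approx:
  fixes \<mu> \<nu> :: "(real ^ 'd::finite) measure" and k :: "nat \<Rightarrow> nat" and r :: "nat \<Rightarrow> real"
  assumes \<mu>: "borel_prob \<mu>" and \<nu>: "borel_prob \<nu>" and \<phi>: "\<phi> \<in> {sigmoid, relu}"
    and k: "filterlim k at_top sequentially" and r: "filterlim r at_top sequentially" and \<epsilon>: "0 < \<epsilon>"
  shows "eventually (\<lambda>n. \<exists>g \<in> G_star (k n) \<phi> (r n). tv_dist \<mu> \<nu> - 11 * \<epsilon> \<le> integral\<^sup>L \<mu> g - integral\<^sup>L \<nu> g) sequentially"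
proof -
  have adm: "admissible_activation \<phi>" using \<phi> admissible_sigmoid admissible_relu by auto
  have "\<exists>C\<in>sets borel. tv_dist \<mu> \<nu> - \<epsilon> < 2 * \<bar>measure \<mu> C - measure \<nu> C\<bar>"
  proof (rule ccontr)
    assume "\<not> ?thesis"
    then have "2 * \<bar>measure \<mu> C - measure \<nu> C\<bar> \<le> tv_dist \<mu> \<nu> - \<epsilon>" if "C \<in> sets borel" for C
      using that by force
    then have "tv_dist \<mu> \<nu> \<le> tv_dist \<mu> \<nu> - \<epsilon>"
      by (subst (1) tv_dist_def, intro cSUP_least) auto
    then show False using \<epsilon> by simp
  qed
  then obtain C0 where C0: "C0 \<in> sets borel" "tv_dist \<mu> \<nu> - \<epsilon> < 2 * \<bar>measure \<mu> C0 - measure \<nu> C0\<bar>" by blast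
  have compl: "measure Mi (- C0) = 1 - measure Mi C0" if Mi: "borel_prob Mi" for Mi :: "(real ^ 'd) measure"
  proof -
    interpret Mi: prob_space Mi using Mi by (simp add: borel_prob_def)
    have s: "sets Mi = sets borel" "space Mi = UNIV" using Mi sets_eq_imp_space_eq[of Mi borel] by (auto simp: borel_prob_def)
    show ?thesis using Mi.prob_compl[of C0] C0(1) s by (simp add: Compl_eq_Diff_UNIV)
  qed
  \<comment> \<open>Passing to the complement changes the sign of the difference and so removes the
    absolute value.\<close>
  have "\<exists>C\<in>sets borel. tv_dist \<mu> \<nu> - \<epsilon> \<le> 2 * (measure \<mu> C - measure \<nu> C)"
  proof (cases "measure \<nu> C0 \<le> measure \<mu> C0")
    case True
    then show ?thesis using C0 by (intro bexI[of _ C0]) auto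
  next
    case False
    then show ?thesis using C0 by (intro bexI[of _ "- C0"]) (auto simp: compl[OF \<mu>] compl[OF \<nu>])
  qed
  then obtain C where C: "C \<in> sets borel" "tv_dist \<mu> \<nu> - \<epsilon> \<le> 2 * (measure \<mu> C - measure \<nu> C)" by blast
  have C': "- C \<in> sets borel" using C(1) by simp
  obtain K1 K2 L1 L2 where K: "compact K1" "K1 \<subseteq> C" "measure \<mu> (C - K1) \<le> \<epsilon>" "compact K2" "K2 \<subseteq> C" "measure \<nu> (C - K2) \<le> \<epsilon>"
    "compact L1" "L1 \<subseteq> - C" "measure \<mu> (- C - L1) \<le> \<epsilon>" "compact L2" "L2 \<subseteq> - C" "measure \<nu> (- C - L2) \<le> \<epsilon>"
    using compact_inner_approx[OF \<mu> C(1) \<epsilon>] compact_inner_approx[OF \<nu> C(1) \<epsilon>]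
      compact_inner_approx[OF \<mu> C' \<epsilon>] compact_inner_approx[OF \<nu> C' \<epsilon>] by metis
  define A where "A = K1 \<union> K2"
  define B where "B = L1 \<union> L2"
  define S where "S = A \<union> B"
  have AB: "compact A" "compact B" "A \<subseteq> C" "B \<subseteq> - C" using K by (auto simp: A_def B_def)
  have S: "compact S" using AB by (auto simp: S_def)
  define f where "f x = 2 * indicat_real C x - 1" for x
  have "continuous_on S f"
    unfolding S_def
  proof (rule continuous_on_closed_Un)
    show "continuous_on A f" by (rule continuous_on_eq[OF continuous_on_const[of _ 1]]) (use AB in \<open>auto simp: f_def\<close>)
    show "continuous_on B f" by (rule continuous_on_eq[OF continuous_on_const[of _ "- 1"]]) (use AB in \<open>auto simp: f_def indicator_def\<close>)
  qed (use AB in \<open>auto intro: compact_imp_closed\<close>)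
  then obtain g where g: "ridge_comb \<phi> g" "\<And>x. x \<in> S \<Longrightarrow> \<bar>f x - g x\<bar> \<le> \<epsilon>"
    using universal_approximation[OF S \<phi>] \<epsilon> unfolding ridge_approx_def by blast
  obtain K where K0: "\<And>k. k \<ge> K \<Longrightarrow> \<exists>p \<in> nn_params k 1 1 1 0. nn_fun k \<phi> p = g"
    using ridge_comb_nn_params[OF g(1)] by blast
  obtain R where R: "0 < R" "\<And>x. x \<in> S \<Longrightarrow> norm x \<le> R" using compact_norm_bound[OF S] by blast
  have "eventually (\<lambda>n. K \<le> k n) sequentially" "eventually (\<lambda>n. R \<le> r n) sequentially"
    using k r by (auto simp: filterlim_at_top)
  then show ?thesis
  proof eventually_elim
    case (elim n)
    define h where "h = ball_fun (r n) g"
    obtain p where p: "p \<in> nn_params (k n) 1 1 1 0" "nn_fun (k n) \<phi> p = g" using K0[OF elim(1)] by blast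
    have hG: "h \<in> ball_class (k n) 1 1 1 0 \<phi> (r n)"
      unfolding h_def ball_class_def p(2)[symmetric] by (rule imageI[OF p(1)])
    have hm: "h \<in> borel_measurable borel" by (rule ball_class_measurable[OF adm hG])
    have hb: "\<bar>h x\<bar> \<le> 1" for x by (rule ball_class_bounds[OF hG])
    have fb: "\<bar>f x\<bar> \<le> 1" for x by (simp add: f_def indicator_def)
    have fm: "f \<in> borel_measurable borel" unfolding f_def[abs_def] using C(1) by measurable
    have close: "\<bar>h x - f x\<bar> \<le> \<epsilon> + 2 * indicat_real (- S) x" for x
    proof (cases "x \<in> S")
      case True
      then have "x \<in> cball 0 (r n)" using R(2)[of x] elim(2) by simp
      then have "h x - f x = clip (g x) - clip (f x)" by (simp add: h_def ball_fun_def clip_id fb)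
      then show ?thesis using clip_lipschitz[of "g x" "f x"] g(2)[OF True] True by simp
    next
      case False
      then show ?thesis using hb[of x] fb[of x] \<epsilon> by (simp add: abs_le_iff)
    qed
    \<comment> \<open>\<open>\<epsilon>\<close> from the uniform error on \<open>S\<close>, and
      twice the mass of the complement of \<open>S\<close>, which is at most
      \<open>2 * \<epsilon>\<close>.\<close>
    have int: "\<bar>integral\<^sup>L Mi h - (2 * measure Mi C - 1)\<bar> \<le> 5 * \<epsilon>"
      if Mi: "borel_prob Mi" and sm: "measure Mi (C - A) \<le> \<epsilon>" "measure Mi (- C - B) \<le> \<epsilon>" for Mi :: "(real ^ 'd) measure"
    proof -
      interpret Mi: prob_space Mi using Mi by (simp add: borel_prob_def)
      have s: "sets Mi = sets borel" "space Mi = UNIV" using Mi sets_eq_imp_space_eq[of Mi borel] by (auto simp: borel_prob_def)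
      have Ss: "S \<in> sets borel" "A \<in> sets borel" "B \<in> sets borel" using S AB by (auto intro: borel_compact)
      have i: "integrable Mi h" "integrable Mi f"
        using borel_prob_integrable[OF Mi hm hb] borel_prob_integrable[OF Mi fm fb] by auto
      have iC: "integrable Mi (indicat_real C)"
        using C(1) by (intro borel_prob_integrable[OF Mi, of _ 1]) auto
      have iS: "integrable Mi (indicat_real (- S))"
        using Ss by (intro borel_prob_integrable[OF Mi, of _ 1]) auto
      have If: "integral\<^sup>L Mi f = 2 * measure Mi C - 1"
        unfolding f_def using iC C(1) s Mi.prob_space by simp
      have "measure Mi (- S) \<le> measure Mi ((C - A) \<union> (- C - B))"
        using Ss C(1) s by (intro Mi.finite_measure_mono) (auto simp: S_def)
      also have "\<dots> \<le> measure Mi (C - A) + measure Mi (- C - B)"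
        using Ss C(1) s by (intro measure_Un_le) auto
      finally have mS: "measure Mi (- S) \<le> 2 * \<epsilon>" using sm by simp
      have "\<bar>integral\<^sup>L Mi h - integral\<^sup>L Mi f\<bar> = \<bar>\<integral>x. h x - f x \<partial>Mi\<bar>" using i by simp
      also have "\<dots> \<le> (\<integral>x. \<bar>h x - f x\<bar> \<partial>Mi)" using i by (intro integral_abs_bound)
      also have "\<dots> \<le> (\<integral>x. \<epsilon> + 2 * indicat_real (- S) x \<partial>Mi)"
        using i iS close by (intro integral_mono) auto
      also have "\<dots> = \<epsilon> + 2 * measure Mi (- S)"
        using iS Ss s Mi.prob_space by simp
      finally show ?thesis using mS unfolding If by linarith
    qed
    have mono: "measure Mi (U - V') \<le> measure Mi (U - V)" if "V \<subseteq> V'" "borel_prob Mi" "U \<in> sets borel" "V \<in> sets borel" for U V V' and Mi :: "(real ^ 'd) measure"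
    proof -
      interpret Mi: prob_space Mi using that by (simp add: borel_prob_def)
      show ?thesis using that by (intro Mi.finite_measure_mono) (auto simp: borel_prob_def)
    qed
    have Ks: "K1 \<in> sets borel" "K2 \<in> sets borel" "L1 \<in> sets borel" "L2 \<in> sets borel" using K by (auto intro: borel_compact)
    have "\<bar>integral\<^sup>L \<mu> h - (2 * measure \<mu> C - 1)\<bar> \<le> 5 * \<epsilon>"
      by (intro int \<mu> order.trans[OF mono K(3)] order.trans[OF mono K(9)] C C' Ks) (auto simp: A_def B_def)
    moreover have "\<bar>integral\<^sup>L \<nu> h - (2 * measure \<nu> C - 1)\<bar> \<le> 5 * \<epsilon>"
      by (intro int \<nu> order.trans[OF mono K(6)] order.trans[OF mono K(12)] C C' Ks) (auto simp: A_def B_def)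
    \<comment> \<open>\<open>5 * \<epsilon>\<close> for each measure and \<open>\<epsilon>\<close>
      for the choice of \<open>C\<close>.\<close>
    ultimately have "tv_dist \<mu> \<nu> - 11 * \<epsilon> \<le> integral\<^sup>L \<mu> h - integral\<^sup>L \<nu> h"
      using C(2) by (simp add: abs_le_iff)
    then show ?case using hG unfolding G_star_eq by blast
  qed
qed

text \<open>Uniform deviation controls the estimator from above together with
  \<open>integral_diff_le_tv_dist\<close>, and from below together with a nearly optimal network.
  Working with the tolerances \<open>1 / real (Suc j)\<close> keeps the exceptional null sets
  countable in number.\<close>

lemma tv_estimator_consistent:
  fixes \<mu> \<nu> :: "(real ^ 'd::finite) measure" and k :: "nat \<Rightarrow> nat" and r :: "nat \<Rightarrow> real"
  assumes \<mu>: "borel_prob \<mu>" and \<nu>: "borel_prob \<nu>" and \<phi>: "\<phi> \<in> {sigmoid, relu}" and \<rho>: "0 < \<rho>"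
    and k: "filterlim k at_top sequentially" and r: "filterlim r at_top sequentially"
    and rate: "(\<lambda>n. real (k n) * sqrt (r n)) \<in> O(\<lambda>n. real n powr ((1 - \<rho>) / 2))"
    and iid: "iid_samples P \<mu> \<nu> X Y"
  shows "AE \<omega> in P. (\<lambda>n. tv_estimator (G_star (k n) \<phi> (r n)) n (\<lambda>i. X i \<omega>) (\<lambda>i. Y i \<omega>)) \<longlonglongrightarrow> tv_dist \<mu> \<nu>"
proof -
  have adm: "admissible_activation \<phi>" using \<phi> admissible_sigmoid admissible_relu by auto
  have k1: "eventually (\<lambda>n. 1 \<le> k n) sequentially" and r1: "eventually (\<lambda>n. 1 \<le> r n) sequentially"
    using k r by (auto simp: filterlim_at_top)
  obtain c where c: "0 < c" "eventually (\<lambda>n. norm (real (k n) * sqrt (r n)) \<le> c * norm (real n powr ((1 - \<rho>) / 2))) sequentially"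
    using landau_o.bigE[OF rate] by blast
  have rate': "eventually (\<lambda>n. real (k n) * sqrt (r n) \<le> c * sqrt (real n)) sequentially"
    using c(2) eventually_ge_at_top[of 1]
  proof eventually_elim
    case (elim n)
    have "real n powr ((1 - \<rho>) / 2) \<le> real n powr (1 / 2)"
      using elim(2) \<rho> by (intro powr_mono) auto
    then have "c * real n powr ((1 - \<rho>) / 2) \<le> c * sqrt (real n)"
      using c(1) by (simp add: powr_half_sqrt)
    then show ?case using elim(1) by simp
  qed
  have "AE \<omega> in P. \<forall>j::nat. eventually (\<lambda>n. \<forall>g \<in> G_star (k n) \<phi> (r n).
    \<bar>emp_diff n (\<lambda>i. X i \<omega>) (\<lambda>i. Y i \<omega>) g - (integral\<^sup>L \<mu> g - integral\<^sup>L \<nu> g)\<bar> \<le> 6 * (1 / real (Suc j))) sequentially"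
    by (subst AE_all_countable, intro allI uniform_deviation[OF \<mu> \<nu> adm k1 r1 c(1) rate' iid]) simp
  then show ?thesis
  proof eventually_elim
    case (elim \<omega>)
    show ?case
    proof (rule LIMSEQ_I)
      fix e :: real assume e: "0 < e"
      \<comment> \<open>The lower bound loses \<open>11 * \<epsilon>\<close> and
        \<open>6 * \<epsilon>\<close>, the upper one \<open>6 * \<epsilon>\<close>; 18 in place of
        17 leaves some room.\<close>
      then obtain j :: nat where j: "inverse (real (Suc j)) < e / 18" using reals_Archimedean[of "e / 18"] by auto
      define \<epsilon> where "\<epsilon> = 1 / real (Suc j)"
      have \<epsilon>: "0 < \<epsilon>" "18 * \<epsilon> < e" using j by (auto simp: \<epsilon>_def inverse_eq_divide)
      have dev: "eventually (\<lambda>n. \<forall>g \<in> G_star (k n) \<phi> (r n).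
        \<bar>emp_diff n (\<lambda>i. X i \<omega>) (\<lambda>i. Y i \<omega>) g - (integral\<^sup>L \<mu> g - integral\<^sup>L \<nu> g)\<bar> \<le> 6 * \<epsilon>) sequentially"
        using elim by (simp only: \<epsilon>_def)
      have "eventually (\<lambda>n. norm (tv_estimator (G_star (k n) \<phi> (r n)) n (\<lambda>i. X i \<omega>) (\<lambda>i. Y i \<omega>) - tv_dist \<mu> \<nu>) < e) sequentially"
        using dev G_star_tv_approx[OF \<mu> \<nu> \<phi> k r \<epsilon>(1)]
      proof eventually_elim
        case (elim n)
        let ?G = "G_star (k n) \<phi> (r n) :: (real ^ 'd \<Rightarrow> real) set"
        let ?T = "tv_estimator ?G n (\<lambda>i. X i \<omega>) (\<lambda>i. Y i \<omega>)"
        have G: "g \<in> borel_measurable borel" "\<bar>g x\<bar> \<le> 1" if "g \<in> ?G" for g and x :: "real ^ 'd"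
          using that ball_class_measurable[OF adm] ball_class_bounds unfolding G_star_eq by blast+
        obtain g where g: "g \<in> ?G" "tv_dist \<mu> \<nu> - 11 * \<epsilon> \<le> integral\<^sup>L \<mu> g - integral\<^sup>L \<nu> g" using elim(2) by blast
        have "?T \<le> tv_dist \<mu> \<nu> + 6 * \<epsilon>"
        proof (rule tv_estimator_upper)
          fix h assume h: "h \<in> ?G"
          have "integral\<^sup>L \<mu> h - integral\<^sup>L \<nu> h \<le> tv_dist \<mu> \<nu>"
            by (rule integral_diff_le_tv_dist[OF \<mu> \<nu>]) (use G[OF h] in auto)
          then show "emp_diff n (\<lambda>i. X i \<omega>) (\<lambda>i. Y i \<omega>) h \<le> tv_dist \<mu> \<nu> + 6 * \<epsilon>"
            using bspec[OF elim(1) h] by (simp add: abs_le_iff)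
        qed (use g(1) in auto)
        moreover have "emp_diff n (\<lambda>i. X i \<omega>) (\<lambda>i. Y i \<omega>) g \<le> ?T"
          by (rule tv_estimator_lower) (use G g(1) in auto)
        moreover have "\<bar>emp_diff n (\<lambda>i. X i \<omega>) (\<lambda>i. Y i \<omega>) g - (integral\<^sup>L \<mu> g - integral\<^sup>L \<nu> g)\<bar> \<le> 6 * \<epsilon>"
          using elim(1) g(1) by blast
        ultimately have "\<bar>?T - tv_dist \<mu> \<nu>\<bar> < e" using g(2) \<epsilon> by linarith
        then show ?case by simp
      qed
      then show "\<exists>no. \<forall>n\<ge>no. norm (tv_estimator (G_star (k n) \<phi> (r n)) n (\<lambda>i. X i \<omega>) (\<lambda>i. Y i \<omega>) - tv_dist \<mu> \<nu>) < e"
        by (simp add: eventually_sequentially)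
    qed
  qed
qed

theorem theorem51:
  shows
    "(\<forall>(\<mu> :: (real ^ 'd::finite) measure) \<nu> \<phi> (\<rho> :: real) (k :: nat \<Rightarrow> nat) (r :: nat \<Rightarrow> real)
        (P :: 'w measure) X Y.
        borel_prob \<mu> \<longrightarrow> borel_prob \<nu> \<longrightarrow> \<phi> \<in> {sigmoid, relu} \<longrightarrow> 0 < \<rho> \<longrightarrow> \<rho> < 1 \<longrightarrow>
        filterlim k at_top sequentially \<longrightarrow> filterlim r at_top sequentially \<longrightarrow>
        (\<lambda>n. real (k n) * sqrt (r n)) \<in> O(\<lambda>n. real n powr ((1 - \<rho>) / 2)) \<longrightarrow>
        iid_samples P \<mu> \<nu> X Y \<longrightarrow>
        (AE \<omega> in P. (\<lambda>n. tv_estimator (G_star (k n) \<phi> (r n)) n (\<lambda>i. X i \<omega>) (\<lambda>i. Y i \<omega>))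
           \<longlonglongrightarrow> tv_dist \<mu> \<nu>))
     \<and>
     (\<forall>(M :: real) (s :: real). 0 < M \<longrightarrow> 0 < s \<longrightarrow> s \<le> 1 \<longrightarrow>
        (\<exists>C :: real. 0 < C \<and>
          (\<forall>(\<psi> :: real \<Rightarrow> real) (r :: nat \<Rightarrow> real) (m :: nat \<Rightarrow> real) (k :: nat) (n :: nat).
             orlicz_function \<psi> \<longrightarrow>
             mono_on {1..} r \<longrightarrow> (\<forall>j\<ge>1. 1 \<le> r j) \<longrightarrow> filterlim r at_top sequentially \<longrightarrow>
             mono_on {1..} m \<longrightarrow> (\<forall>j\<ge>1. 1 \<le> m j) \<longrightarrow>
             1 \<le> k \<longrightarrow> 1 \<le> n \<longrightarrow>
             (SUP (\<mu>, \<nu>) \<in> (P_tv \<psi> M s r m :: ((real ^ 'd) measure \<times> (real ^ 'd) measure) set).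
                expected_error (G_relu k (c_vec TYPE('d) k s m r) (r k)) n \<mu> \<nu>)
             \<le> ennreal C *
                (ennreal ((m k powr (CARD('d) + 2) * r k powr (s * (CARD('d) + 1))
                            * real k powr (- s / 2)) powr (1 / (s + CARD('d) + 2)))
                 + ennreal (real n powr (- 1 / 2)
                            * (m k * r k powr (s + 1) * real k powr (1 / 2))
                                powr ((CARD('d) + 2) / (s + CARD('d) + 2)))
                 + inverse (ennreal (\<psi> (r k / M)))))))"
  by (intro conjI allI impI tv_estimator_consistent expected_error_rate)

end
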